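(* Assume $\gamma_1>0$ and $\delta_1>0$. For every $s\ge1$ there is a constant $C_s>0$ depending only on $s$ (for fixed equation coefficients) such that the following holds for every nonzero $\eta_0\in H^s(\mathbb{R})$. Let $\eta$ be the solution, continuous in time with values in $H^s(\mathbb{R})$, of the initial value problem $$\partial_t\eta+\partial_x\eta-\gamma_1\partial_x^2\partial_t\eta+\gamma_2\partial_x^3\eta+\delta_1\partial_x^4\partial_t\eta+\delta_2\partial_x^5\eta+\tfrac34\partial_x(\eta^2)+\gamma\,\partial_x^3(\eta^2)-\tfrac{7}{48}\partial_x\big((\partial_x\eta)^2\big)-\tfrac18\partial_x(\eta^3)=0,\qquad \eta(x,0)=\eta_0(x).$$ (1) The maximal existence time $T=T_s$ of $\eta$ satisfies $$T\ge\bar T:=\frac{1}{8C_s\|\eta_0\|_{H^s}(1+\|\eta_0\|_{H^s})}.$$ (2) For every $t\in[0,\bar T]$, $\ \|\eta(\cdot,t)\|_{H^s}\le 2\|\eta_0\|_{H^s}$.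
   Context: Coefficients. Let $\theta\in[0,1]$ and $\lambda,\mu,\lambda_1,\mu_1,\rho\in\mathbb{R}$, and put $a=\frac12(\theta^2-\frac13)\lambda$, $b=\frac12(\theta^2-\frac13)(1-\lambda)$, $c=\frac12(1-\theta^2)\mu$, $d=\frac12(1-\theta^2)(1-\mu)$, $a_1=-\frac14(\theta^2-\frac13)^2(1-\lambda)+\frac5{24}(\theta^2-\frac15)^2\lambda_1$, $b_1=-\frac5{24}(\theta^2-\frac15)^2(1-\lambda_1)$, $c_1=\frac5{24}(1-\theta^2)(\theta^2-\frac15)(1-\mu_1)$, $d_1=-\frac14(1-\theta^2)^2\mu-\frac5{24}(1-\theta^2)(\theta^2-\frac15)\mu_1$. The real coefficients of the equation are $\gamma_1=\frac12(b+d-\rho)$, $\gamma_2=\frac12(a+c+\rho)$, $\delta_1=\frac14[2(b_1+d_1)-(b-d+\rho)(\frac16-a-d)-d(c-a+\rho)]$, $\delta_2=\frac14[2(a_1+c_1)-(c-a+\rho)(\frac16-a)+\frac13\rho]$, $\gamma=\frac1{24}[5-9(b+d)+9\rho]$. Functions are real-valued. Put $\varphi(\xi)=1+\gamma_1\xi^2+\delta_1\xi^4$ and let $\phi(\partial_x),\psi(\partial_x),\tau(\partial_x)$ be the Fourier multipliers (i.e. $\widehat{m(\partial_x)f}(\xi)=m(\xi)\widehat f(\xi)$) with symbols $\phi(\xi)=\frac{\xi(1-\gamma_2\xi^2+\delta_2\xi^4)}{\varphi(\xi)}$, $\psi(\xi)=\frac{\xi}{\varphi(\xi)}$, $\tau(\xi)=\frac{3\xi-4\gamma\xi^3}{4\varphi(\xi)}$.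 Let $S(t)$ be given by $\widehat{S(t)f}(\xi)=e^{-i\phi(\xi)t}\widehat f(\xi)$. A solution in $C([0,T];H^s)$ of the initial value problem is understood as a solution of the equivalent integral equation $$\eta(t)=S(t)\eta_0-i\int_0^tS(t-t')\Big(\tau(\partial_x)\eta^2-\tfrac18\psi(\partial_x)\eta^3-\tfrac7{48}\psi(\partial_x)\eta_x^2\Big)(t')\,dt'.$$ *)

theory Defs
  imports "HOL-Analysis.Analysis"
begin

text \<open>
  Functions on the line are represented by Borel representatives of their almost-everywhere
  classes; equality of functions is equality almost everywhere.
\<close>

section \<open>Fourier transform on the union of the spaces L1 and L2\<close>

definition L2 :: "(real \<Rightarrow> complex) set" where
  "L2 = {f. f \<in> borel_measurable lborel \<and> integrable lborel (\<lambda>x. (norm (f x))\<^sup>2)}"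

definition fourier_integral :: "(real \<Rightarrow> complex) \<Rightarrow> real \<Rightarrow> complex" where
  "fourier_integral f \<xi> =
     complex_of_real (1 / sqrt (2 * pi)) * (LINT x|lborel. exp (- (\<i> * of_real (x * \<xi>))) * f x)"

definition has_fourier_L2 :: "(real \<Rightarrow> complex) \<Rightarrow> (real \<Rightarrow> complex) \<Rightarrow> bool" where
  "has_fourier_L2 f g \<longleftrightarrow> f \<in> L2 \<and> g \<in> L2 \<and>
     ((\<lambda>R. \<integral>\<^sup>+ \<xi>. ennreal ((norm (fourier_integral (\<lambda>x. indicator {-R..R} x * f x) \<xi> - g \<xi>))\<^sup>2)
             \<partial>lborel) \<longlongrightarrow> 0) at_top"

text \<open>
  For a function which is in L2 but not in L1 the transform is determined only up to a null set.
  On the intersection of L1 and L2 the two notions agree almost everywhere. The case of L1 is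
  needed since the square of the derivative of a function in \<open>H\<^sup>1\<close> need not be in L2.
\<close>
definition fourier :: "(real \<Rightarrow> complex) \<Rightarrow> real \<Rightarrow> complex" where
  "fourier f = (if integrable lborel f then fourier_integral f else (SOME g. has_fourier_L2 f g))"

text \<open>The Fourier multiplier with symbol \<open>m\<close>, for \<open>f\<close> such that \<open>m\<close> times the transform of
  \<open>f\<close> is in L2.\<close>
definition multiplier :: "(real \<Rightarrow> complex) \<Rightarrow> (real \<Rightarrow> complex) \<Rightarrow> real \<Rightarrow> complex" where
  "multiplier m f = (SOME h. h \<in> L2 \<and> (AE \<xi> in lborel. fourier h \<xi> = m \<xi> * fourier f \<xi>))"

text \<open>The distributional derivative of a function in \<open>H\<^sup>1\<close>.\<close>
definition deriv_x :: "(real \<Rightarrow> complex) \<Rightarrow> real \<Rightarrow> complex" where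
  "deriv_x f = multiplier (\<lambda>\<xi>. \<i> * of_real \<xi>) f"


section \<open>Sobolev spaces of order \<open>s \<ge> 0\<close>\<close>

definition Hs :: "real \<Rightarrow> (real \<Rightarrow> complex) set" where
  "Hs s = {f \<in> L2. integrable lborel (\<lambda>\<xi>. (1 + \<xi>\<^sup>2) powr s * (norm (fourier f \<xi>))\<^sup>2)}"

text \<open>Only meaningful on \<open>Hs s\<close>: outside, the Lebesgue integral has a default value.\<close>
definition Hs_norm :: "real \<Rightarrow> (real \<Rightarrow> complex) \<Rightarrow> real" where
  "Hs_norm s f = sqrt (LINT \<xi>|lborel. (1 + \<xi>\<^sup>2) powr s * (norm (fourier f \<xi>))\<^sup>2)"

definition continuous_Hs :: "real \<Rightarrow> real set \<Rightarrow> (real \<Rightarrow> real \<Rightarrow> complex) \<Rightarrow> bool" where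
  "continuous_Hs s J u \<longleftrightarrow> (\<forall>t\<in>J. u t \<in> Hs s) \<and>
     (\<forall>t\<in>J. ((\<lambda>r. Hs_norm s (\<lambda>x. u r x - u t x)) \<longlongrightarrow> 0) (at t within J))"

text \<open>\<open>w\<close> is the Riemann integral of the \<open>H\<^sup>s\<close>-valued function \<open>F\<close> over \<open>[a, b]\<close>: the Riemann
  sums of \<open>F\<close> converge to \<open>w\<close> in the norm of \<open>H\<^sup>s\<close> as the mesh tends to 0. For continuous \<open>F\<close> this
  is the Bochner integral.\<close>
definition has_Hs_integral ::
    "real \<Rightarrow> (real \<Rightarrow> real \<Rightarrow> complex) \<Rightarrow> (real \<Rightarrow> complex) \<Rightarrow> real \<Rightarrow> real \<Rightarrow> bool" where
  "has_Hs_integral s F w a b \<longleftrightarrow> (\<forall>t\<in>{a..b}. F t \<in> Hs s) \<and> w \<in> Hs s \<and>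
     (\<forall>e>0. \<exists>d>0. \<forall>p. p tagged_division_of {a..b} \<and> (\<lambda>t. ball t d) fine p \<longrightarrow>
        Hs_norm s (\<lambda>x. (\<Sum>(t, K)\<in>p. of_real (measure lborel K) * F t x) - w x) < e)"


section \<open>The integral equation\<close>

context
  fixes \<gamma>\<^sub>1 \<gamma>\<^sub>2 \<delta>\<^sub>1 \<delta>\<^sub>2 \<gamma> :: real
begin

definition denom :: "real \<Rightarrow> real" where
  "denom \<xi> = 1 + \<gamma>\<^sub>1 * \<xi>^2 + \<delta>\<^sub>1 * \<xi>^4"

definition phi_symbol :: "real \<Rightarrow> real" where
  "phi_symbol \<xi> = \<xi> * (1 - \<gamma>\<^sub>2 * \<xi>^2 + \<delta>\<^sub>2 * \<xi>^4) / denom \<xi>"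

definition psi_symbol :: "real \<Rightarrow> real" where
  "psi_symbol \<xi> = \<xi> / denom \<xi>"

definition tau_symbol :: "real \<Rightarrow> real" where
  "tau_symbol \<xi> = (3 * \<xi> - 4 * \<gamma> * \<xi>^3) / (4 * denom \<xi>)"

definition evolution :: "real \<Rightarrow> (real \<Rightarrow> complex) \<Rightarrow> real \<Rightarrow> complex" where
  "evolution t = multiplier (\<lambda>\<xi>. exp (- (\<i> * of_real (phi_symbol \<xi> * t))))"

definition nonlinearity :: "(real \<Rightarrow> complex) \<Rightarrow> real \<Rightarrow> complex" where
  "nonlinearity f = (\<lambda>x.
     multiplier (\<lambda>\<xi>. of_real (tau_symbol \<xi>)) (\<lambda>y. (f y)^2) x
     - 1/8 * multiplier (\<lambda>\<xi>. of_real (psi_symbol \<xi>)) (\<lambda>y. (f y)^3) x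
     - 7/48 * multiplier (\<lambda>\<xi>. of_real (psi_symbol \<xi>)) (\<lambda>y. (deriv_x f y)^2) x)"

text \<open>\<open>\<eta>\<close> is a real-valued solution in \<open>C([0,T]; H\<^sup>s)\<close>; the first argument of \<open>\<eta>\<close> is time.\<close>
definition solution_on :: "real \<Rightarrow> (real \<Rightarrow> real) \<Rightarrow> real \<Rightarrow> (real \<Rightarrow> real \<Rightarrow> real) \<Rightarrow> bool" where
  "solution_on s \<eta>\<^sub>0 T \<eta> \<longleftrightarrow>
     continuous_Hs s {0..T} (\<lambda>t x. complex_of_real (\<eta> t x)) \<and>
     (\<forall>t\<in>{0..T}. \<exists>w.
        has_Hs_integral s
          (\<lambda>t'. evolution (t - t') (nonlinearity (\<lambda>x. complex_of_real (\<eta> t' x)))) w 0 t \<and>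
        (AE x in lborel. complex_of_real (\<eta> t x) =
           evolution t (\<lambda>y. complex_of_real (\<eta>\<^sub>0 y)) x - \<i> * w x))"

text \<open>\<open>\<eta>\<close> is a solution on \<open>[0,T)\<close> which is not the restriction of a solution on some \<open>[0,r]\<close>
  with \<open>r \<ge> T\<close>; that is, \<open>T\<close> is the maximal existence time of \<open>\<eta>\<close>.\<close>
definition maximal_solution ::
    "real \<Rightarrow> (real \<Rightarrow> real) \<Rightarrow> ereal \<Rightarrow> (real \<Rightarrow> real \<Rightarrow> real) \<Rightarrow> bool" where
  "maximal_solution s \<eta>\<^sub>0 T \<eta> \<longleftrightarrow>
     0 < T \<and> (\<forall>r>0. ereal r < T \<longrightarrow> solution_on s \<eta>\<^sub>0 r \<eta>) \<and>
     \<not> (\<exists>r \<zeta>. T \<le> ereal r \<and> solution_on s \<eta>\<^sub>0 r \<zeta> \<and>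
          (\<forall>t\<ge>0. ereal t < T \<longrightarrow> (AE x in lborel. \<zeta> t x = \<eta> t x)))"

end

end

theory Submission
  imports Defs "HOL-Probability.Probability"
begin

text \<open>
  On the Fourier side, multiplication by \<open>(1 + \<xi>\<^sup>2)\<^sup>s\<^sup>/\<^sup>2\<close> identifies \<open>H\<^sup>s\<close> with the Hilbert space of
  square-integrable functions, and the equation becomes an ordinary differential equation there.
  The linear group \<open>S(t)\<close> is multiplication by a unimodular function. In the unknown
  \<open>W(t) = S(-t) \<eta>(t)\<close> the integral equation reads \<open>W(t) = W(0) + \<integral> G(r, W(r)) dr\<close>, where \<open>G\<close> is the
  nonlinear term conjugated with the group.

  The nonlinear term maps \<open>H\<^sup>s\<close> to itself because the denominator of the symbols is comparable to
  \<open>1 + \<xi>\<^sup>4\<close>; this is where \<open>\<gamma>\<^sub>1 > 0\<close> and \<open>\<delta>\<^sub>1 > 0\<close> enter. So \<open>\<tau>\<close> gains one derivative and \<open>\<psi>\<close> gains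
  three. For \<open>f\<close> and \<open>g\<close> in \<open>H\<^sup>r\<close> with \<open>r \<ge> 0\<close>, the weighted transform of \<open>f g\<close> is bounded, with a bound
  proportional to the product of the norms (\<open>fourier_product_bound\<close>), and the factor
  \<open>(1 + \<xi>\<^sup>2)\<^sup>-\<^sup>1\<^sup>/\<^sup>2\<close>, which is square-integrable on the line, turns the bound into an estimate in the
  norm. Every term is of this kind: the square of \<open>\<eta>\<close> with \<open>r = s\<close>, the cube and the square of the
  derivative with \<open>r = s - 1\<close>. Since differences of squares and of cubes factor, the nonlinear term is
  Lipschitz on the ball of radius \<open>R\<close> with a constant \<open>K R (1 + R)\<close> (\<open>NL_Lipschitz\<close>), and \<open>K\<close> is the
  constant \<open>C\<^sub>s\<close> of the theorem.

  Picard iteration in the ball of radius \<open>2 N\<close> then gives a solution on an interval of length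
  \<open>1 / (8 K N (1 + N))\<close> (\<open>local_existence\<close>). By uniqueness every maximal solution coincides with it, and
  if the maximal time were at most the length of this interval, this solution would be a forbidden
  extension (\<open>maximal_solution_bounds\<close>). Solutions stay real-valued because the symbols of the nonlinear
  term are odd: the conjugation symmetry \<open>real_sym\<close> is preserved by the flow.

  The Fourier transform enters through Plancherel's theorem, the inversion formula, and the behaviour
  under modulation and conjugation. Plancherel's theorem is proved by Gaussian regularisation; the
  isometry and the multiplication formula together give inversion.
\<close>

section \<open>Square-integrable functions\<close>

lemma L2_measurable: "f \<in> L2 \<Longrightarrow> f \<in> borel_measurable borel"
  by (simp add: L2_def)

lemma L2_integrable: "f \<in> L2 \<Longrightarrow> integrable lborel (\<lambda>x. (norm (f x))\<^sup>2)"
  by (simp add: L2_def)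

lemma L2_I:
  assumes "f \<in> borel_measurable borel" "integrable lborel (\<lambda>x. (norm (f x))\<^sup>2)"
  shows "f \<in> L2"
  using assms by (simp add: L2_def)

lemma L2_dominated:
  assumes "f \<in> borel_measurable borel" "g \<in> L2" "AE x in lborel. norm (f x) \<le> c * norm (g x)"
  shows "f \<in> L2"
proof (rule L2_I)
  show "integrable lborel (\<lambda>x. (norm (f x))\<^sup>2)"
  proof (rule Bochner_Integration.integrable_bound)
    show "integrable lborel (\<lambda>x. c\<^sup>2 * (norm (g x))\<^sup>2)"
      using L2_integrable[OF assms(2)] by simp
    show "AE x in lborel. norm ((norm (f x))\<^sup>2) \<le> norm (c\<^sup>2 * (norm (g x))\<^sup>2)"
      using assms(3)
    proof eventually_elim
      case (elim x)
      then have "(norm (f x))\<^sup>2 \<le> (c * norm (g x))\<^sup>2" by (intro power_mono) auto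
      then show ?case by (simp add: power_mult_distrib)
    qed
  qed (use assms(1) in measurable)
qed (use assms in auto)

lemma L2_add:
  assumes "f \<in> L2" "g \<in> L2" shows "(\<lambda>x. f x + g x) \<in> L2"
proof (rule L2_I)
  note [measurable] = assms[THEN L2_measurable]
  show "integrable lborel (\<lambda>x. (norm (f x + g x))\<^sup>2)"
  proof (rule Bochner_Integration.integrable_bound)
    show "integrable lborel (\<lambda>x. 2 * (norm (f x))\<^sup>2 + 2 * (norm (g x))\<^sup>2)"
      using assms[THEN L2_integrable] by simp
    have "(norm (f x + g x))\<^sup>2 \<le> 2 * (norm (f x))\<^sup>2 + 2 * (norm (g x))\<^sup>2" for x
    proof -
      have "(norm (f x + g x))\<^sup>2 \<le> (norm (f x) + norm (g x))\<^sup>2"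
        by (intro power_mono norm_triangle_ineq) auto
      also have "\<dots> \<le> 2 * (norm (f x))\<^sup>2 + 2 * (norm (g x))\<^sup>2"
        using sum_squares_bound[of "norm (f x)" "norm (g x)"] by (simp add: power2_sum)
      finally show ?thesis .
    qed
    then show "AE x in lborel. norm ((norm (f x + g x))\<^sup>2) \<le> norm (2 * (norm (f x))\<^sup>2 + 2 * (norm (g x))\<^sup>2)"
      by auto
  qed measurable
  show "(\<lambda>x. f x + g x) \<in> borel_measurable borel" by measurable
qed

lemma L2_bounded_mult:
  assumes "f \<in> L2" "m \<in> borel_measurable borel" "\<And>x. norm (m x) \<le> c"
  shows "(\<lambda>x. m x * f x) \<in> L2"
  using L2_measurable[OF assms(1)] assms(2)
  by (intro L2_dominated[OF _ assms(1), where c = c])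
    (auto simp: norm_mult intro!: mult_right_mono assms(3))

lemma L2_cmult: "f \<in> L2 \<Longrightarrow> (\<lambda>x. c * f x) \<in> L2"
  by (rule L2_bounded_mult[where c = "norm c"]) auto

lemma L2_minus: "f \<in> L2 \<Longrightarrow> (\<lambda>x. - f x) \<in> L2"
  using L2_cmult[of f "-1"] by simp

lemma L2_diff: "f \<in> L2 \<Longrightarrow> g \<in> L2 \<Longrightarrow> (\<lambda>x. f x - g x) \<in> L2"
  using L2_add[OF _ L2_minus, of f g] by simp

lemma L2_zero: "(\<lambda>x. 0) \<in> L2"
  by (simp add: L2_def)

lemma cnj_measurable [measurable]: "cnj \<in> borel_measurable borel"
  by (intro borel_measurable_continuous_onI continuous_intros)

lemma L2_cnj: "f \<in> L2 \<Longrightarrow> (\<lambda>x. cnj (f x)) \<in> L2"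
proof (rule L2_dominated)
  assume f: "f \<in> L2"
  note [measurable] = L2_measurable[OF f]
  show "(\<lambda>x. cnj (f x)) \<in> borel_measurable borel" by measurable
  show "AE x in lborel. norm (cnj (f x)) \<le> 1 * norm (f x)" by simp
qed

lemma L2_mult_integrable:
  assumes "f \<in> L2" "g \<in> L2" shows "integrable lborel (\<lambda>x. f x * g x)"
proof (rule Bochner_Integration.integrable_bound)
  note [measurable] = assms[THEN L2_measurable]
  show "integrable lborel (\<lambda>x. (norm (f x))\<^sup>2 + (norm (g x))\<^sup>2)"
    using assms[THEN L2_integrable] by simp
  have "norm (f x) * norm (g x) \<le> (norm (f x))\<^sup>2 + (norm (g x))\<^sup>2" for x
    using sum_squares_bound[of "norm (f x)" "norm (g x)"]
      mult_nonneg_nonneg[OF norm_ge_zero[of "f x"] norm_ge_zero[of "g x"]] by linarith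
  then show "AE x in lborel. norm (f x * g x) \<le> norm ((norm (f x))\<^sup>2 + (norm (g x))\<^sup>2)"
    by (auto simp: norm_mult)
  show "(\<lambda>x. f x * g x) \<in> borel_measurable lborel" by measurable
qed

lemma inner_complex_eq: "x \<bullet> y = Re (x * cnj y)" for x y :: complex
  by (simp add: inner_complex_def)

lemma L2_inner_integrable:
  assumes "f \<in> L2" "g \<in> L2" shows "integrable lborel (\<lambda>x. f x \<bullet> g x)"
  unfolding inner_complex_eq
  by (rule integrable_Re[OF L2_mult_integrable[OF assms(1) L2_cnj[OF assms(2)]]])


section \<open>The Hilbert space of classes of square-integrable functions\<close>

text \<open>Almost everywhere equality is made into equality on a type, so that the notions of limit, integral
  and contraction for Banach spaces apply to Sobolev-space-valued functions of time.\<close>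
definition eq_L2 :: "(real \<Rightarrow> complex) \<Rightarrow> (real \<Rightarrow> complex) \<Rightarrow> bool" where
  "eq_L2 f g \<longleftrightarrow> f \<in> L2 \<and> g \<in> L2 \<and> (AE x in lborel. f x = g x)"

quotient_type l2 = "real \<Rightarrow> complex" / partial: eq_L2 morphisms rep_l2 cls
proof (rule part_equivpI)
  show "\<exists>x. eq_L2 x x" using L2_zero by (auto simp: eq_L2_def)
  show "symp eq_L2" by (auto simp: symp_def eq_L2_def elim: eventually_mono)
  show "transp eq_L2"
    by (auto simp: transp_def eq_L2_def elim!: eventually_elim2)
qed

lemma rep_l2_L2: "rep_l2 V \<in> L2"
  using Quotient3_rep_reflp[OF Quotient3_l2, of V] by (simp add: eq_L2_def)

lemma cls_rep_l2 [simp]: "cls (rep_l2 V) = V"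
  by (rule Quotient3_abs_rep[OF Quotient3_l2])

lemma cls_eq_iff:
  assumes "f \<in> L2" "g \<in> L2" shows "cls f = cls g \<longleftrightarrow> (AE x in lborel. f x = g x)"
  using Quotient3_rel[OF Quotient3_l2, of f g] assms by (auto simp: eq_L2_def)

lemma rep_l2_cls: "f \<in> L2 \<Longrightarrow> AE x in lborel. rep_l2 (cls f) x = f x"
  using cls_eq_iff[OF rep_l2_L2, of f "cls f"] by simp

lemma l2_cases: obtains f where "f \<in> L2" "V = cls f"
  using rep_l2_L2[of V] cls_rep_l2[of V] by metis

instantiation l2 :: real_inner
begin

lift_definition zero_l2 :: l2 is "\<lambda>x. 0"
  by (simp add: eq_L2_def L2_zero)

lift_definition plus_l2 :: "l2 \<Rightarrow> l2 \<Rightarrow> l2" is "\<lambda>f g x. f x + g x"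
  by (auto simp: eq_L2_def L2_add elim!: eventually_elim2)

lift_definition minus_l2 :: "l2 \<Rightarrow> l2 \<Rightarrow> l2" is "\<lambda>f g x. f x - g x"
  by (auto simp: eq_L2_def L2_diff elim!: eventually_elim2)

lift_definition uminus_l2 :: "l2 \<Rightarrow> l2" is "\<lambda>f x. - f x"
  by (auto simp: eq_L2_def L2_minus elim!: eventually_mono)

lift_definition scaleR_l2 :: "real \<Rightarrow> l2 \<Rightarrow> l2" is "\<lambda>r f x. of_real r * f x"
  by (auto simp: eq_L2_def L2_cmult elim!: eventually_mono)

lift_definition inner_l2 :: "l2 \<Rightarrow> l2 \<Rightarrow> real" is "\<lambda>f g. LBINT x. f x \<bullet> g x"
proof -
  fix f1 f2 g1 g2 assume "eq_L2 f1 f2" "eq_L2 g1 g2"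
  then have *: "AE x in lborel. f1 x = f2 x" "AE x in lborel. g1 x = g2 x"
    and L2: "f1 \<in> L2" "f2 \<in> L2" "g1 \<in> L2" "g2 \<in> L2"
    by (auto simp: eq_L2_def)
  note [measurable] = L2[THEN L2_measurable]
  show "(LBINT x. f1 x \<bullet> g1 x) = (LBINT x. f2 x \<bullet> g2 x)"
    using * by (intro integral_cong_AE) (auto elim: eventually_elim2)
qed

definition norm_l2 :: "l2 \<Rightarrow> real" where "norm_l2 V = sqrt (V \<bullet> V)"
definition sgn_l2 :: "l2 \<Rightarrow> l2" where "sgn_l2 V = scaleR (inverse (norm V)) V"
definition dist_l2 :: "l2 \<Rightarrow> l2 \<Rightarrow> real" where "dist_l2 V W = norm (V - W)"
definition uniformity_l2 :: "(l2 \<times> l2) filter" where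
  "uniformity_l2 = (INF e\<in>{0 <..}. principal {(x, y). dist x y < e})"
definition open_l2 :: "l2 set \<Rightarrow> bool" where
  "open_l2 U \<longleftrightarrow> (\<forall>x\<in>U. eventually (\<lambda>(x', y). x' = x \<longrightarrow> y \<in> U) uniformity)"

instance
proof
  fix U V W :: l2 and r q :: real
  show "U + V + W = U + (V + W)"
    by transfer (auto simp: eq_L2_def L2_add algebra_simps)
  show "U + V = V + U"
    by transfer (auto simp: eq_L2_def L2_add algebra_simps)
  show "0 + U = U"
    by transfer (auto simp: eq_L2_def)
  show "- U + U = 0"
    by transfer (auto simp: eq_L2_def L2_zero)
  show "U - V = U + - V"
    by transfer (auto simp: eq_L2_def L2_diff)
  show "r *\<^sub>R (U + V) = r *\<^sub>R U + r *\<^sub>R V"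
    by transfer (auto simp: eq_L2_def distrib_left intro!: L2_add L2_cmult)
  show "(r + q) *\<^sub>R U = r *\<^sub>R U + q *\<^sub>R U"
    by transfer (auto simp: eq_L2_def distrib_right intro!: L2_add L2_cmult)
  show "r *\<^sub>R q *\<^sub>R U = (r * q) *\<^sub>R U"
    by transfer (auto simp: eq_L2_def mult.assoc intro!: L2_cmult)
  show "1 *\<^sub>R U = U"
    by transfer (auto simp: eq_L2_def)
  show "dist U V = norm (U - V)" by (rule dist_l2_def)
  show "sgn U = inverse (norm U) *\<^sub>R U" by (rule sgn_l2_def)
  show "norm U = sqrt (U \<bullet> U)" by (rule norm_l2_def)
  show "(uniformity :: (l2 \<times> l2) filter) = (INF e\<in>{0 <..}. principal {(x, y). dist x y < e})"
    by (rule uniformity_l2_def)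
  show "\<And>U :: l2 set. open U = (\<forall>x\<in>U. eventually (\<lambda>(x', y). x' = x \<longrightarrow> y \<in> U) uniformity)"
    by (rule open_l2_def)
  show "U \<bullet> V = V \<bullet> U"
    by transfer (subst inner_commute, rule refl)
  show "(U + V) \<bullet> W = U \<bullet> W + V \<bullet> W"
    by transfer (auto simp: eq_L2_def inner_add_left L2_inner_integrable)
  show "(r *\<^sub>R U) \<bullet> V = r * (U \<bullet> V)"
  proof transfer
    fix r and f g :: "real \<Rightarrow> complex"
    have "(of_real r * f x) \<bullet> g x = r * (f x \<bullet> g x)" for x
      by (simp add: inner_complex_def algebra_simps)
    then show "(LBINT x. (of_real r * f x) \<bullet> g x) = r * (LBINT x. f x \<bullet> g x)"
      by simp
  qed
  show "0 \<le> U \<bullet> U"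
    by transfer simp
  show "U \<bullet> U = 0 \<longleftrightarrow> U = 0"
  proof transfer
    fix f assume "eq_L2 f f"
    then have f: "f \<in> L2" by (simp add: eq_L2_def)
    have "(LBINT x. f x \<bullet> f x) = 0 \<longleftrightarrow> (AE x in lborel. f x \<bullet> f x = 0)"
      by (rule integral_nonneg_eq_0_iff_AE[OF L2_inner_integrable[OF f f]]) auto
    then show "((LBINT x. f x \<bullet> f x) = 0) = eq_L2 f (\<lambda>x. 0)"
      using f L2_zero by (simp add: eq_L2_def)
  qed
qed

end


lemma cls_add: "f \<in> L2 \<Longrightarrow> g \<in> L2 \<Longrightarrow> cls (\<lambda>x. f x + g x) = cls f + cls g"
  by (simp add: plus_l2.abs_eq eq_L2_def)

lemma cls_diff: "f \<in> L2 \<Longrightarrow> g \<in> L2 \<Longrightarrow> cls (\<lambda>x. f x - g x) = cls f - cls g"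
  by (simp add: minus_l2.abs_eq eq_L2_def)

lemma cls_scaleR: "f \<in> L2 \<Longrightarrow> cls (\<lambda>x. of_real r * f x) = r *\<^sub>R cls f"
  by (simp add: scaleR_l2.abs_eq eq_L2_def)

lemma cls_zero: "cls (\<lambda>x. 0) = 0"
  by (simp add: zero_l2_def)

lemma inner_cls: "f \<in> L2 \<Longrightarrow> g \<in> L2 \<Longrightarrow> cls f \<bullet> cls g = (LBINT x. f x \<bullet> g x)"
  by (simp add: inner_l2.abs_eq eq_L2_def)

lemma norm_cls: "f \<in> L2 \<Longrightarrow> norm (cls f) = sqrt (LBINT x. (norm (f x))\<^sup>2)"
  by (simp add: norm_eq_sqrt_inner[of "cls f"] inner_cls power2_norm_eq_inner)

lemma norm_cls_sq: "f \<in> L2 \<Longrightarrow> (norm (cls f))\<^sup>2 = (LBINT x. (norm (f x))\<^sup>2)"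
  by (simp add: norm_cls)

lemma nn_integral_norm_cls:
  "f \<in> L2 \<Longrightarrow> (\<integral>\<^sup>+x. ennreal ((norm (f x))\<^sup>2) \<partial>lborel) = ennreal ((norm (cls f))\<^sup>2)"
  by (simp add: norm_cls_sq nn_integral_eq_integral[OF L2_integrable])

text \<open>The squares of the differences of consecutive terms have integrals at most \<open>4\<^sup>-\<^sup>k\<close>, and with weights
  \<open>2\<^sup>k\<close> these are still summable; so almost everywhere the differences are \<open>O(2\<^sup>-\<^sup>k\<^sup>/\<^sup>2)\<close> and the sequence
  converges pointwise. Fatou's lemma turns this into convergence in the norm.\<close>
lemma fast_Cauchy_L2_converges:
  fixes f :: "nat \<Rightarrow> real \<Rightarrow> complex"
  assumes f: "\<And>k. f k \<in> L2"
    and fast: "\<And>k m. k \<le> m \<Longrightarrow> (\<integral>\<^sup>+x. ennreal ((norm (f m x - f k x))\<^sup>2) \<partial>lborel) \<le> ennreal ((1/4)^k)"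
  shows "\<exists>g\<in>L2. \<forall>k. (\<integral>\<^sup>+x. ennreal ((norm (g x - f k x))\<^sup>2) \<partial>lborel) \<le> ennreal ((1/4)^k)"
proof -
  note [measurable] = f[THEN L2_measurable]
  have "(\<integral>\<^sup>+x. (\<Sum>k. ennreal (2^k * (norm (f (Suc k) x - f k x))\<^sup>2)) \<partial>lborel)
      = (\<Sum>k. \<integral>\<^sup>+x. ennreal (2^k * (norm (f (Suc k) x - f k x))\<^sup>2) \<partial>lborel)"
    by (intro nn_integral_suminf) measurable
  also have "\<dots> \<le> (\<Sum>k. ennreal ((1/2)^k))"
  proof (intro suminf_le allI)
    fix k
    have "(\<integral>\<^sup>+x. ennreal (2^k * (norm (f (Suc k) x - f k x))\<^sup>2) \<partial>lborel)
        = ennreal (2^k) * (\<integral>\<^sup>+x. ennreal ((norm (f (Suc k) x - f k x))\<^sup>2) \<partial>lborel)"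
      by (subst nn_integral_cmult[symmetric]) (auto simp: ennreal_mult)
    also have "\<dots> \<le> ennreal (2^k) * ennreal ((1/4)^k)"
      by (intro mult_left_mono fast) auto
    also have "\<dots> = ennreal ((1/2)^k)"
      by (subst ennreal_mult[symmetric]) (auto simp flip: power_mult_distrib)
    finally show "(\<integral>\<^sup>+x. ennreal (2^k * (norm (f (Suc k) x - f k x))\<^sup>2) \<partial>lborel) \<le> ennreal ((1/2)^k)" .
  qed auto
  also have "\<dots> < \<infinity>"
    by (subst suminf_ennreal2) (auto simp: summable_geometric)
  finally have "AE x in lborel. (\<Sum>k. ennreal (2^k * (norm (f (Suc k) x - f k x))\<^sup>2)) \<noteq> \<infinity>"
    by (intro nn_integral_PInf_AE) auto
  then have conv: "AE x in lborel. convergent (\<lambda>k. f k x)"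
  proof eventually_elim
    case (elim x)
    then have "summable (\<lambda>k. 2^k * (norm (f (Suc k) x - f k x))\<^sup>2)"
      by (intro summable_suminf_not_top) auto
    then have "(\<lambda>k. 2^k * (norm (f (Suc k) x - f k x))\<^sup>2) \<longlonglongrightarrow> 0"
      by (rule summable_LIMSEQ_zero)
    then have "Bseq (\<lambda>k. 2^k * (norm (f (Suc k) x - f k x))\<^sup>2)"
      by (intro convergent_imp_Bseq convergentI)
    then obtain B where B: "\<And>k. norm (2^k * (norm (f (Suc k) x - f k x))\<^sup>2) \<le> B"
      by (auto simp only: Bseq_def)
    have *: "norm (f (Suc k) x - f k x) \<le> sqrt B * (1 / sqrt 2)^k" for k
    proof -
      have "(norm (f (Suc k) x - f k x))\<^sup>2 \<le> B * (1/2)^k"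
        using B[of k] by (simp add: field_simps)
      then have "norm (f (Suc k) x - f k x) \<le> sqrt (B * (1/2)^k)"
        using real_le_rsqrt by blast
      then show ?thesis by (simp add: real_sqrt_mult real_sqrt_power real_sqrt_divide)
    qed
    have "summable (\<lambda>k. sqrt B * (1 / sqrt 2)^k)"
      by (intro summable_mult summable_geometric) auto
    then have "summable (\<lambda>k. f (Suc k) x - f k x)"
      using * by (rule summable_comparison_test'[where N = 0])
    then have "convergent (\<lambda>n. \<Sum>k<n. f (Suc k) x - f k x)"
      by (simp add: summable_iff_convergent)
    then have "convergent (\<lambda>n. f n x - f 0 x)"
      by (simp only: sum_lessThan_telescope[of "\<lambda>k. f k x"])
    then show ?case
      using convergent_add[OF _ convergent_const[of "f 0 x"]] by fastforce
  qed
  define g where "g x = lim (\<lambda>k. f k x)" for x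
  have [measurable]: "g \<in> borel_measurable borel"
    unfolding g_def by (intro borel_measurable_lim_metric) measurable
  have lim: "AE x in lborel. (\<lambda>k. f k x) \<longlonglongrightarrow> g x"
    using conv by eventually_elim (simp add: g_def convergent_LIMSEQ_iff)
  have bound: "(\<integral>\<^sup>+x. ennreal ((norm (g x - f k x))\<^sup>2) \<partial>lborel) \<le> ennreal ((1/4)^k)" for k
  proof -
    have "(\<integral>\<^sup>+x. ennreal ((norm (g x - f k x))\<^sup>2) \<partial>lborel)
        = (\<integral>\<^sup>+x. liminf (\<lambda>m. ennreal ((norm (f m x - f k x))\<^sup>2)) \<partial>lborel)"
    proof (rule nn_integral_cong_AE)
      show "AE x in lborel. ennreal ((norm (g x - f k x))\<^sup>2)
          = liminf (\<lambda>m. ennreal ((norm (f m x - f k x))\<^sup>2))"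
        using lim
      proof eventually_elim
        case (elim x)
        then have "(\<lambda>m. ennreal ((norm (f m x - f k x))\<^sup>2)) \<longlonglongrightarrow> ennreal ((norm (g x - f k x))\<^sup>2)"
          by (intro tendsto_intros)
        then show ?case by (rule lim_imp_Liminf[OF sequentially_bot, symmetric])
      qed
    qed
    also have "\<dots> \<le> liminf (\<lambda>m. \<integral>\<^sup>+x. ennreal ((norm (f m x - f k x))\<^sup>2) \<partial>lborel)"
      by (rule nn_integral_liminf) measurable
    also have "\<dots> \<le> ennreal ((1/4)^k)"
      by (rule Liminf_le) (use fast in \<open>auto simp: eventually_sequentially\<close>)
    finally show ?thesis .
  qed
  have "(\<lambda>x. g x - f 0 x) \<in> L2"
  proof (rule L2_I)
    show "integrable lborel (\<lambda>x. (norm (g x - f 0 x))\<^sup>2)"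
      using bound[of 0] by (intro integrableI_nonneg) (auto simp: le_less_trans)
  qed measurable
  from L2_add[OF this f[of 0]] have "g \<in> L2" by simp
  with bound show ?thesis by blast
qed

instance l2 :: banach
proof
  fix X :: "nat \<Rightarrow> l2" assume X: "Cauchy X"
  have "\<exists>N. \<forall>m\<ge>N. \<forall>n\<ge>N. norm (X m - X n) < (1/2)^k" for k
    using X by (auto simp: Cauchy_def dist_norm)
  then obtain N where N: "\<And>k m n. m \<ge> N k \<Longrightarrow> n \<ge> N k \<Longrightarrow> norm (X m - X n) < (1/2)^k"
    by metis
  define r where "r = rec_nat (N 0) (\<lambda>k j. max (Suc j) (N (Suc k)))"
  have r_Suc: "r (Suc k) = max (Suc (r k)) (N (Suc k))" for k by (simp add: r_def)
  have r: "strict_mono r" by (rule strict_monoI_Suc) (simp add: r_Suc)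
  have rN: "r k \<ge> N k" for k by (cases k) (simp_all add: r_def)
  define f where "f k = rep_l2 (X (r k))" for k
  have f: "f k \<in> L2" "cls (f k) = X (r k)" for k by (simp_all add: f_def rep_l2_L2)
  have "\<exists>g\<in>L2. \<forall>k. (\<integral>\<^sup>+x. ennreal ((norm (g x - f k x))\<^sup>2) \<partial>lborel) \<le> ennreal ((1/4)^k)"
  proof (rule fast_Cauchy_L2_converges)
    fix k m :: nat assume "k \<le> m"
    then have "r m \<ge> N k" "r k \<ge> N k"
      using rN[of k] strict_mono_mono[OF r] by (auto simp: mono_def intro: order_trans)
    then have "norm (X (r m) - X (r k)) \<le> (1/2)^k" using N by (intro less_imp_le)
    then have "(norm (X (r m) - X (r k)))\<^sup>2 \<le> ((1/2)^k)\<^sup>2" by (intro power_mono) auto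
    also have "((1/2)^k)\<^sup>2 = (1/4 :: real)^k"
      by (simp add: power2_eq_square flip: power_mult_distrib)
    finally show "(\<integral>\<^sup>+x. ennreal ((norm (f m x - f k x))\<^sup>2) \<partial>lborel) \<le> ennreal ((1/4)^k)"
      using f by (subst nn_integral_norm_cls) (auto simp: L2_diff cls_diff intro!: ennreal_leI)
  qed (rule f)
  then obtain g where g: "g \<in> L2"
    and *: "\<And>k. (\<integral>\<^sup>+x. ennreal ((norm (g x - f k x))\<^sup>2) \<partial>lborel) \<le> ennreal ((1/4)^k)"
    by blast
  have "(norm (cls g - X (r k)))\<^sup>2 \<le> ((1/2)^k)\<^sup>2" for k
    using *[of k] f[of k] g
    by (subst (asm) nn_integral_norm_cls) (auto simp: L2_diff cls_diff power2_eq_square simp flip: power_mult_distrib)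
  then have bd: "norm (cls g - X (r k)) \<le> (1/2)^k" for k
    by (rule power2_le_imp_le) simp
  have "(\<lambda>k. norm (X (r k) - cls g)) \<longlonglongrightarrow> 0"
  proof (rule tendsto_sandwich[OF _ _ tendsto_const])
    show "(\<lambda>k. (1/2)^k :: real) \<longlonglongrightarrow> 0" by (rule LIMSEQ_realpow_zero) auto
  qed (use bd in \<open>auto simp: norm_minus_commute\<close>)
  then have "(X \<circ> r) \<longlonglongrightarrow> cls g" by (simp add: o_def tendsto_norm_zero_iff LIM_zero_iff)
  then show "convergent X"
    using Cauchy_converges_subseq[OF X r] by (auto simp: convergent_def)
qed


section \<open>The Fourier integral and Gaussian regularisation\<close>

lemma cis_measurable [measurable]: "cis \<in> borel_measurable borel"
  by (intro borel_measurable_continuous_onI continuous_on_cis continuous_on_id)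

lemma fourier_integral_cis:
  "fourier_integral f \<xi> = of_real (1 / sqrt (2 * pi)) * (LBINT x. cis (- (x * \<xi>)) * f x)"
  unfolding fourier_integral_def cis_conv_exp by (simp add: exp_minus)

lemma integrable_cis_mult:
  fixes f :: "real \<Rightarrow> complex"
  assumes "integrable lborel f" and [measurable]: "r \<in> borel_measurable borel"
  shows "integrable lborel (\<lambda>x. cis (r x) * f x)"
proof (rule Bochner_Integration.integrable_bound[OF assms(1)])
  note [measurable] = borel_measurable_integrable[OF assms(1)]
  show "(\<lambda>x. cis (r x) * f x) \<in> borel_measurable lborel" by measurable
qed (simp add: norm_mult)

lemma fourier_integral_measurable:
  assumes "f \<in> borel_measurable borel"
  shows "fourier_integral f \<in> borel_measurable borel"
proof -
  note [measurable] = assms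
  show ?thesis
    unfolding fourier_integral_cis[abs_def] by measurable
qed

lemma fourier_integral_bound:
  assumes "integrable lborel f"
  shows "norm (fourier_integral f \<xi>) \<le> (1 / sqrt (2 * pi)) * (LBINT x. norm (f x))"
proof -
  have "norm (LBINT x. cis (- (x * \<xi>)) * f x) \<le> (LBINT x. norm (cis (- (x * \<xi>)) * f x))"
    by (rule integral_norm_bound)
  then show ?thesis
    by (simp add: fourier_integral_cis norm_mult norm_divide divide_right_mono)
qed

lemma fourier_integral_add:
  assumes "integrable lborel f" "integrable lborel g"
  shows "fourier_integral (\<lambda>x. f x + g x) \<xi> = fourier_integral f \<xi> + fourier_integral g \<xi>"
  using assms by (simp add: fourier_integral_cis distrib_left integrable_cis_mult)

lemma fourier_integral_diff:
  assumes "integrable lborel f" "integrable lborel g"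
  shows "fourier_integral (\<lambda>x. f x - g x) \<xi> = fourier_integral f \<xi> - fourier_integral g \<xi>"
  using assms by (simp add: fourier_integral_cis right_diff_distrib integrable_cis_mult)

lemma fourier_integral_cmult:
  "fourier_integral (\<lambda>x. c * f x) \<xi> = c * fourier_integral f \<xi>"
  by (simp add: fourier_integral_cis mult.left_commute[of _ c])

lemma fourier_integral_cong_AE:
  assumes "f \<in> borel_measurable borel" "g \<in> borel_measurable borel" "AE x in lborel. f x = g x"
  shows "fourier_integral f = fourier_integral g"
proof
  fix \<xi>
  note [measurable] = assms(1,2)
  have "(LBINT x. cis (- (x * \<xi>)) * f x) = (LBINT x. cis (- (x * \<xi>)) * g x)"
    using assms(3) by (intro integral_cong_AE) auto
  then show "fourier_integral f \<xi> = fourier_integral g \<xi>"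
    by (simp add: fourier_integral_cis)
qed

lemma integrable_bounded_mult:
  fixes f m :: "real \<Rightarrow> complex"
  assumes "integrable lborel f" "m \<in> borel_measurable borel" "\<And>x. norm (m x) \<le> c"
  shows "integrable lborel (\<lambda>x. m x * f x)"
proof (rule Bochner_Integration.integrable_bound)
  note [measurable] = borel_measurable_integrable[OF assms(1)] assms(2)
  show "integrable lborel (\<lambda>x. c * norm (f x))" using assms(1) by simp
  show "(\<lambda>x. m x * f x) \<in> borel_measurable lborel" by measurable
  have "norm (m x * f x) \<le> norm (c * norm (f x))" for x
    using mult_right_mono[OF assms(3)[of x] norm_ge_zero[of "f x"]] by (simp add: norm_mult)
  then show "AE x in lborel. norm (m x * f x) \<le> norm (c * norm (f x))" by simp
qed

text \<open>Fubini's theorem: both sides are the integral of \<open>f(x) g(\<xi>)\<close> against the symmetric kernel.\<close>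
lemma fourier_integral_multiplication:
  assumes f: "integrable lborel f" and g: "integrable lborel g"
  shows "(LBINT \<xi>. fourier_integral f \<xi> * g \<xi>) = (LBINT x. f x * fourier_integral g x)"
proof -
  note [measurable] = borel_measurable_integrable[OF f] borel_measurable_integrable[OF g]
  have int: "integrable (lborel \<Otimes>\<^sub>M lborel) (\<lambda>(x, \<xi>). cis (- (x * \<xi>)) * (f x * g \<xi>))"
  proof (rule lborel_pair.Fubini_integrable)
    show "(\<lambda>(x, \<xi>). cis (- (x * \<xi>)) * (f x * g \<xi>)) \<in> borel_measurable (lborel \<Otimes>\<^sub>M lborel)"
      by measurable
    show "integrable lborel (\<lambda>x. LBINT \<xi>. norm (case (x, \<xi>) of (x, \<xi>) \<Rightarrow> cis (- (x * \<xi>)) * (f x * g \<xi>)))"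
      using f by (simp add: norm_mult)
    show "AE x in lborel. integrable lborel (\<lambda>\<xi>. case (x, \<xi>) of (x, \<xi>) \<Rightarrow> cis (- (x * \<xi>)) * (f x * g \<xi>))"
      using g by (auto intro!: AE_I2 integrable_cis_mult)
  qed
  have "(LBINT \<xi>. fourier_integral f \<xi> * g \<xi>)
      = of_real (1 / sqrt (2 * pi)) * (LBINT \<xi>. LBINT x. cis (- (x * \<xi>)) * (f x * g \<xi>))"
    by (simp add: fourier_integral_cis mult.assoc flip: integral_mult_left_zero integral_mult_right_zero)
  also have "\<dots> = of_real (1 / sqrt (2 * pi)) * (LBINT x. LBINT \<xi>. cis (- (x * \<xi>)) * (f x * g \<xi>))"
    by (subst lborel_pair.Fubini_integral[OF int]) (rule refl)
  also have "\<dots> = (LBINT x. f x * fourier_integral g x)"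
    by (simp add: fourier_integral_cis mult_ac flip: integral_mult_left_zero integral_mult_right_zero)
  finally show ?thesis .
qed

lemma fourier_std_normal:
  "(LBINT \<xi>. cis (- (x * \<xi>)) * of_real (std_normal_density \<xi>)) = of_real (sqrt (2 * pi) * std_normal_density x)"
proof -
  have "(LBINT \<xi>. cis (- (x * \<xi>)) * of_real (std_normal_density \<xi>)) = char std_normal_distribution (- x)"
    unfolding char_def
    by (subst integral_density)
       (auto simp: cis_conv_exp scaleR_conv_of_real mult_ac exp_minus)
  also have "\<dots> = of_real (sqrt (2 * pi) * std_normal_density x)"
    unfolding char_std_normal_distribution by (simp add: std_normal_density_def)
  finally show ?thesis .
qed

lemma std_normal_density_le_1: "std_normal_density x \<le> 1"
proof -
  have "1 \<le> sqrt (2 * pi)" using pi_ge_two by (intro real_le_rsqrt) simp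
  then have "1 / sqrt (2 * pi) * exp (- x\<^sup>2 / 2) \<le> 1 * 1"
    by (intro mult_mono) auto
  then show ?thesis by (simp add: std_normal_density_def)
qed

text \<open>The transform of a modulated Gaussian is a translated Gaussian, so the multiplication formula
  against it yields an average of \<open>f\<close> near \<open>x\<close>.\<close>
lemma fourier_integral_regularised:
  assumes f: "integrable lborel f" and \<epsilon>: "\<epsilon> > 0"
  shows "(LBINT \<xi>. fourier_integral f \<xi> * (cis (x * \<xi>) * of_real (std_normal_density (\<epsilon> * \<xi>))))
       = (LBINT z. of_real (std_normal_density z) * f (x + \<epsilon> * z))"
proof -
  let ?h = "\<lambda>\<xi>. cis (x * \<xi>) * complex_of_real (std_normal_density (\<epsilon> * \<xi>))"
  have n: "integrable lborel (\<lambda>\<xi>. complex_of_real (std_normal_density (\<epsilon> * \<xi>)))"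
    using lborel_integrable_real_affine[of std_normal_density \<epsilon> 0] \<epsilon>
    by (intro integrable_of_real) simp
  have h: "integrable lborel ?h"
    by (intro integrable_cis_mult n) measurable
  have Fh: "fourier_integral ?h y = of_real (std_normal_density ((y - x) / \<epsilon>) / \<epsilon>)" for y
  proof -
    have "(LBINT \<xi>. cis (- (((y - x) / \<epsilon>) * \<xi>)) * complex_of_real (std_normal_density \<xi>))
        = \<bar>\<epsilon>\<bar> *\<^sub>R (LBINT \<xi>. cis (- (((y - x) / \<epsilon>) * (0 + \<epsilon> * \<xi>))) * complex_of_real (std_normal_density (0 + \<epsilon> * \<xi>)))"
      using \<epsilon> by (intro lborel_integral_real_affine) simp
    also have "(LBINT \<xi>. cis (- (((y - x) / \<epsilon>) * (0 + \<epsilon> * \<xi>))) * complex_of_real (std_normal_density (0 + \<epsilon> * \<xi>)))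
       = (LBINT \<xi>. cis (- (\<xi> * y)) * ?h \<xi>)"
    proof (intro Bochner_Integration.integral_cong refl)
      fix \<xi>
      have "- ((y - x) / \<epsilon> * (0 + \<epsilon> * \<xi>)) = - (\<xi> * y) + x * \<xi>"
        using \<epsilon> by (simp add: field_simps)
      then show "cis (- (((y - x) / \<epsilon>) * (0 + \<epsilon> * \<xi>))) * complex_of_real (std_normal_density (0 + \<epsilon> * \<xi>))
          = cis (- (\<xi> * y)) * ?h \<xi>"
        by (simp only: cis_mult mult.assoc[symmetric] add_0)
    qed
    finally have "of_real \<epsilon> * (LBINT \<xi>. cis (- (\<xi> * y)) * ?h \<xi>)
        = of_real (sqrt (2 * pi) * std_normal_density ((y - x) / \<epsilon>))"
      using \<epsilon> by (simp only: fourier_std_normal scaleR_conv_of_real abs_of_pos)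
    then have "(LBINT \<xi>. cis (- (\<xi> * y)) * ?h \<xi>)
        = of_real (sqrt (2 * pi) * std_normal_density ((y - x) / \<epsilon>)) / of_real \<epsilon>"
      using \<epsilon> by (simp add: field_simps)
    then show ?thesis by (simp add: fourier_integral_cis del: cis_conv_exp)
  qed
  have "(LBINT \<xi>. fourier_integral f \<xi> * ?h \<xi>) = (LBINT y. f y * of_real (std_normal_density ((y - x) / \<epsilon>) / \<epsilon>))"
    by (simp add: fourier_integral_multiplication[OF f h] Fh)
  also have "\<dots> = \<bar>\<epsilon>\<bar> *\<^sub>R (LBINT z. f (x + \<epsilon> * z) * of_real (std_normal_density ((x + \<epsilon> * z - x) / \<epsilon>) / \<epsilon>))"
    using \<epsilon> by (intro lborel_integral_real_affine) auto
  also have "\<dots> = (LBINT z. of_real (std_normal_density z) * f (x + \<epsilon> * z))"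
    unfolding scaleR_conv_of_real integral_mult_right_zero[symmetric]
    using \<epsilon> by (intro Bochner_Integration.integral_cong refl) simp
  finally show ?thesis .
qed

text \<open>The multiplication formula, applied twice, moves the Gaussian weight from the transform
  to a mollification of the function itself.\<close>
lemma fourier_energy_regularised:
  assumes f: "integrable lborel f" and \<epsilon>: "\<epsilon> > 0"
  shows "complex_of_real (LBINT \<xi>. std_normal_density (\<epsilon> * \<xi>) * (norm (fourier_integral f \<xi>))\<^sup>2)
       = of_real (1 / sqrt (2 * pi)) * (LBINT x. f x * cnj (LBINT z. of_real (std_normal_density z) * f (x + \<epsilon> * z)))"
proof -
  note [measurable] = borel_measurable_integrable[OF f]
  have [measurable]: "fourier_integral f \<in> borel_measurable borel"
    by (rule fourier_integral_measurable) simp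
  let ?h = "\<lambda>\<xi>. cnj (fourier_integral f \<xi>) * complex_of_real (std_normal_density (\<epsilon> * \<xi>))"
  have n: "integrable lborel (\<lambda>\<xi>. complex_of_real (std_normal_density (\<epsilon> * \<xi>)))"
    using lborel_integrable_real_affine[of std_normal_density \<epsilon> 0] \<epsilon>
    by (intro integrable_of_real) simp
  have h: "integrable lborel ?h"
  proof (rule integrable_bounded_mult[OF n])
    show "(\<lambda>\<xi>. cnj (fourier_integral f \<xi>)) \<in> borel_measurable borel" by measurable
    show "norm (cnj (fourier_integral f \<xi>)) \<le> (1 / sqrt (2 * pi)) * (LBINT x. norm (f x))" for \<xi>
      unfolding complex_mod_cnj by (rule fourier_integral_bound[OF f])
  qed
  have "complex_of_real (LBINT \<xi>. std_normal_density (\<epsilon> * \<xi>) * (norm (fourier_integral f \<xi>))\<^sup>2)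
     = (LBINT \<xi>. fourier_integral f \<xi> * ?h \<xi>)"
    by (subst integral_complex_of_real[symmetric], intro Bochner_Integration.integral_cong refl)
      (simp only: of_real_mult complex_norm_square mult_ac)
  also have "\<dots> = (LBINT x. f x * fourier_integral ?h x)"
    by (rule fourier_integral_multiplication[OF f h])
  also have "fourier_integral ?h = (\<lambda>x. of_real (1 / sqrt (2 * pi)) * cnj (LBINT z. of_real (std_normal_density z) * f (x + \<epsilon> * z)))"
  proof
    fix x
    have "cnj (LBINT z. of_real (std_normal_density z) * f (x + \<epsilon> * z))
        = cnj (LBINT \<xi>. fourier_integral f \<xi> * (cis (x * \<xi>) * of_real (std_normal_density (\<epsilon> * \<xi>))))"
      by (simp only: fourier_integral_regularised[OF f \<epsilon>])
    also have "\<dots> = (LBINT \<xi>. cnj (fourier_integral f \<xi> * (cis (x * \<xi>) * of_real (std_normal_density (\<epsilon> * \<xi>)))))"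
      by (rule Bochner_Integration.integral_cnj[symmetric])
    also have "\<dots> = (LBINT \<xi>. cis (- (\<xi> * x)) * ?h \<xi>)"
      by (intro Bochner_Integration.integral_cong refl) (simp add: cis_cnj mult_ac)
    finally show "fourier_integral ?h x = of_real (1 / sqrt (2 * pi)) * cnj (LBINT z. of_real (std_normal_density z) * f (x + \<epsilon> * z))"
      unfolding fourier_integral_cis[of ?h] by (rule arg_cong2[where f = "(*)", OF refl, symmetric])
  qed
  also have "(LBINT x. f x * (of_real (1 / sqrt (2 * pi)) * cnj (LBINT z. of_real (std_normal_density z) * f (x + \<epsilon> * z))))
     = of_real (1 / sqrt (2 * pi)) * (LBINT x. f x * cnj (LBINT z. of_real (std_normal_density z) * f (x + \<epsilon> * z)))"
    by (subst integral_mult_right_zero[symmetric]) (simp only: mult.left_commute)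
  finally show ?thesis .
qed

lemma norm_integral_le_nn_integral:
  fixes f :: "'a \<Rightarrow> 'b::{banach, second_countable_topology}"
  shows "ennreal (norm (integral\<^sup>L M f)) \<le> (\<integral>\<^sup>+x. norm (f x) \<partial>M)"
  by (cases "integrable M f") (auto simp: integral_norm_bound_ennreal not_integrable_integral_eq)

lemma nn_integral_translate:
  fixes f :: "real \<Rightarrow> ennreal"
  assumes "f \<in> borel_measurable borel"
  shows "(\<integral>\<^sup>+x. f (x + c) \<partial>lborel) = (\<integral>\<^sup>+x. f x \<partial>lborel)"
  using nn_integral_real_affine[OF assms, of 1 c] by (simp add: add.commute)

lemma nn_integral_std_normal: "(\<integral>\<^sup>+z. ennreal (std_normal_density z) \<partial>lborel) = 1"
  by (subst nn_integral_eq_integral) auto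

text \<open>An average, with weights of total mass one, of pairings of \<open>f\<close> with its translates; each of these is at
  most the energy of \<open>f\<close>.\<close>
lemma mollified_pairing_bound:
  fixes f :: "real \<Rightarrow> complex"
  assumes [measurable]: "f \<in> borel_measurable borel"
  shows "(\<integral>\<^sup>+x. ennreal (norm (f x)) * (\<integral>\<^sup>+z. ennreal (std_normal_density z * norm (f (x + \<epsilon> * z))) \<partial>lborel) \<partial>lborel)
      \<le> (\<integral>\<^sup>+x. ennreal ((norm (f x))\<^sup>2) \<partial>lborel)"
proof -
  let ?E = "\<integral>\<^sup>+x. ennreal ((norm (f x))\<^sup>2) \<partial>lborel"
  have "(\<integral>\<^sup>+x. ennreal (norm (f x)) * (\<integral>\<^sup>+z. ennreal (std_normal_density z * norm (f (x + \<epsilon> * z))) \<partial>lborel) \<partial>lborel)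
      = (\<integral>\<^sup>+x. \<integral>\<^sup>+z. ennreal (std_normal_density z) * ennreal (norm (f x) * norm (f (x + \<epsilon> * z))) \<partial>lborel \<partial>lborel)"
    by (subst nn_integral_cmult[symmetric]) (auto simp: ennreal_mult mult_ac)
  also have "\<dots> = (\<integral>\<^sup>+z. \<integral>\<^sup>+x. ennreal (std_normal_density z) * ennreal (norm (f x) * norm (f (x + \<epsilon> * z))) \<partial>lborel \<partial>lborel)"
    by (rule lborel_pair.Fubini'[symmetric]) measurable
  also have "\<dots> = (\<integral>\<^sup>+z. ennreal (std_normal_density z) * (\<integral>\<^sup>+x. ennreal (norm (f x) * norm (f (x + \<epsilon> * z))) \<partial>lborel) \<partial>lborel)"
    by (subst nn_integral_cmult) auto
  also have "\<dots> \<le> (\<integral>\<^sup>+z. ennreal (std_normal_density z) * ?E \<partial>lborel)"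
  proof (rule nn_integral_mono, rule mult_left_mono)
    fix z :: real
    have "(\<integral>\<^sup>+x. ennreal (norm (f x) * norm (f (x + \<epsilon> * z))) \<partial>lborel)
      \<le> (\<integral>\<^sup>+x. ennreal (1/2) * ennreal ((norm (f x))\<^sup>2) + ennreal (1/2) * ennreal ((norm (f (x + \<epsilon> * z)))\<^sup>2) \<partial>lborel)"
    proof (intro nn_integral_mono)
      fix x
      have "norm (f x) * norm (f (x + \<epsilon> * z)) \<le> 1/2 * (norm (f x))\<^sup>2 + 1/2 * (norm (f (x + \<epsilon> * z)))\<^sup>2"
        using sum_squares_bound[of "norm (f x)" "norm (f (x + \<epsilon> * z))"] by simp
      then have "ennreal (norm (f x) * norm (f (x + \<epsilon> * z))) \<le> ennreal (1/2 * (norm (f x))\<^sup>2 + 1/2 * (norm (f (x + \<epsilon> * z)))\<^sup>2)"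
        by (rule ennreal_leI)
      also have "\<dots> = ennreal (1/2) * ennreal ((norm (f x))\<^sup>2) + ennreal (1/2) * ennreal ((norm (f (x + \<epsilon> * z)))\<^sup>2)"
        by (simp only: ennreal_mult[symmetric] ennreal_plus[symmetric] zero_le_power2 zero_le_mult_iff zero_le_divide_1_iff zero_le_numeral simp_thms)
      finally show "ennreal (norm (f x) * norm (f (x + \<epsilon> * z)))
         \<le> ennreal (1/2) * ennreal ((norm (f x))\<^sup>2) + ennreal (1/2) * ennreal ((norm (f (x + \<epsilon> * z)))\<^sup>2)" .
    qed
    also have "\<dots> = ennreal (1/2) * ?E + ennreal (1/2) * (\<integral>\<^sup>+x. ennreal ((norm (f (x + \<epsilon> * z)))\<^sup>2) \<partial>lborel)"
      by (subst nn_integral_add) (auto simp: nn_integral_cmult)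
    also have "\<dots> = ennreal (1/2) * ?E + ennreal (1/2) * ?E"
      by (subst nn_integral_translate[where f = "\<lambda>x. ennreal ((norm (f x))\<^sup>2)"]) auto
    also have "\<dots> = ?E"
      by (simp only: distrib_right[symmetric] ennreal_plus[symmetric] zero_le_divide_1_iff zero_le_numeral) simp
    finally show "(\<integral>\<^sup>+x. ennreal (norm (f x) * norm (f (x + \<epsilon> * z))) \<partial>lborel) \<le> ?E" .
  qed simp
  also have "\<dots> = ?E"
    by (simp add: nn_integral_multc nn_integral_std_normal)
  finally show ?thesis .
qed


section \<open>Plancherel's theorem for integrable functions\<close>

lemma cls_tendsto_dominated:
  assumes f: "\<And>n::nat. f n \<in> borel_measurable borel" and g: "g \<in> borel_measurable borel" and w: "w \<in> L2"
    and lim: "AE x in lborel. (\<lambda>n. f n x) \<longlonglongrightarrow> g x"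
    and bound: "\<And>n x. norm (f n x) \<le> norm (w x)"
  shows "g \<in> L2" "\<And>n. f n \<in> L2" "(\<lambda>n. cls (f n)) \<longlonglongrightarrow> cls g"
proof -
  note [measurable] = f g L2_measurable[OF w]
  have gw: "AE x in lborel. norm (g x) \<le> norm (w x)"
    using lim
  proof eventually_elim
    case (elim x)
    show ?case by (rule LIMSEQ_le_const2[OF tendsto_norm[OF elim]]) (use bound in auto)
  qed
  show gL: "g \<in> L2" using gw by (intro L2_dominated[OF g w, where c = 1]) simp
  show fL: "\<And>n. f n \<in> L2" using bound by (intro L2_dominated[OF f w, where c = 1]) simp
  have "(\<lambda>n. LBINT x. (norm (f n x - g x))\<^sup>2) \<longlonglongrightarrow> (LINT (x::real)|lborel. 0)"
  proof (rule integral_dominated_convergence)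
    show "integrable lborel (\<lambda>x. 4 * (norm (w x))\<^sup>2)" using L2_integrable[OF w] by simp
    show "AE x in lborel. (\<lambda>n. (norm (f n x - g x))\<^sup>2) \<longlonglongrightarrow> 0"
      using lim
    proof eventually_elim
      case (elim x)
      have "(\<lambda>n. (norm (f n x - g x))\<^sup>2) \<longlonglongrightarrow> (norm (g x - g x))\<^sup>2"
        by (intro tendsto_intros elim)
      then show ?case by simp
    qed
    show "AE x in lborel. norm ((norm (f n x - g x))\<^sup>2) \<le> 4 * (norm (w x))\<^sup>2" for n
      using gw
    proof eventually_elim
      case (elim x)
      have "norm (f n x - g x) \<le> 2 * norm (w x)"
        using norm_triangle_ineq4[of "f n x" "g x"] bound[of n x] elim by linarith
      then have "(norm (f n x - g x))\<^sup>2 \<le> (2 * norm (w x))\<^sup>2" by (intro power_mono) auto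
      then show ?case by (simp add: power_mult_distrib)
    qed
  qed measurable
  then have "(\<lambda>n. (norm (cls (f n) - cls g))\<^sup>2) \<longlonglongrightarrow> 0"
    using fL gL by (simp add: cls_diff[symmetric] norm_cls_sq L2_diff)
  then have "(\<lambda>n. sqrt ((norm (cls (f n) - cls g))\<^sup>2)) \<longlonglongrightarrow> sqrt 0"
    by (rule tendsto_real_sqrt)
  then show "(\<lambda>n. cls (f n)) \<longlonglongrightarrow> cls g"
    by (simp add: tendsto_norm_zero_iff LIM_zero_iff)
qed

lemma L2_bounded_integrable:
  assumes "integrable lborel f" "\<And>x. norm (f x) \<le> M"
  shows "f \<in> L2"
proof (rule L2_I)
  note [measurable] = borel_measurable_integrable[OF assms(1)]
  show "f \<in> borel_measurable borel" by measurable
  show "integrable lborel (\<lambda>x. (norm (f x))\<^sup>2)"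
  proof (rule Bochner_Integration.integrable_bound)
    show "integrable lborel (\<lambda>x. M * norm (f x))" using assms(1) by simp
    have "norm ((norm (f x))\<^sup>2) \<le> norm (M * norm (f x))" for x
      using mult_right_mono[OF assms(2)[of x] norm_ge_zero[of "f x"]]
      by (simp add: power2_eq_square)
    then show "AE x in lborel. norm ((norm (f x))\<^sup>2) \<le> norm (M * norm (f x))" by simp
  qed measurable
qed

lemma inverse_Suc_tendsto: "(\<lambda>k. inverse (real (Suc k)) * c) \<longlonglongrightarrow> 0"
  using tendsto_mult_left_zero[OF LIMSEQ_inverse_real_of_nat] .

lemma std_normal_density_tendsto:
  "(\<lambda>k. std_normal_density (inverse (real (Suc k)) * \<xi>)) \<longlonglongrightarrow> 1 / sqrt (2 * pi)"
proof -
  have "(\<lambda>k. 1 / sqrt (2 * pi) * exp (- (inverse (real (Suc k)) * \<xi>)\<^sup>2 / 2)) \<longlonglongrightarrow> 1 / sqrt (2 * pi) * exp (- (0::real)\<^sup>2 / 2)"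
    by (intro tendsto_intros inverse_Suc_tendsto) auto
  then show ?thesis by (simp add: std_normal_density_def)
qed

text \<open>The Gaussian weights increase to a constant as \<open>\<epsilon>\<close> tends to 0, and the regularised energies are bounded by
  the energy of \<open>f\<close>. Equality needs the convergence of the mollifications to \<open>f\<close>, which is easy only for
  continuous functions; the contraction property carries it to all others.\<close>
lemma fourier_integral_contraction:
  assumes f: "integrable lborel f" "f \<in> L2"
  shows "fourier_integral f \<in> L2" "norm (cls (fourier_integral f)) \<le> norm (cls f)"
proof -
  note [measurable] = L2_measurable[OF f(2)]
  have [measurable]: "fourier_integral f \<in> borel_measurable borel"
    by (rule fourier_integral_measurable) simp
  let ?n = "\<lambda>k \<xi>. std_normal_density (inverse (real (Suc k)) * \<xi>)"
  have int: "integrable lborel (\<lambda>\<xi>. ?n k \<xi> * (norm (fourier_integral f \<xi>))\<^sup>2)" for k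
  proof (rule Bochner_Integration.integrable_bound)
    let ?B = "((1 / sqrt (2 * pi)) * (LBINT x. norm (f x)))\<^sup>2"
    have "integrable lborel (?n k)"
      using lborel_integrable_real_affine[of std_normal_density "inverse (real (Suc k))" 0] by simp
    then show "integrable lborel (\<lambda>\<xi>. ?n k \<xi> * ?B)" by simp
    have "(norm (fourier_integral f \<xi>))\<^sup>2 \<le> ?B" for \<xi>
      by (intro power_mono fourier_integral_bound f) auto
    then show "AE \<xi> in lborel. norm (?n k \<xi> * (norm (fourier_integral f \<xi>))\<^sup>2) \<le> norm (?n k \<xi> * ?B)"
      by (auto simp: abs_mult intro!: mult_left_mono)
  qed measurable
  have le: "(\<integral>\<^sup>+\<xi>. ennreal (sqrt (2 * pi) * ?n k \<xi> * (norm (fourier_integral f \<xi>))\<^sup>2) \<partial>lborel)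
      \<le> (\<integral>\<^sup>+x. ennreal ((norm (f x))\<^sup>2) \<partial>lborel)" for k
  proof -
    let ?e = "inverse (real (Suc k))"
    let ?g = "\<lambda>x. LBINT z. of_real (std_normal_density z) * f (x + ?e * z)"
    let ?I = "LBINT \<xi>. ?n k \<xi> * (norm (fourier_integral f \<xi>))\<^sup>2"
    have "?I = norm (complex_of_real ?I)"
      unfolding norm_of_real by (rule abs_of_nonneg[symmetric]) (intro integral_nonneg_AE, simp)
    also have "\<dots> = 1 / sqrt (2 * pi) * norm (LBINT x. f x * cnj (?g x))"
      by (subst fourier_energy_regularised[OF f(1)]) (auto simp: norm_mult norm_divide)
    finally have "sqrt (2 * pi) * ?I = norm (LBINT x. f x * cnj (?g x))" by simp
    then have "(\<integral>\<^sup>+\<xi>. ennreal (sqrt (2 * pi) * ?n k \<xi> * (norm (fourier_integral f \<xi>))\<^sup>2) \<partial>lborel)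
       = ennreal (norm (LBINT x. f x * cnj (?g x)))"
      using int[of k] by (subst nn_integral_eq_integral) (auto simp: mult.assoc)
    also have "\<dots> \<le> (\<integral>\<^sup>+x. norm (f x * cnj (?g x)) \<partial>lborel)"
      by (rule norm_integral_le_nn_integral)
    also have "\<dots> = (\<integral>\<^sup>+x. ennreal (norm (f x)) * ennreal (norm (?g x)) \<partial>lborel)"
      by (simp add: norm_mult ennreal_mult)
    also have "\<dots> \<le> (\<integral>\<^sup>+x. ennreal (norm (f x)) * (\<integral>\<^sup>+z. ennreal (std_normal_density z * norm (f (x + ?e * z))) \<partial>lborel) \<partial>lborel)"
    proof (rule nn_integral_mono, rule mult_left_mono)
      fix x
      show "ennreal (norm (?g x)) \<le> (\<integral>\<^sup>+z. ennreal (std_normal_density z * norm (f (x + ?e * z))) \<partial>lborel)"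
        using norm_integral_le_nn_integral[of lborel "\<lambda>z. of_real (std_normal_density z) * f (x + ?e * z)"]
        by (simp add: norm_mult)
    qed simp
    also have "\<dots> \<le> (\<integral>\<^sup>+x. ennreal ((norm (f x))\<^sup>2) \<partial>lborel)"
      by (rule mollified_pairing_bound) measurable
    finally show ?thesis .
  qed
  have "(\<integral>\<^sup>+\<xi>. ennreal ((norm (fourier_integral f \<xi>))\<^sup>2) \<partial>lborel)
      = (\<integral>\<^sup>+\<xi>. liminf (\<lambda>k. ennreal (sqrt (2 * pi) * ?n k \<xi> * (norm (fourier_integral f \<xi>))\<^sup>2)) \<partial>lborel)"
  proof (rule nn_integral_cong)
    fix \<xi>
    have "(\<lambda>k. ennreal (sqrt (2 * pi) * ?n k \<xi> * (norm (fourier_integral f \<xi>))\<^sup>2))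
       \<longlonglongrightarrow> ennreal (sqrt (2 * pi) * (1 / sqrt (2 * pi)) * (norm (fourier_integral f \<xi>))\<^sup>2)"
      by (intro tendsto_intros std_normal_density_tendsto)
    from lim_imp_Liminf[OF sequentially_bot this]
    show "ennreal ((norm (fourier_integral f \<xi>))\<^sup>2) = liminf (\<lambda>k. ennreal (sqrt (2 * pi) * ?n k \<xi> * (norm (fourier_integral f \<xi>))\<^sup>2))"
      by simp
  qed
  also have "\<dots> \<le> liminf (\<lambda>k. \<integral>\<^sup>+\<xi>. ennreal (sqrt (2 * pi) * ?n k \<xi> * (norm (fourier_integral f \<xi>))\<^sup>2) \<partial>lborel)"
    by (rule nn_integral_liminf) measurable
  also have "\<dots> \<le> (\<integral>\<^sup>+x. ennreal ((norm (f x))\<^sup>2) \<partial>lborel)"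
    by (rule Liminf_le[OF sequentially_bot always_eventually]) (rule allI, rule le)
  finally have *: "(\<integral>\<^sup>+\<xi>. ennreal ((norm (fourier_integral f \<xi>))\<^sup>2) \<partial>lborel) \<le> ennreal ((norm (cls f))\<^sup>2)"
    by (simp add: nn_integral_norm_cls f)
  show FL: "fourier_integral f \<in> L2"
  proof (rule L2_I)
    show "integrable lborel (\<lambda>\<xi>. (norm (fourier_integral f \<xi>))\<^sup>2)"
      using * by (intro integrableI_nonneg) (auto simp: le_less_trans[OF _ ennreal_less_top])
  qed measurable
  from * have "(norm (cls (fourier_integral f)))\<^sup>2 \<le> (norm (cls f))\<^sup>2"
    by (simp add: nn_integral_norm_cls FL)
  then show "norm (cls (fourier_integral f)) \<le> norm (cls f)"
    by (rule power2_le_imp_le) simp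
qed

lemma fourier_integral_isometry_continuous:
  assumes f: "integrable lborel f" "\<And>x. norm (f x) \<le> M" "continuous_on UNIV f"
  shows "norm (cls (fourier_integral f)) = norm (cls f)"
proof -
  have fL: "f \<in> L2" by (rule L2_bounded_integrable[OF f(1,2)])
  note FL = fourier_integral_contraction(1)[OF f(1) fL]
  note [measurable] = L2_measurable[OF fL] L2_measurable[OF FL]
  let ?e = "\<lambda>k. inverse (real (Suc k))"
  let ?g = "\<lambda>k x. LBINT z. of_real (std_normal_density z) * f (x + ?e k * z)"
  have "(\<lambda>k. LBINT \<xi>. std_normal_density (?e k * \<xi>) * (norm (fourier_integral f \<xi>))\<^sup>2)
      \<longlonglongrightarrow> (LBINT \<xi>. 1 / sqrt (2 * pi) * (norm (fourier_integral f \<xi>))\<^sup>2)"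
  proof (rule integral_dominated_convergence)
    show "integrable lborel (\<lambda>\<xi>. (norm (fourier_integral f \<xi>))\<^sup>2)" by (rule L2_integrable[OF FL])
    show "AE \<xi> in lborel. (\<lambda>k. std_normal_density (?e k * \<xi>) * (norm (fourier_integral f \<xi>))\<^sup>2)
        \<longlonglongrightarrow> 1 / sqrt (2 * pi) * (norm (fourier_integral f \<xi>))\<^sup>2"
      by (intro AE_I2 tendsto_intros std_normal_density_tendsto)
    show "AE \<xi> in lborel. norm (std_normal_density (?e k * \<xi>) * (norm (fourier_integral f \<xi>))\<^sup>2)
        \<le> (norm (fourier_integral f \<xi>))\<^sup>2" for k
      by (simp add: abs_mult mult_left_le_one_le std_normal_density_le_1)
  qed measurable
  then have lim1: "(\<lambda>k. complex_of_real (LBINT \<xi>. std_normal_density (?e k * \<xi>) * (norm (fourier_integral f \<xi>))\<^sup>2))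
     \<longlonglongrightarrow> of_real (LBINT \<xi>. 1 / sqrt (2 * pi) * (norm (fourier_integral f \<xi>))\<^sup>2)"
    by (rule tendsto_of_real)
  have lim2: "(\<lambda>k. of_real (1 / sqrt (2 * pi)) * (LBINT x. f x * cnj (?g k x)))
     \<longlonglongrightarrow> of_real (1 / sqrt (2 * pi)) * (LBINT x. f x * cnj (f x))"
  proof (intro tendsto_mult_left integral_dominated_convergence)
    show "integrable lborel (\<lambda>x. M * norm (f x))" using f(1) by simp
    have gM: "norm (?g k x) \<le> M" for k x
    proof -
      have "norm (?g k x) \<le> (LBINT z. M * std_normal_density z)"
      proof (rule Bochner_Integration.integral_norm_bound_integral)
        have *: "norm (of_real (std_normal_density z) * f (x + ?e k * z)) \<le> M * std_normal_density z" for z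
          using mult_right_mono[OF f(2)[of "x + ?e k * z"] normal_density_nonneg[of 0 1 z]]
          by (simp add: norm_mult mult.commute)
        then show "norm (of_real (std_normal_density z) * f (x + ?e k * z)) \<le> M * std_normal_density z" for z .
        show int: "integrable lborel (\<lambda>z. M * std_normal_density z)" by simp
        show "integrable lborel (\<lambda>z. of_real (std_normal_density z) * f (x + ?e k * z))"
          by (rule Bochner_Integration.integrable_bound[OF int])
            (measurable, intro AE_I2 order_trans[OF *], simp only: real_norm_def abs_ge_self)
      qed
      then show ?thesis by simp
    qed
    show "AE x in lborel. norm (f x * cnj (?g k x)) \<le> M * norm (f x)" for k
      using gM by (simp add: norm_mult mult.commute[of M] mult_left_mono)
    have "(\<lambda>k. ?g k x) \<longlonglongrightarrow> (LBINT z. of_real (std_normal_density z) * f x)" for x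
    proof (rule integral_dominated_convergence)
      show "integrable lborel (\<lambda>z. std_normal_density z * M)" by simp
      have "isCont f y" for y using f(3) by (simp add: continuous_on_eq_continuous_at)
      moreover have "(\<lambda>k. x + ?e k * z) \<longlonglongrightarrow> x + 0" for z
        by (intro tendsto_add tendsto_const inverse_Suc_tendsto)
      ultimately have "(\<lambda>k. f (x + ?e k * z)) \<longlonglongrightarrow> f (x + 0)" for z
        by (intro isCont_tendsto_compose[of _ f]) auto
      then show "AE z in lborel. (\<lambda>k. of_real (std_normal_density z) * f (x + ?e k * z))
          \<longlonglongrightarrow> of_real (std_normal_density z) * f x"
        by (intro AE_I2 tendsto_mult_left) simp
      show "AE z in lborel. norm (of_real (std_normal_density z) * f (x + ?e k * z)) \<le> std_normal_density z * M" for k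
        using f(2) by (simp add: norm_mult mult_left_mono)
    qed measurable
    then show "AE x in lborel. (\<lambda>k. f x * cnj (?g k x)) \<longlonglongrightarrow> f x * cnj (f x)"
      by (intro AE_I2 tendsto_intros) simp
  qed measurable
  have "(\<lambda>k. complex_of_real (LBINT \<xi>. std_normal_density (?e k * \<xi>) * (norm (fourier_integral f \<xi>))\<^sup>2))
      = (\<lambda>k. of_real (1 / sqrt (2 * pi)) * (LBINT x. f x * cnj (?g k x)))"
    by (rule ext, rule fourier_energy_regularised[OF f(1)]) simp
  from LIMSEQ_unique[OF lim1[unfolded this] lim2]
  have "complex_of_real (LBINT \<xi>. 1 / sqrt (2 * pi) * (norm (fourier_integral f \<xi>))\<^sup>2)
      = of_real (1 / sqrt (2 * pi)) * (LBINT x. f x * cnj (f x))" .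
  also have "(LBINT x. f x * cnj (f x)) = of_real (LBINT x. (norm (f x))\<^sup>2)"
    by (subst integral_complex_of_real[symmetric]) (simp only: complex_norm_square)
  finally have "1 / sqrt (2 * pi) * (norm (cls (fourier_integral f)))\<^sup>2 = 1 / sqrt (2 * pi) * (norm (cls f))\<^sup>2"
    by (simp only: norm_cls_sq fL FL integral_mult_right_zero of_real_mult[symmetric] of_real_eq_iff)
  then show ?thesis by simp
qed

text \<open>As the transform is a contraction, the functions on which it preserves the norm form a closed set.\<close>
lemma fourier_integral_isometry_limit:
  assumes f: "\<And>n::nat. integrable lborel (f n)" "\<And>n. f n \<in> L2" and g: "integrable lborel g" "g \<in> L2"
    and iso: "\<And>n. norm (cls (fourier_integral (f n))) = norm (cls (f n))"
    and lim: "(\<lambda>n. cls (f n)) \<longlonglongrightarrow> cls g"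
  shows "norm (cls (fourier_integral g)) = norm (cls g)"
proof -
  have *: "norm (cls (fourier_integral (f n)) - cls (fourier_integral g)) \<le> norm (cls (f n) - cls g)" for n
  proof -
    have "fourier_integral (\<lambda>x. f n x - g x) = (\<lambda>\<xi>. fourier_integral (f n) \<xi> - fourier_integral g \<xi>)"
      using f g by (intro ext fourier_integral_diff)
    then show ?thesis
      using fourier_integral_contraction(2)[of "\<lambda>x. f n x - g x"] f[of n] g
      by (simp add: L2_diff cls_diff fourier_integral_contraction(1))
  qed
  have "(\<lambda>n. cls (fourier_integral (f n))) \<longlonglongrightarrow> cls (fourier_integral g)"
    using lim *
    by (subst (asm) tendsto_dist_iff, subst tendsto_dist_iff)
      (auto simp: dist_norm intro: Lim_null_comparison[rotated])
  then have "(\<lambda>n. norm (cls (f n))) \<longlonglongrightarrow> norm (cls (fourier_integral g))"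
    using tendsto_norm iso by fastforce
  with tendsto_norm[OF lim] show ?thesis using LIMSEQ_unique by blast
qed

text \<open>This comes from the equivalence of Lebesgue measurability with being an almost everywhere limit of
  continuous functions.\<close>
lemma AE_limit_of_continuous:
  fixes f :: "real \<Rightarrow> complex"
  assumes "f \<in> borel_measurable borel"
  obtains g where "\<And>n::nat. continuous_on UNIV (g n)" "AE x in lborel. (\<lambda>n. g n x) \<longlonglongrightarrow> f x"
proof -
  note [measurable] = assms
  have "(\<lambda>x. Re (f x)) \<in> borel_measurable lborel" "(\<lambda>x. Im (f x)) \<in> borel_measurable lborel"
    by measurable
  then have "(\<lambda>x. Re (f x)) \<in> borel_measurable lebesgue" "(\<lambda>x. Im (f x)) \<in> borel_measurable lebesgue"
    by (auto intro: measurable_completion)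
  then have "(\<lambda>x. Re (f x)) measurable_on UNIV" "(\<lambda>x. Im (f x)) measurable_on UNIV"
    by (auto intro: lebesgue_measurable_imp_measurable_on_real)
  then obtain N1 N2 g1 g2 where N: "negligible N1" "negligible N2"
    and c: "\<And>n::nat. continuous_on UNIV (g1 n)" "\<And>n::nat. continuous_on UNIV (g2 n)"
    and lim: "\<And>x. x \<notin> N1 \<Longrightarrow> (\<lambda>n. g1 n x) \<longlonglongrightarrow> Re (f x)" "\<And>x. x \<notin> N2 \<Longrightarrow> (\<lambda>n. g2 n x) \<longlonglongrightarrow> Im (f x)"
    unfolding measurable_on_def by auto
  have "N1 \<union> N2 \<in> null_sets lebesgue"
    using N by (auto simp: negligible_iff_null_sets)
  then have "AE x in lebesgue. x \<notin> N1 \<union> N2" by (rule AE_not_in)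
  then have "AE x in lborel. x \<notin> N1 \<union> N2" by (simp add: AE_completion_iff)
  then have lim': "AE x in lborel. (\<lambda>n. Complex (g1 n x) (g2 n x)) \<longlonglongrightarrow> f x"
    by eventually_elim (use lim in \<open>auto intro!: tendsto_complex_iff[THEN iffD2]\<close>)
  have "continuous_on UNIV (\<lambda>x. Complex (g1 n x) (g2 n x))" for n
    unfolding Complex_eq
    by (intro continuous_on_add continuous_on_mult continuous_on_of_real continuous_on_const c)
  from that[OF this lim'] show thesis .
qed

text \<open>A bounded function with bounded support is an almost everywhere limit of continuous functions;
  clamping these and cutting them off keeps them dominated.\<close>
lemma fourier_integral_isometry_bounded_support:
  fixes f :: "real \<Rightarrow> complex"
  assumes f: "f \<in> borel_measurable borel" and M: "\<And>x. norm (f x) \<le> M" "0 < M"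
    and supp: "\<And>x. \<bar>x\<bar> > R \<Longrightarrow> f x = 0"
  shows "integrable lborel f" "f \<in> L2" "norm (cls (fourier_integral f)) = norm (cls f)"
proof -
  obtain g where g: "\<And>n::nat. continuous_on UNIV (g n)" "AE x in lborel. (\<lambda>n. g n x) \<longlonglongrightarrow> f x"
    using AE_limit_of_continuous[OF f] by blast
  \<comment> \<open>\<open>c\<close> is the identity on the disc of radius \<open>M\<close>, and \<open>q\<close> is 1 on the support of \<open>f\<close>, so neither
    changes the limit.\<close>
  define c where "c z = z / of_real (max 1 (norm z / M))" for z :: complex
  define q where "q x = max 0 (min 1 (R + 1 - \<bar>x\<bar>))" for x :: real
  define h where "h n x = c (g n x) * of_real (q x)" for n x
  have c_bound: "norm (c z) \<le> M" for z
    using M(2) by (auto simp: c_def norm_divide field_simps max_def)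
  have c_cont: "continuous_on UNIV c"
    unfolding c_def using M(2) by (intro continuous_intros) auto
  have q_bound: "0 \<le> q x" "q x \<le> 1" for x by (auto simp: q_def)
  have q_cont: "continuous_on UNIV q" unfolding q_def by (intro continuous_intros)
  have h_cont: "continuous_on UNIV (h n)" for n
    unfolding h_def
    by (intro continuous_intros q_cont continuous_on_compose2[OF c_cont g(1)]) auto
  have h_meas: "h n \<in> borel_measurable borel" for n
    by (rule borel_measurable_continuous_onI[OF h_cont])
  let ?w = "\<lambda>x. complex_of_real (M * indicator {-(R + 1)..R + 1} x)"
  have w: "integrable lborel ?w"
    by (intro integrable_of_real integrable_mult_right integrable_real_indicator)
      (auto simp: emeasure_lborel_Icc_eq)
  have wL: "?w \<in> L2" using M(2)
    by (intro L2_bounded_integrable[OF w, where M = M]) (auto simp: norm_mult split: split_indicator)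
  have h_bound: "norm (h n x) \<le> norm (?w x)" for n x
  proof (cases "\<bar>x\<bar> \<le> R + 1")
    case True
    then have "norm (?w x) = M" using M(2) by (auto simp: indicator_def abs_le_iff)
    then show ?thesis using mult_mono[OF c_bound[of "g n x"] q_bound(2)[of x]] q_bound(1)[of x] M(2)
      by (simp add: h_def norm_mult)
  next
    case False
    then have "q x = 0" by (simp add: q_def)
    then show ?thesis by (simp add: h_def)
  qed
  have lim: "AE x in lborel. (\<lambda>n. h n x) \<longlonglongrightarrow> f x"
    using g(2)
  proof eventually_elim
    case (elim x)
    have "isCont c z" for z using c_cont by (simp add: continuous_on_eq_continuous_at)
    then have "(\<lambda>n. c (g n x)) \<longlonglongrightarrow> c (f x)" by (intro isCont_tendsto_compose[OF _ elim])
    then have "(\<lambda>n. h n x) \<longlonglongrightarrow> c (f x) * of_real (q x)"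
      unfolding h_def by (intro tendsto_intros)
    also have "c (f x) * of_real (q x) = f x"
    proof (cases "\<bar>x\<bar> \<le> R")
      case True
      then have "q x = 1" by (simp add: q_def)
      moreover have "c (f x) = f x" using M(1)[of x] M(2) by (simp add: c_def max_def)
      ultimately show ?thesis by simp
    next
      case False
      then show ?thesis using supp[of x] by (simp add: c_def)
    qed
    finally show ?case .
  qed
  note conv = cls_tendsto_dominated[OF h_meas f wL lim h_bound]
  have h_int: "integrable lborel (h n)" for n
    using h_meas h_bound by (intro Bochner_Integration.integrable_bound[OF w]) (auto intro!: AE_I2)
  show f_int: "integrable lborel f"
  proof (rule Bochner_Integration.integrable_bound[OF w])
    show "AE x in lborel. norm (f x) \<le> norm (?w x)"
      using M supp by (intro AE_I2) (auto simp: indicator_def abs_le_iff not_le)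
  qed (use f in simp)
  show fL: "f \<in> L2" by (rule L2_bounded_integrable[OF f_int M(1)])
  have hM: "norm (h n x) \<le> M" for n x
    using mult_mono[OF c_bound[of "g n x"] q_bound(2)[of x]] q_bound(1)[of x] M(2)
    by (simp add: h_def norm_mult)
  show "norm (cls (fourier_integral f)) = norm (cls f)"
    by (rule fourier_integral_isometry_limit[OF h_int conv(2) f_int fL
          fourier_integral_isometry_continuous[OF h_int hM h_cont] conv(3)])
qed

theorem plancherel_integrable:
  assumes f: "integrable lborel f" "f \<in> L2"
  shows "norm (cls (fourier_integral f)) = norm (cls f)"
proof -
  note [measurable] = L2_measurable[OF f(2)]
  define h where "h n x = (if \<bar>x\<bar> \<le> real n \<and> norm (f x) \<le> real n then f x else 0)" for n :: nat and x
  have h_meas: "h n \<in> borel_measurable borel" for n unfolding h_def by measurable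
  have "(\<lambda>n. h n x) \<longlonglongrightarrow> f x" for x
  proof (rule tendsto_eventually)
    obtain N where N: "max \<bar>x\<bar> (norm (f x)) \<le> real N" using real_arch_simple by blast
    show "eventually (\<lambda>n. h n x = f x) sequentially"
      using eventually_ge_at_top[of N]
    proof eventually_elim
      case (elim n)
      then have "real N \<le> real n" by simp
      with N have "\<bar>x\<bar> \<le> real n" "norm (f x) \<le> real n" by linarith+
      then show ?case by (simp add: h_def)
    qed
  qed
  then have lim: "AE x in lborel. (\<lambda>n. h n x) \<longlonglongrightarrow> f x" by simp
  have bound: "norm (h n x) \<le> norm (f x)" for n x by (simp add: h_def)
  note conv = cls_tendsto_dominated[OF h_meas L2_measurable[OF f(2)] f(2) lim bound]
  have hM: "norm (h n x) \<le> real n + 1" for n x by (simp add: h_def)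
  have hpos: "0 < real n + 1" for n by simp
  have hsupp: "h n x = 0" if "real n < \<bar>x\<bar>" for n x using that by (simp add: h_def)
  note h = fourier_integral_isometry_bounded_support[OF h_meas hM hpos hsupp]
  show ?thesis
    by (rule fourier_integral_isometry_limit[OF h(1) conv(2) f h(3) conv(3)])
qed


section \<open>Multiplication and conjugation on the space of classes\<close>

definition mult_l2 :: "(real \<Rightarrow> complex) \<Rightarrow> l2 \<Rightarrow> l2" where
  "mult_l2 m V = cls (\<lambda>x. m x * rep_l2 V x)"

definition cnj_l2 :: "l2 \<Rightarrow> l2" where
  "cnj_l2 V = cls (\<lambda>x. cnj (rep_l2 V x))"

lemma norm_cls_mono:
  assumes "f \<in> L2" "g \<in> L2" "0 \<le> c" "AE x in lborel. norm (f x) \<le> c * norm (g x)"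
  shows "norm (cls f) \<le> c * norm (cls g)"
proof -
  have "(LBINT x. (norm (f x))\<^sup>2) \<le> (LBINT x. c\<^sup>2 * (norm (g x))\<^sup>2)"
  proof (intro integral_mono_AE L2_integrable assms(1))
    show "integrable lborel (\<lambda>x. c\<^sup>2 * (norm (g x))\<^sup>2)"
      using L2_integrable[OF assms(2)] by simp
    show "AE x in lborel. (norm (f x))\<^sup>2 \<le> c\<^sup>2 * (norm (g x))\<^sup>2"
      using assms(4)
    proof eventually_elim
      case (elim x)
      then have "(norm (f x))\<^sup>2 \<le> (c * norm (g x))\<^sup>2" by (intro power_mono) auto
      then show ?case by (simp add: power_mult_distrib)
    qed
  qed
  then have "(norm (cls f))\<^sup>2 \<le> (c * norm (cls g))\<^sup>2"
    using assms by (simp add: norm_cls_sq power_mult_distrib)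
  then show ?thesis by (rule power2_le_imp_le) (use assms in simp)
qed

lemma mult_l2_cls:
  assumes m: "m \<in> borel_measurable borel" "\<And>x. norm (m x) \<le> c" and f: "f \<in> L2"
  shows "mult_l2 m (cls f) = cls (\<lambda>x. m x * f x)"
  unfolding mult_l2_def
proof (subst cls_eq_iff)
  show "AE x in lborel. m x * rep_l2 (cls f) x = m x * f x"
    using rep_l2_cls[OF f] by eventually_elim simp
qed (rule L2_bounded_mult[OF _ m], rule rep_l2_L2 f)+

lemma bounded_linear_mult_l2:
  assumes m: "m \<in> borel_measurable borel" "\<And>x. norm (m x) \<le> c"
  shows "bounded_linear (mult_l2 m)" "norm (mult_l2 m V) \<le> c * norm V"
proof -
  have c: "0 \<le> c" using m(2)[of 0] norm_ge_zero order_trans by blast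
  have le: "norm (mult_l2 m V) \<le> c * norm V" for V
  proof (cases V rule: l2_cases)
    case (1 f)
    then show ?thesis
      by (auto simp: mult_l2_cls[OF m] norm_mult intro!: norm_cls_mono L2_bounded_mult[OF _ m] c AE_I2 mult_right_mono m)
  qed
  then show "norm (mult_l2 m V) \<le> c * norm V" .
  show "bounded_linear (mult_l2 m)"
  proof (rule bounded_linear_intro[where K = c])
    fix V W :: l2 and r :: real
    obtain f where f: "f \<in> L2" "V = cls f" by (rule l2_cases)
    obtain g where g: "g \<in> L2" "W = cls g" by (rule l2_cases)
    note mL = L2_bounded_mult[OF _ m]
    show "mult_l2 m (V + W) = mult_l2 m V + mult_l2 m W"
      using f g by (simp add: cls_add[symmetric] mult_l2_cls[OF m] L2_add mL distrib_left)
    show "mult_l2 m (r *\<^sub>R V) = r *\<^sub>R mult_l2 m V"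
      using f by (simp add: cls_scaleR[symmetric] mult_l2_cls[OF m] L2_cmult mL mult.left_commute)
    show "norm (mult_l2 m V) \<le> norm V * c" using le[of V] by (simp add: mult.commute)
  qed
qed

lemma cnj_l2_cls:
  assumes f: "f \<in> L2"
  shows "cnj_l2 (cls f) = cls (\<lambda>x. cnj (f x))"
  unfolding cnj_l2_def
proof (subst cls_eq_iff)
  show "AE x in lborel. cnj (rep_l2 (cls f) x) = cnj (f x)"
    using rep_l2_cls[OF f] by eventually_elim simp
qed (intro L2_cnj rep_l2_L2 f)+

lemma norm_cnj_l2: "norm (cnj_l2 V) = norm V"
  by (cases V rule: l2_cases) (simp add: cnj_l2_cls norm_cls L2_cnj)

lemma bounded_linear_cnj_l2: "bounded_linear cnj_l2"
proof (rule bounded_linear_intro[where K = 1])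
  fix V W :: l2 and r :: real
  obtain f where f: "f \<in> L2" "V = cls f" by (rule l2_cases)
  obtain g where g: "g \<in> L2" "W = cls g" by (rule l2_cases)
  show "cnj_l2 (V + W) = cnj_l2 V + cnj_l2 W"
    using f g by (simp add: cls_add[symmetric] cnj_l2_cls L2_add L2_cnj)
  show "cnj_l2 (r *\<^sub>R V) = r *\<^sub>R cnj_l2 V"
    using f by (simp add: cls_scaleR[symmetric] cnj_l2_cls L2_cmult L2_cnj)
  show "norm (cnj_l2 V) \<le> norm V * 1" by (simp add: norm_cnj_l2)
qed


section \<open>The Fourier transform on square-integrable functions\<close>

abbreviation trunc :: "real \<Rightarrow> (real \<Rightarrow> complex) \<Rightarrow> real \<Rightarrow> complex" where
  "trunc R f \<equiv> \<lambda>x. indicator {-R..R} x * f x"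

lemma trunc_L2: "f \<in> L2 \<Longrightarrow> trunc R f \<in> L2"
  by (rule L2_bounded_mult[where c = 1]) (auto simp: indicator_def)

lemma trunc_integrable:
  assumes "f \<in> L2" shows "integrable lborel (trunc R f)"
proof (rule L2_mult_integrable[OF _ assms])
  have "integrable lborel (\<lambda>x. complex_of_real (indicator {-R..R} x))"
    by (intro integrable_of_real integrable_real_indicator) (auto simp: emeasure_lborel_Icc_eq)
  then have "integrable lborel (\<lambda>x. indicator {-R..R} x :: complex)"
    by (simp add: indicator_def of_bool_def if_distrib cong: if_cong)
  then show "(indicator {-R..R} :: real \<Rightarrow> complex) \<in> L2"
    by (rule L2_bounded_integrable[where M = 1]) (simp add: indicator_def)
qed

lemma trunc_fourier_L2: "f \<in> L2 \<Longrightarrow> fourier_integral (trunc R f) \<in> L2"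
  by (intro fourier_integral_contraction(1) trunc_integrable trunc_L2)

lemma trunc_tendsto:
  assumes "f \<in> L2"
  shows "((\<lambda>R. cls (trunc R f)) \<longlongrightarrow> cls f) at_top"
proof (rule tendsto_at_topI_sequentially)
  fix X :: "nat \<Rightarrow> real" assume X: "filterlim X at_top sequentially"
  note [measurable] = L2_measurable[OF assms]
  show "(\<lambda>n. cls (trunc (X n) f)) \<longlonglongrightarrow> cls f"
  proof (rule cls_tendsto_dominated(3)[OF _ _ assms])
    have "(\<lambda>n. trunc (X n) f x) \<longlonglongrightarrow> f x" for x
    proof (rule tendsto_eventually)
      have "eventually (\<lambda>n. \<bar>x\<bar> \<le> X n) sequentially"
        using X by (simp add: filterlim_at_top)
      then show "eventually (\<lambda>n. trunc (X n) f x = f x) sequentially"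
        by eventually_elim (simp add: indicator_def abs_le_iff)
    qed
    then show "AE x in lborel. (\<lambda>n. trunc (X n) f x) \<longlonglongrightarrow> f x" by simp
    show "norm (trunc (X n) f x) \<le> norm (f x)" for n x
      by (simp add: indicator_def)
  qed measurable
qed

text \<open>Since the limit is one of square-integrable functions, the transform is the continuous extension of the
  integral along truncations, and its properties follow by passing to the limit in L2.\<close>
lemma has_fourier_L2_iff:
  assumes "f \<in> L2" "g \<in> L2"
  shows "has_fourier_L2 f g \<longleftrightarrow> ((\<lambda>R. cls (fourier_integral (trunc R f))) \<longlongrightarrow> cls g) at_top"
proof -
  have "(\<integral>\<^sup>+ \<xi>. ennreal ((norm (fourier_integral (trunc R f) \<xi> - g \<xi>))\<^sup>2) \<partial>lborel)
      = ennreal ((norm (cls (fourier_integral (trunc R f)) - cls g))\<^sup>2)" for R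
    using assms trunc_fourier_L2[of f R]
    by (subst nn_integral_norm_cls) (simp_all add: L2_diff cls_diff)
  then have "has_fourier_L2 f g \<longleftrightarrow>
      ((\<lambda>R. ennreal ((norm (cls (fourier_integral (trunc R f)) - cls g))\<^sup>2)) \<longlongrightarrow> ennreal 0) at_top"
    using assms by (simp add: has_fourier_L2_def)
  also have "\<dots> \<longleftrightarrow> ((\<lambda>R. (norm (cls (fourier_integral (trunc R f)) - cls g))\<^sup>2) \<longlongrightarrow> 0) at_top"
    by (rule tendsto_ennreal_iff) auto
  also have "\<dots> \<longleftrightarrow> ((\<lambda>R. norm (cls (fourier_integral (trunc R f)) - cls g)) \<longlongrightarrow> 0) at_top"
    using tendsto_real_sqrt[of "\<lambda>R. (norm (cls (fourier_integral (trunc R f)) - cls g))\<^sup>2" 0 at_top]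
      tendsto_power[of "\<lambda>R. norm (cls (fourier_integral (trunc R f)) - cls g)" 0 at_top 2]
    by auto
  also have "\<dots> \<longleftrightarrow> ((\<lambda>R. cls (fourier_integral (trunc R f))) \<longlongrightarrow> cls g) at_top"
    by (simp only: tendsto_norm_zero_iff LIM_zero_iff)
  finally show ?thesis .
qed

lemma plancherel_diff:
  assumes "integrable lborel f" "f \<in> L2" "integrable lborel g" "g \<in> L2"
  shows "norm (cls (fourier_integral f) - cls (fourier_integral g)) = norm (cls f - cls g)"
proof -
  have "fourier_integral (\<lambda>x. f x - g x) = (\<lambda>\<xi>. fourier_integral f \<xi> - fourier_integral g \<xi>)"
    using assms by (intro ext fourier_integral_diff)
  then show ?thesis
    using plancherel_integrable[of "\<lambda>x. f x - g x"] assms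
    by (simp add: L2_diff cls_diff fourier_integral_contraction(1))
qed

text \<open>By isometry the transforms of the truncations form a Cauchy net, with the same mutual distances as the
  truncations.\<close>
lemma has_fourier_L2_exists:
  assumes f: "f \<in> L2"
  shows "\<exists>g. has_fourier_L2 f g"
proof -
  let ?F = "\<lambda>R. cls (fourier_integral (trunc R f))"
  have iso: "norm (?F R - ?F R') = norm (cls (trunc R f) - cls (trunc R' f))" for R R'
    by (intro plancherel_diff trunc_integrable trunc_L2 f)
  have real_top: "filterlim real at_top sequentially" by (rule filterlim_real_sequentially)
  have lim: "(\<lambda>n. cls (trunc (real n) f)) \<longlonglongrightarrow> cls f"
    by (rule filterlim_compose[OF trunc_tendsto[OF f] real_top])
  then have "Cauchy (\<lambda>n. cls (trunc (real n) f))" by (rule LIMSEQ_imp_Cauchy)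
  then have "Cauchy (\<lambda>n. ?F (real n))" by (simp add: Cauchy_def dist_norm iso)
  then obtain G where G: "(\<lambda>n. ?F (real n)) \<longlonglongrightarrow> G"
    using Cauchy_convergent convergent_def by blast
  have eq: "norm (?F R - G) = norm (cls (trunc R f) - cls f)" for R
  proof (rule LIMSEQ_unique)
    show "(\<lambda>n. norm (?F R - ?F (real n))) \<longlonglongrightarrow> norm (?F R - G)"
      by (intro tendsto_intros G)
    show "(\<lambda>n. norm (?F R - ?F (real n))) \<longlonglongrightarrow> norm (cls (trunc R f) - cls f)"
      unfolding iso by (intro tendsto_intros lim)
  qed
  have "((\<lambda>R. norm (?F R - G)) \<longlongrightarrow> 0) at_top"
    unfolding eq using trunc_tendsto[OF f] by (simp add: tendsto_norm_zero_iff LIM_zero_iff)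
  then have "(?F \<longlongrightarrow> cls (rep_l2 G)) at_top"
    by (simp add: tendsto_norm_zero_iff LIM_zero_iff)
  then show ?thesis using has_fourier_L2_iff[OF f rep_l2_L2] by blast
qed

text \<open>On the intersection of L1 and L2 the integral is a limit of its truncations, by isometry.\<close>
lemma has_fourier_L2_fourier:
  assumes f: "f \<in> L2"
  shows "has_fourier_L2 f (fourier f)"
proof (cases "integrable lborel f")
  case True
  have "norm (cls (fourier_integral (trunc R f)) - cls (fourier_integral f)) = norm (cls (trunc R f) - cls f)" for R
    by (intro plancherel_diff trunc_integrable trunc_L2 f True)
  moreover have "((\<lambda>R. norm (cls (trunc R f) - cls f)) \<longlongrightarrow> 0) at_top"
    using trunc_tendsto[OF f] by (simp add: tendsto_norm_zero_iff LIM_zero_iff)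
  ultimately have "((\<lambda>R. norm (cls (fourier_integral (trunc R f)) - cls (fourier_integral f))) \<longlongrightarrow> 0) at_top"
    by simp
  then have "((\<lambda>R. cls (fourier_integral (trunc R f))) \<longlongrightarrow> cls (fourier_integral f)) at_top"
    by (simp add: tendsto_norm_zero_iff LIM_zero_iff)
  then show ?thesis
    using True by (simp add: has_fourier_L2_iff f fourier_integral_contraction(1) fourier_def)
next
  case False
  then show ?thesis using someI_ex[OF has_fourier_L2_exists[OF f]] by (simp add: fourier_def)
qed

lemma fourier_L2: "f \<in> L2 \<Longrightarrow> fourier f \<in> L2"
  using has_fourier_L2_fourier by (auto simp: has_fourier_L2_def)

lemma fourier_tendsto:
  "f \<in> L2 \<Longrightarrow> ((\<lambda>R. cls (fourier_integral (trunc R f))) \<longlongrightarrow> cls (fourier f)) at_top"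
  using has_fourier_L2_fourier has_fourier_L2_iff fourier_L2 by blast

lemma fourier_unique:
  assumes "has_fourier_L2 f g"
  shows "AE \<xi> in lborel. fourier f \<xi> = g \<xi>"
proof -
  have L: "f \<in> L2" "g \<in> L2" using assms by (auto simp: has_fourier_L2_def)
  have "cls (fourier f) = cls g"
    using assms has_fourier_L2_iff[OF L] fourier_tendsto[OF L(1)] tendsto_unique trivial_limit_at_top_linorder
    by blast
  then show ?thesis using L by (simp add: cls_eq_iff fourier_L2)
qed

lemma fourier_cong_AE:
  assumes f: "f \<in> L2" and g: "g \<in> L2" and eq: "AE x in lborel. f x = g x"
  shows "cls (fourier f) = cls (fourier g)"
proof -
  note [measurable] = L2_measurable[OF f] L2_measurable[OF g]
  have "fourier_integral (trunc R f) = fourier_integral (trunc R g)" for R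
    by (rule fourier_integral_cong_AE) (use eq in \<open>measurable, auto\<close>)
  then show ?thesis
    using fourier_tendsto[OF f] fourier_tendsto[OF g] tendsto_unique trivial_limit_at_top_linorder
    by fastforce
qed

lemma norm_fourier:
  assumes f: "f \<in> L2" shows "norm (cls (fourier f)) = norm (cls f)"
proof -
  have "((\<lambda>R. norm (cls (fourier_integral (trunc R f)))) \<longlongrightarrow> norm (cls (fourier f))) at_top"
    by (intro tendsto_norm fourier_tendsto f)
  moreover have "((\<lambda>R. norm (cls (fourier_integral (trunc R f)))) \<longlongrightarrow> norm (cls f)) at_top"
    using tendsto_norm[OF trunc_tendsto[OF f]]
    by (simp add: plancherel_integrable trunc_integrable trunc_L2 f)
  ultimately show ?thesis using tendsto_unique trivial_limit_at_top_linorder by blast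
qed

lemma fourier_add:
  assumes f: "f \<in> L2" and g: "g \<in> L2"
  shows "AE \<xi> in lborel. fourier (\<lambda>x. f x + g x) \<xi> = fourier f \<xi> + fourier g \<xi>"
proof (rule fourier_unique, subst has_fourier_L2_iff)
  have "fourier_integral (trunc R (\<lambda>x. f x + g x))
      = (\<lambda>\<xi>. fourier_integral (trunc R f) \<xi> + fourier_integral (trunc R g) \<xi>)" for R
    by (rule ext) (simp add: distrib_left fourier_integral_add trunc_integrable f g)
  then show "((\<lambda>R. cls (fourier_integral (trunc R (\<lambda>x. f x + g x)))) \<longlongrightarrow> cls (\<lambda>\<xi>. fourier f \<xi> + fourier g \<xi>)) at_top"
    by (simp add: cls_add trunc_fourier_L2 fourier_L2 f g tendsto_add fourier_tendsto)
qed (intro L2_add fourier_L2 f g)+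

lemma fourier_cmult:
  assumes f: "f \<in> L2"
  shows "AE \<xi> in lborel. fourier (\<lambda>x. c * f x) \<xi> = c * fourier f \<xi>"
proof (rule fourier_unique, subst has_fourier_L2_iff)
  have m: "(\<lambda>x. c) \<in> borel_measurable borel" "\<And>x::real. norm c \<le> norm c" by auto
  have "fourier_integral (trunc R (\<lambda>x. c * f x)) = (\<lambda>\<xi>. c * fourier_integral (trunc R f) \<xi>)" for R
    by (rule ext) (simp add: mult.left_commute[of _ c] fourier_integral_cmult)
  then have "cls (fourier_integral (trunc R (\<lambda>x. c * f x))) = mult_l2 (\<lambda>_. c) (cls (fourier_integral (trunc R f)))" for R
    by (simp add: mult_l2_cls[OF m] trunc_fourier_L2 f)
  then show "((\<lambda>R. cls (fourier_integral (trunc R (\<lambda>x. c * f x)))) \<longlongrightarrow> cls (\<lambda>\<xi>. c * fourier f \<xi>)) at_top"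
    using bounded_linear.tendsto[OF bounded_linear_mult_l2(1)[OF m] fourier_tendsto[OF f]]
    by (simp add: mult_l2_cls[OF m] fourier_L2 f)
qed (intro L2_cmult fourier_L2 f)+

lemma fourier_diff:
  assumes f: "f \<in> L2" and g: "g \<in> L2"
  shows "AE \<xi> in lborel. fourier (\<lambda>x. f x - g x) \<xi> = fourier f \<xi> - fourier g \<xi>"
  using fourier_add[OF f L2_cmult[OF g, of "-1"]] fourier_cmult[OF g, of "-1"]
  by eventually_elim simp

lemma L2_affine:
  assumes f: "f \<in> L2" and c: "c \<noteq> 0"
  shows "(\<lambda>x. f (t + c * x)) \<in> L2"
proof (rule L2_I)
  note [measurable] = L2_measurable[OF f]
  show "(\<lambda>x. f (t + c * x)) \<in> borel_measurable borel" by measurable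
  show "integrable lborel (\<lambda>x. (norm (f (t + c * x)))\<^sup>2)"
    by (rule lborel_integrable_real_affine[OF L2_integrable[OF f] c])
qed

text \<open>Pointwise for the truncated integrals; the translation passes through the limit because Lebesgue
  measure is invariant.\<close>
lemma fourier_modulation:
  assumes f: "f \<in> L2"
  shows "AE \<xi> in lborel. fourier (\<lambda>x. cis (a * x) * f x) \<xi> = fourier f (\<xi> - a)"
proof (rule fourier_unique)
  let ?f = "\<lambda>x. cis (a * x) * f x"
  have fL: "?f \<in> L2" by (rule L2_bounded_mult[OF f, where c = 1]) auto
  have gL: "(\<lambda>\<xi>. fourier f (\<xi> - a)) \<in> L2"
    using L2_affine[OF fourier_L2[OF f], of 1 "-a"] by simp
  have *: "fourier_integral (trunc R ?f) \<xi> = fourier_integral (trunc R f) (\<xi> - a)" for R \<xi>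
  proof -
    have eq: "cis (- (x * \<xi>)) * trunc R ?f x = cis (- (x * (\<xi> - a))) * trunc R f x" for x
    proof -
      have "cis (- (x * \<xi>)) * cis (a * x) = cis (- (x * (\<xi> - a)))"
        unfolding cis_mult by (rule arg_cong[where f = cis]) (simp add: algebra_simps)
      then show ?thesis by (simp add: mult_ac)
    qed
    show ?thesis unfolding fourier_integral_cis by (simp only: eq)
  qed
  have "(\<integral>\<^sup>+ \<xi>. ennreal ((norm (fourier_integral (trunc R ?f) \<xi> - fourier f (\<xi> - a)))\<^sup>2) \<partial>lborel)
      = (\<integral>\<^sup>+ \<xi>. ennreal ((norm (fourier_integral (trunc R f) \<xi> - fourier f \<xi>))\<^sup>2) \<partial>lborel)" for R
    unfolding *
    using L2_measurable[OF trunc_fourier_L2[OF f, of R]] L2_measurable[OF fourier_L2[OF f]]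
      nn_integral_translate[of "\<lambda>\<xi>. ennreal ((norm (fourier_integral (trunc R f) \<xi> - fourier f \<xi>))\<^sup>2)" "-a"]
    by simp
  then show "has_fourier_L2 ?f (\<lambda>\<xi>. fourier f (\<xi> - a))"
    using has_fourier_L2_fourier[OF f] fL gL unfolding has_fourier_L2_def by simp
qed

lemma fourier_integral_cnj:
  "fourier_integral (\<lambda>x. cnj (f x)) \<xi> = cnj (fourier_integral f (- \<xi>))"
proof -
  have "(LBINT x. cis (- (x * \<xi>)) * cnj (f x)) = (LBINT x. cnj (cis (- (x * - \<xi>)) * f x))"
    by (simp add: cis_cnj)
  also have "\<dots> = cnj (LBINT x. cis (- (x * - \<xi>)) * f x)"
    by (rule Bochner_Integration.integral_cnj)
  finally show ?thesis by (simp add: fourier_integral_cis)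
qed

lemma fourier_cnj:
  assumes f: "f \<in> L2"
  shows "AE \<xi> in lborel. fourier (\<lambda>x. cnj (f x)) \<xi> = cnj (fourier f (- \<xi>))"
proof (rule fourier_unique)
  let ?f = "\<lambda>x. cnj (f x)"
  have gL: "(\<lambda>\<xi>. cnj (fourier f (- \<xi>))) \<in> L2"
    using L2_cnj[OF L2_affine[OF fourier_L2[OF f], of "-1" 0]] by simp
  have "trunc R ?f = (\<lambda>x. cnj (trunc R f x))" for R by (auto simp: indicator_def)
  then have *: "fourier_integral (trunc R ?f) \<xi> = cnj (fourier_integral (trunc R f) (- \<xi>))" for R \<xi>
    by (simp only: fourier_integral_cnj)
  have "(\<integral>\<^sup>+ \<xi>. ennreal ((norm (fourier_integral (trunc R ?f) \<xi> - cnj (fourier f (- \<xi>))))\<^sup>2) \<partial>lborel)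
      = (\<integral>\<^sup>+ \<xi>. ennreal ((norm (fourier_integral (trunc R f) (0 + -1 * \<xi>) - fourier f (0 + -1 * \<xi>)))\<^sup>2) \<partial>lborel)" for R
    unfolding * complex_cnj_diff[symmetric] complex_mod_cnj by simp
  also have "\<dots> R = (\<integral>\<^sup>+ \<xi>. ennreal ((norm (fourier_integral (trunc R f) \<xi> - fourier f \<xi>))\<^sup>2) \<partial>lborel)" for R
    using L2_measurable[OF trunc_fourier_L2[OF f, of R]] L2_measurable[OF fourier_L2[OF f]]
    by (subst nn_integral_real_affine[where c = "-1" and t = 0
        and f = "\<lambda>\<xi>. ennreal ((norm (fourier_integral (trunc R f) \<xi> - fourier f \<xi>))\<^sup>2)"]) auto
  finally show "has_fourier_L2 ?f (\<lambda>\<xi>. cnj (fourier f (- \<xi>)))"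
    using has_fourier_L2_fourier[OF f] L2_cnj[OF f] gL unfolding has_fourier_L2_def by simp
qed

text \<open>An isometry preserves the real inner product.\<close>
lemma parseval:
  assumes f: "f \<in> L2" and g: "g \<in> L2"
  shows "cls (fourier f) \<bullet> cls (fourier g) = cls f \<bullet> cls g"
proof -
  have "cls (fourier (\<lambda>x. f x + g x)) = cls (fourier f) + cls (fourier g)"
    using fourier_add[OF f g] f g by (simp add: cls_add[symmetric] cls_eq_iff L2_add fourier_L2)
  then have "norm (cls (fourier f) + cls (fourier g)) = norm (cls f + cls g)"
    using norm_fourier[OF L2_add[OF f g]] f g by (simp add: cls_add)
  then show ?thesis by (simp add: dot_norm norm_fourier f g)
qed

text \<open>The multiplication formula for truncations, in the limit. The adjoint is the transform conjugated
  with complex conjugation, that is, the candidate for the inverse.\<close>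
lemma fourier_adjoint:
  assumes f: "f \<in> L2" and g: "g \<in> L2"
  shows "cls (fourier f) \<bullet> cls g = cls f \<bullet> cls (\<lambda>x. cnj (fourier (\<lambda>y. cnj (g y)) x))"
proof -
  let ?g = "\<lambda>y. cnj (g y)"
  have gL: "?g \<in> L2" by (rule L2_cnj[OF g])
  have "cls (fourier_integral (trunc R f)) \<bullet> cls (trunc R g)
      = cls (trunc R f) \<bullet> cnj_l2 (cls (fourier_integral (trunc R ?g)))" for R
  proof -
    have tr: "cnj (trunc R g x) = trunc R ?g x" for x by (simp add: indicator_def)
    have "cls (fourier_integral (trunc R f)) \<bullet> cls (trunc R g)
      = (LBINT \<xi>. Re (fourier_integral (trunc R f) \<xi> * trunc R ?g \<xi>))"
      by (simp only: inner_cls trunc_fourier_L2 trunc_L2 f g inner_complex_eq tr)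
    also have "\<dots> = Re (LBINT \<xi>. fourier_integral (trunc R f) \<xi> * trunc R ?g \<xi>)"
      by (intro integral_Re L2_mult_integrable trunc_fourier_L2 trunc_L2 f gL)
    also have "\<dots> = Re (LBINT x. trunc R f x * fourier_integral (trunc R ?g) x)"
      by (subst fourier_integral_multiplication) (intro trunc_integrable f gL refl)+
    also have "\<dots> = (LBINT x. Re (trunc R f x * fourier_integral (trunc R ?g) x))"
      by (intro integral_Re[symmetric] L2_mult_integrable trunc_fourier_L2 trunc_L2 f gL)
    also have "\<dots> = cls (trunc R f) \<bullet> cnj_l2 (cls (fourier_integral (trunc R ?g)))"
      by (simp only: cnj_l2_cls inner_cls trunc_fourier_L2 trunc_L2 L2_cnj f gL inner_complex_eq complex_cnj_cnj)
    finally show ?thesis .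
  qed
  moreover have "((\<lambda>R. cls (fourier_integral (trunc R f)) \<bullet> cls (trunc R g)) \<longlongrightarrow> cls (fourier f) \<bullet> cls g) at_top"
    by (intro tendsto_inner fourier_tendsto trunc_tendsto f g)
  moreover have "((\<lambda>R. cls (trunc R f) \<bullet> cnj_l2 (cls (fourier_integral (trunc R ?g))))
      \<longlongrightarrow> cls f \<bullet> cnj_l2 (cls (fourier ?g))) at_top"
    by (intro tendsto_inner bounded_linear.tendsto[OF bounded_linear_cnj_l2] fourier_tendsto trunc_tendsto f gL)
  ultimately have "cls (fourier f) \<bullet> cls g = cls f \<bullet> cnj_l2 (cls (fourier ?g))"
    using tendsto_unique[OF trivial_limit_at_top_linorder] by simp
  then show ?thesis by (simp add: cnj_l2_cls fourier_L2 gL)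
qed

text \<open>The transform and its adjoint are both isometries, so they are inverse to each other.\<close>
lemma fourier_of_adjoint:
  assumes g: "g \<in> L2"
  shows "AE \<xi> in lborel. fourier (\<lambda>x. cnj (fourier (\<lambda>y. cnj (g y)) x)) \<xi> = g \<xi>"
proof -
  let ?A = "\<lambda>g x. cnj (fourier (\<lambda>y. cnj (g y)) x)"
  have A: "?A h \<in> L2" if "h \<in> L2" for h using that by (intro L2_cnj fourier_L2)
  have "cls (fourier (?A g)) \<bullet> U = cls g \<bullet> U" for U
  proof (cases U rule: l2_cases)
    case (1 u)
    have "cls (fourier (?A g)) \<bullet> U = cls (?A g) \<bullet> cls (?A u)"
      by (simp add: 1 fourier_adjoint A g)
    also have "\<dots> = cls (fourier (\<lambda>y. cnj (g y))) \<bullet> cls (fourier (\<lambda>y. cnj (u y)))"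
      using g 1 by (simp add: inner_cls L2_cnj fourier_L2 inner_complex_def)
    also have "\<dots> = cls (\<lambda>y. cnj (g y)) \<bullet> cls (\<lambda>y. cnj (u y))"
      by (intro parseval L2_cnj g 1)
    also have "\<dots> = cls g \<bullet> U"
      using g 1 by (simp add: inner_cls L2_cnj inner_complex_def)
    finally show ?thesis .
  qed
  then have "cls (fourier (?A g)) = cls g" using vector_eq_rdot by blast
  then show ?thesis using g A by (simp add: cls_eq_iff fourier_L2)
qed

lemma adjoint_of_fourier:
  assumes f: "f \<in> L2"
  shows "AE x in lborel. f x = cnj (fourier (\<lambda>\<xi>. cnj (fourier f \<xi>)) x)"
proof -
  let ?A = "\<lambda>g x. cnj (fourier (\<lambda>y. cnj (g y)) x)"
  have A: "?A (fourier f) \<in> L2" by (intro L2_cnj fourier_L2 f)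
  have "U \<bullet> cls f = U \<bullet> cls (?A (fourier f))" for U
    by (cases U rule: l2_cases) (simp add: fourier_adjoint[symmetric] fourier_L2 f parseval)
  then have "cls f = cls (?A (fourier f))" using vector_eq_ldot by blast
  then show ?thesis using f A by (simp add: cls_eq_iff)
qed

lemma fourier_surj:
  assumes "g \<in> L2"
  obtains h where "h \<in> L2" "AE \<xi> in lborel. fourier h \<xi> = g \<xi>"
  using fourier_of_adjoint[OF assms] L2_cnj[OF fourier_L2[OF L2_cnj[OF assms]]] by blast

lemma fourier_inj:
  assumes f: "f \<in> L2" and g: "g \<in> L2" and eq: "AE \<xi> in lborel. fourier f \<xi> = fourier g \<xi>"
  shows "AE x in lborel. f x = g x"
proof -
  have "AE \<xi> in lborel. fourier (\<lambda>x. f x - g x) \<xi> = 0"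
    using fourier_diff[OF f g] eq by eventually_elim simp
  then have "cls (fourier (\<lambda>x. f x - g x)) = 0"
    by (simp add: cls_zero[symmetric] cls_eq_iff fourier_L2 L2_diff f g L2_zero)
  then have "cls f - cls g = 0"
    using norm_fourier[OF L2_diff[OF f g]] by (simp add: cls_diff f g)
  then show ?thesis by (simp add: cls_eq_iff f g)
qed


section \<open>Sobolev spaces as weighted copies of the space of classes\<close>

definition wt :: "real \<Rightarrow> real \<Rightarrow> real" where
  "wt s \<xi> = (1 + \<xi>\<^sup>2) powr (s / 2)"

text \<open>A linear isometry of \<open>H\<^sup>s\<close>, modulo null functions, onto the space of classes (for \<open>s \<ge> 0\<close>).\<close>
definition sob :: "real \<Rightarrow> (real \<Rightarrow> complex) \<Rightarrow> l2" where
  "sob s f = cls (\<lambda>\<xi>. of_real (wt s \<xi>) * fourier f \<xi>)"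

lemma one_plus_sq_pos: "0 < 1 + (\<xi>::real)\<^sup>2"
  by (simp add: add_pos_nonneg)

lemma wt_pos [simp]: "0 < wt s \<xi>"
  using one_plus_sq_pos[of \<xi>] by (simp add: wt_def)

lemma wt_nonneg [simp]: "0 \<le> wt s \<xi>"
  by (rule less_imp_le) simp

lemma wt_nonzero [simp]: "wt s \<xi> \<noteq> 0"
  using wt_pos[of s \<xi>] by linarith

lemma wt_measurable [measurable]: "wt s \<in> borel_measurable borel"
  unfolding wt_def[abs_def] by measurable

lemma wt_add: "wt (s + r) \<xi> = wt s \<xi> * wt r \<xi>"
  by (simp add: wt_def powr_add[symmetric] add_divide_distrib)

lemma wt_mono: "s \<le> r \<Longrightarrow> wt s \<xi> \<le> wt r \<xi>"
  by (simp add: wt_def powr_mono)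

lemma wt_0 [simp]: "wt 0 \<xi> = 1"
  using one_plus_sq_pos[of \<xi>] by (simp add: wt_def)

lemma wt_2: "wt 2 \<xi> = 1 + \<xi>\<^sup>2"
  using one_plus_sq_pos[of \<xi>] by (simp add: wt_def)

lemma wt_uminus [simp]: "wt s (- \<xi>) = wt s \<xi>"
  by (simp add: wt_def)

lemma wt_sq: "(wt s \<xi>)\<^sup>2 = (1 + \<xi>\<^sup>2) powr s"
  by (simp add: wt_def power2_eq_square powr_add[symmetric])

text \<open>On the line, one negative power of \<open>(1 + \<xi>\<^sup>2)\<^sup>1\<^sup>/\<^sup>2\<close> suffices to make a bounded function
  square-integrable; all estimates of the nonlinear term end with this fact.\<close>
lemma wt_minus1_L2: "(\<lambda>\<xi>. complex_of_real (wt (-1) \<xi>)) \<in> L2"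
proof (rule L2_I)
  have "integrable lborel (\<lambda>x::real. inverse (1 + x\<^sup>2))"
    using integrable_inverse_1_plus_square by (simp add: set_integrable_def)
  moreover have "(norm (complex_of_real (wt (-1) \<xi>)))\<^sup>2 = inverse (1 + \<xi>\<^sup>2)" for \<xi>
    using one_plus_sq_pos[of \<xi>] by (simp add: wt_sq powr_minus)
  ultimately show "integrable lborel (\<lambda>\<xi>. (norm (complex_of_real (wt (-1) \<xi>)))\<^sup>2)"
    by simp
qed measurable

text \<open>Peetre's inequality.\<close>
lemma wt_submultiplicative:
  assumes "0 \<le> s"
  shows "wt s (x + y) \<le> 2 powr (s / 2) * (wt s x * wt s y)"
proof -
  have "1 + (x + y)\<^sup>2 \<le> 2 * ((1 + x\<^sup>2) * (1 + y\<^sup>2))"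
  proof -
    have "2 * ((1 + x\<^sup>2) * (1 + y\<^sup>2)) - (1 + (x + y)\<^sup>2) = 1 + (x - y)\<^sup>2 + 2 * (x * y)\<^sup>2"
      by (simp add: power2_eq_square algebra_simps)
    then show ?thesis by (smt (verit) zero_le_power2)
  qed
  then have "wt s (x + y) \<le> (2 * ((1 + x\<^sup>2) * (1 + y\<^sup>2))) powr (s / 2)"
    using assms unfolding wt_def by (intro powr_mono2) auto
  also have "\<dots> = 2 powr (s / 2) * (wt s x * wt s y)"
    by (simp add: wt_def powr_mult)
  finally show ?thesis .
qed

lemma Hs_iff: "f \<in> Hs s \<longleftrightarrow> f \<in> L2 \<and> (\<lambda>\<xi>. of_real (wt s \<xi>) * fourier f \<xi>) \<in> L2"
proof -
  have "(norm (of_real (wt s \<xi>) * fourier f \<xi>))\<^sup>2 = (1 + \<xi>\<^sup>2) powr s * (norm (fourier f \<xi>))\<^sup>2" for \<xi>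
    by (simp add: norm_mult power_mult_distrib wt_sq)
  moreover have "(\<lambda>\<xi>. of_real (wt s \<xi>) * fourier f \<xi>) \<in> borel_measurable borel" if "f \<in> L2"
  proof -
    note [measurable] = L2_measurable[OF fourier_L2[OF that]]
    show ?thesis by measurable
  qed
  ultimately show ?thesis by (auto simp: Hs_def L2_def)
qed

lemma Hs_L2: "f \<in> Hs s \<Longrightarrow> f \<in> L2"
  by (simp add: Hs_iff)

lemma Hs_weighted: "f \<in> Hs s \<Longrightarrow> (\<lambda>\<xi>. of_real (wt s \<xi>) * fourier f \<xi>) \<in> L2"
  by (simp add: Hs_iff)

lemma Hs_norm_sob: "f \<in> Hs s \<Longrightarrow> Hs_norm s f = norm (sob s f)"
  by (simp add: Hs_norm_def sob_def norm_cls Hs_weighted norm_mult power_mult_distrib wt_sq)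

lemma Hs_I:
  assumes f: "f \<in> L2" and g: "AE \<xi> in lborel. fourier f \<xi> = g \<xi>"
    and w: "(\<lambda>\<xi>. of_real (wt s \<xi>) * g \<xi>) \<in> L2"
  shows "f \<in> Hs s" "sob s f = cls (\<lambda>\<xi>. of_real (wt s \<xi>) * g \<xi>)"
proof -
  note [measurable] = L2_measurable[OF fourier_L2[OF f]]
  have eq: "AE \<xi> in lborel. of_real (wt s \<xi>) * fourier f \<xi> = of_real (wt s \<xi>) * g \<xi>"
    using g by eventually_elim simp
  have "(\<lambda>\<xi>. of_real (wt s \<xi>) * fourier f \<xi>) \<in> L2"
  proof (rule L2_dominated[OF _ w, where c = 1])
    show "AE \<xi> in lborel. norm (of_real (wt s \<xi>) * fourier f \<xi>) \<le> 1 * norm (of_real (wt s \<xi>) * g \<xi>)"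
      using eq by eventually_elim simp
  qed measurable
  with f show "f \<in> Hs s" by (simp add: Hs_iff)
  then show "sob s f = cls (\<lambda>\<xi>. of_real (wt s \<xi>) * g \<xi>)"
    using eq w by (simp add: sob_def cls_eq_iff Hs_weighted)
qed

lemma Hs_add:
  assumes f: "f \<in> Hs s" and g: "g \<in> Hs s"
  shows "(\<lambda>x. f x + g x) \<in> Hs s" "sob s (\<lambda>x. f x + g x) = sob s f + sob s g"
proof -
  have "(\<lambda>\<xi>. of_real (wt s \<xi>) * (fourier f \<xi> + fourier g \<xi>)) \<in> L2"
    using L2_add[OF Hs_weighted[OF f] Hs_weighted[OF g]] by (simp add: distrib_left)
  note * = Hs_I[OF L2_add[OF Hs_L2[OF f] Hs_L2[OF g]] fourier_add[OF Hs_L2[OF f] Hs_L2[OF g]] this]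
  show "(\<lambda>x. f x + g x) \<in> Hs s" by (rule *)
  show "sob s (\<lambda>x. f x + g x) = sob s f + sob s g"
    using *(2) Hs_weighted[OF f] Hs_weighted[OF g] by (simp add: distrib_left cls_add sob_def)
qed

lemma Hs_cmult:
  assumes f: "f \<in> Hs s"
  shows "(\<lambda>x. c * f x) \<in> Hs s" "sob s (\<lambda>x. c * f x) = mult_l2 (\<lambda>_. c) (sob s f)"
proof -
  have "(\<lambda>\<xi>. of_real (wt s \<xi>) * (c * fourier f \<xi>)) \<in> L2"
    using L2_cmult[OF Hs_weighted[OF f], of c] by (simp add: mult_ac)
  note * = Hs_I[OF L2_cmult[OF Hs_L2[OF f]] fourier_cmult[OF Hs_L2[OF f]] this]
  show "(\<lambda>x. c * f x) \<in> Hs s" by (rule *)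
  show "sob s (\<lambda>x. c * f x) = mult_l2 (\<lambda>_. c) (sob s f)"
    using *(2) Hs_weighted[OF f] mult_l2_cls[of "\<lambda>_. c" "norm c"]
    by (simp add: mult.left_commute[of _ c] sob_def)
qed

lemma Hs_scaleR:
  assumes f: "f \<in> Hs s"
  shows "sob s (\<lambda>x. of_real r * f x) = r *\<^sub>R sob s f"
  using Hs_cmult(2)[OF f, of "of_real r"] mult_l2_cls[of "\<lambda>_. of_real r" "norm r" "\<lambda>\<xi>. of_real (wt s \<xi>) * fourier f \<xi>"]
  by (simp add: sob_def Hs_weighted[OF f] cls_scaleR)

lemma Hs_diff:
  assumes f: "f \<in> Hs s" and g: "g \<in> Hs s"
  shows "(\<lambda>x. f x - g x) \<in> Hs s" "sob s (\<lambda>x. f x - g x) = sob s f - sob s g"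
  using Hs_add[OF f Hs_cmult(1)[OF g, of "-1"]] Hs_scaleR[OF g, of "-1"] by simp_all

lemma Hs_zero: "(\<lambda>x. 0) \<in> Hs s" "sob s (\<lambda>x. 0) = 0"
proof -
  have *: "fourier (\<lambda>x. 0) = (\<lambda>\<xi>. 0)"
    by (rule ext) (simp add: fourier_def fourier_integral_def)
  show "(\<lambda>x. 0) \<in> Hs s" "sob s (\<lambda>x. 0) = 0"
    by (simp_all add: Hs_iff sob_def * L2_zero cls_zero)
qed

lemma Hs_sum:
  assumes "finite I" "\<And>i. i \<in> I \<Longrightarrow> f i \<in> Hs s"
  shows "(\<lambda>x. \<Sum>i\<in>I. of_real (r i) * f i x) \<in> Hs s \<and>
    sob s (\<lambda>x. \<Sum>i\<in>I. of_real (r i) * f i x) = (\<Sum>i\<in>I. r i *\<^sub>R sob s (f i))"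
  using assms
proof (induction I rule: finite_induct)
  case empty
  then show ?case by (simp add: Hs_zero)
next
  case (insert i I)
  then show ?case by (simp add: Hs_add Hs_cmult(1) Hs_scaleR)
qed

lemma sob_eq_iff:
  assumes f: "f \<in> Hs s" and g: "g \<in> Hs s"
  shows "sob s f = sob s g \<longleftrightarrow> (AE x in lborel. f x = g x)"
proof
  assume "sob s f = sob s g"
  then have "AE \<xi> in lborel. of_real (wt s \<xi>) * fourier f \<xi> = of_real (wt s \<xi>) * fourier g \<xi>"
    using f g by (simp add: sob_def cls_eq_iff Hs_weighted)
  then have "AE \<xi> in lborel. fourier f \<xi> = fourier g \<xi>"
    by eventually_elim simp
  then show "AE x in lborel. f x = g x"
    by (rule fourier_inj[OF Hs_L2[OF f] Hs_L2[OF g]])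
next
  assume "AE x in lborel. f x = g x"
  then have "cls (fourier f) = cls (fourier g)"
    by (rule fourier_cong_AE[OF Hs_L2[OF f] Hs_L2[OF g]])
  then have "AE \<xi> in lborel. fourier f \<xi> = fourier g \<xi>"
    using f g by (simp add: cls_eq_iff fourier_L2 Hs_L2)
  then have "AE \<xi> in lborel. of_real (wt s \<xi>) * fourier f \<xi> = of_real (wt s \<xi>) * fourier g \<xi>"
    by eventually_elim simp
  then show "sob s f = sob s g"
    using f g by (simp add: sob_def cls_eq_iff Hs_weighted)
qed

text \<open>Membership only depends on the class, but the definition mentions the transform, which is chosen for each
  representative separately.\<close>
lemma Hs_cong_AE:
  assumes f: "f \<in> Hs s" and g: "g \<in> borel_measurable borel" and eq: "AE x in lborel. f x = g x"
  shows "g \<in> Hs s"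
proof -
  have gL: "g \<in> L2"
    by (rule L2_dominated[OF g Hs_L2[OF f], where c = 1]) (use eq in \<open>auto elim: eventually_mono\<close>)
  have "AE x in lborel. g x = f x" using eq by eventually_elim simp
  then have "AE \<xi> in lborel. fourier g \<xi> = fourier f \<xi>"
    using fourier_cong_AE[OF gL Hs_L2[OF f]] gL Hs_L2[OF f]
    by (simp add: cls_eq_iff fourier_L2)
  from Hs_I(1)[OF gL this Hs_weighted[OF f]] show ?thesis .
qed

lemma sob_surj:
  assumes s: "0 \<le> s"
  obtains f where "f \<in> Hs s" "sob s f = V"
proof -
  obtain v where v: "v \<in> L2" "V = cls v" by (rule l2_cases)
  have "(\<lambda>\<xi>. of_real (wt (- s) \<xi>) * v \<xi>) \<in> L2"
    using wt_mono[of "- s" 0] s by (intro L2_bounded_mult[OF v(1), where c = 1]) auto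
  then obtain f where f: "f \<in> L2" "AE \<xi> in lborel. fourier f \<xi> = of_real (wt (- s) \<xi>) * v \<xi>"
    by (rule fourier_surj)
  have eq: "(\<lambda>\<xi>. of_real (wt s \<xi>) * (of_real (wt (- s) \<xi>) * v \<xi>)) = v"
    by (rule ext) (simp add: wt_add[symmetric] flip: mult.assoc of_real_mult)
  from Hs_I[OF f, of s] that v show thesis unfolding eq by metis
qed

lemma Hs_mono:
  assumes f: "f \<in> Hs r" and sr: "s \<le> r"
  shows "f \<in> Hs s" "norm (sob s f) \<le> norm (sob r f)"
proof -
  have le: "norm (of_real (wt s \<xi>) * fourier f \<xi>) \<le> norm (of_real (wt r \<xi>) * fourier f \<xi>)" for \<xi>
    using wt_mono[OF sr, of \<xi>] by (simp add: norm_mult mult_right_mono)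
  note [measurable] = L2_measurable[OF fourier_L2[OF Hs_L2[OF f]]]
  have "(\<lambda>\<xi>. of_real (wt s \<xi>) * fourier f \<xi>) \<in> L2"
    by (rule L2_dominated[OF _ Hs_weighted[OF f], where c = 1]) (measurable, simp add: le)
  then show "f \<in> Hs s" using f by (simp add: Hs_iff)
  then show "norm (sob s f) \<le> norm (sob r f)"
    using norm_cls_mono[of "\<lambda>\<xi>. of_real (wt s \<xi>) * fourier f \<xi>" "\<lambda>\<xi>. of_real (wt r \<xi>) * fourier f \<xi>" 1] f le
    by (simp add: sob_def Hs_weighted)
qed


section \<open>Fourier multipliers\<close>

lemma multiplier_spec:
  assumes "(\<lambda>\<xi>. m \<xi> * fourier f \<xi>) \<in> L2"
  shows "multiplier m f \<in> L2" "AE \<xi> in lborel. fourier (multiplier m f) \<xi> = m \<xi> * fourier f \<xi>"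
proof -
  obtain h where "h \<in> L2" "AE \<xi> in lborel. fourier h \<xi> = m \<xi> * fourier f \<xi>"
    by (rule fourier_surj[OF assms])
  then have "\<exists>h. h \<in> L2 \<and> (AE \<xi> in lborel. fourier h \<xi> = m \<xi> * fourier f \<xi>)"
    by (intro exI conjI)
  then have "multiplier m f \<in> L2 \<and> (AE \<xi> in lborel. fourier (multiplier m f) \<xi> = m \<xi> * fourier f \<xi>)"
    unfolding multiplier_def by (rule someI_ex)
  then show "multiplier m f \<in> L2" "AE \<xi> in lborel. fourier (multiplier m f) \<xi> = m \<xi> * fourier f \<xi>"
    by auto
qed

lemma multiplier_bounded:
  assumes f: "f \<in> Hs s" and m: "m \<in> borel_measurable borel" "\<And>\<xi>. norm (m \<xi>) \<le> c"
  shows "multiplier m f \<in> Hs s" "sob s (multiplier m f) = mult_l2 m (sob s f)"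
proof -
  have "(\<lambda>\<xi>. m \<xi> * fourier f \<xi>) \<in> L2"
    by (rule L2_bounded_mult[OF fourier_L2[OF Hs_L2[OF f]] m])
  note spec = multiplier_spec[OF this]
  have "(\<lambda>\<xi>. of_real (wt s \<xi>) * (m \<xi> * fourier f \<xi>)) \<in> L2"
    using L2_bounded_mult[OF Hs_weighted[OF f] m] by (simp add: mult.left_commute)
  note * = Hs_I[OF spec this]
  show "multiplier m f \<in> Hs s" by (rule *)
  show "sob s (multiplier m f) = mult_l2 m (sob s f)"
    using *(2) mult_l2_cls[OF m Hs_weighted[OF f]] by (simp add: sob_def mult.left_commute)
qed

lemma deriv_x_spec:
  assumes f: "f \<in> Hs s" and s: "1 \<le> s"
  shows "deriv_x f \<in> Hs (s - 1)" "AE \<xi> in lborel. fourier (deriv_x f) \<xi> = \<i> * of_real \<xi> * fourier f \<xi>"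
    "norm (sob (s - 1) (deriv_x f)) \<le> norm (sob s f)"
proof -
  note [measurable] = L2_measurable[OF fourier_L2[OF Hs_L2[OF f]]]
  have x1: "\<bar>\<xi>\<bar> \<le> wt 1 \<xi>" for \<xi>
  proof -
    have "\<xi>\<^sup>2 \<le> (wt 1 \<xi>)\<^sup>2" unfolding wt_sq by simp
    then show ?thesis using abs_le_square_iff[of \<xi> "wt 1 \<xi>"] by simp
  qed
  have le: "norm (of_real (wt (s - 1) \<xi>) * (\<i> * of_real \<xi> * fourier f \<xi>)) \<le> 1 * norm (of_real (wt s \<xi>) * fourier f \<xi>)" for \<xi>
  proof -
    have "wt (s - 1) \<xi> * \<bar>\<xi>\<bar> \<le> wt (s - 1) \<xi> * wt 1 \<xi>" by (intro mult_left_mono x1) simp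
    also have "\<dots> = wt s \<xi>" by (simp add: wt_add[symmetric])
    finally show ?thesis
      by (simp add: norm_mult mult.assoc[symmetric] mult_right_mono)
  qed
  have w: "(\<lambda>\<xi>. of_real (wt (s - 1) \<xi>) * (\<i> * of_real \<xi> * fourier f \<xi>)) \<in> L2"
    by (rule L2_dominated[OF _ Hs_weighted[OF f], where c = 1]) (measurable, intro AE_I2 le)
  have "(\<lambda>\<xi>. \<i> * of_real \<xi> * fourier f \<xi>) \<in> L2"
  proof (rule L2_dominated[OF _ w, where c = 1])
    show "AE \<xi> in lborel. norm (\<i> * of_real \<xi> * fourier f \<xi>) \<le> 1 * norm (of_real (wt (s - 1) \<xi>) * (\<i> * of_real \<xi> * fourier f \<xi>))"
    proof (rule AE_I2)
      fix \<xi>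
      have "1 * norm (\<i> * of_real \<xi> * fourier f \<xi>) \<le> wt (s - 1) \<xi> * norm (\<i> * of_real \<xi> * fourier f \<xi>)"
        using wt_mono[of 0 "s - 1" \<xi>] s by (intro mult_right_mono) auto
      then show "norm (\<i> * of_real \<xi> * fourier f \<xi>) \<le> 1 * norm (of_real (wt (s - 1) \<xi>) * (\<i> * of_real \<xi> * fourier f \<xi>))"
        by (simp add: norm_mult)
    qed
  qed measurable
  note spec = multiplier_spec[OF this, folded deriv_x_def]
  show "AE \<xi> in lborel. fourier (deriv_x f) \<xi> = \<i> * of_real \<xi> * fourier f \<xi>" by (rule spec(2))
  note * = Hs_I[OF spec w]
  show "deriv_x f \<in> Hs (s - 1)" by (rule *)
  show "norm (sob (s - 1) (deriv_x f)) \<le> norm (sob s f)"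
    unfolding *(2) sob_def[of s]
    using norm_cls_mono[OF w Hs_weighted[OF f], of 1] le by simp
qed

lemma deriv_x_diff:
  assumes f: "f \<in> Hs s" and g: "g \<in> Hs s" and s: "1 \<le> s"
  shows "norm (sob (s - 1) (deriv_x f) - sob (s - 1) (deriv_x g)) \<le> norm (sob s f - sob s g)"
proof -
  let ?h = "\<lambda>x. f x - g x"
  have h: "?h \<in> Hs s" by (rule Hs_diff[OF f g])
  note df = deriv_x_spec[OF f s] and dg = deriv_x_spec[OF g s] and dh = deriv_x_spec[OF h s]
  have d: "(\<lambda>x. deriv_x f x - deriv_x g x) \<in> Hs (s - 1)"
    by (rule Hs_diff[OF df(1) dg(1)])
  have "AE \<xi> in lborel. fourier (deriv_x ?h) \<xi> = fourier (\<lambda>x. deriv_x f x - deriv_x g x) \<xi>"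
    using df(2) dg(2) dh(2) fourier_diff[OF Hs_L2[OF f] Hs_L2[OF g]] fourier_diff[OF Hs_L2[OF df(1)] Hs_L2[OF dg(1)]]
    by eventually_elim (simp add: right_diff_distrib)
  then have "AE x in lborel. deriv_x ?h x = deriv_x f x - deriv_x g x"
    by (rule fourier_inj[OF Hs_L2[OF dh(1)] Hs_L2[OF d]])
  then have "sob (s - 1) (deriv_x ?h) = sob (s - 1) (deriv_x f) - sob (s - 1) (deriv_x g)"
    using sob_eq_iff[OF dh(1) d] Hs_diff(2)[OF df(1) dg(1)] by simp
  then show ?thesis using dh(3) Hs_diff(2)[OF f g] by simp
qed


section \<open>Product estimates\<close>

lemma L2_Cauchy_Schwarz:
  assumes f: "f \<in> L2" and g: "g \<in> L2"
  shows "(LBINT x. norm (f x) * norm (g x)) \<le> norm (cls f) * norm (cls g)"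
proof -
  note [measurable] = L2_measurable[OF f] L2_measurable[OF g]
  let ?n = "\<lambda>f x. complex_of_real (norm (f x :: complex))"
  have n: "?n h \<in> L2" if h: "h \<in> L2" for h
  proof -
    note [measurable] = L2_measurable[OF h]
    show ?thesis
    proof (rule L2_dominated[OF _ h, where c = 1])
      show "?n h \<in> borel_measurable borel" by measurable
    qed simp
  qed
  note fg = n[OF f] n[OF g]
  have "(LBINT x. norm (f x) * norm (g x)) = cls (?n f) \<bullet> cls (?n g)"
    by (simp add: inner_cls fg inner_complex_def)
  also have "\<dots> \<le> norm (cls (?n f)) * norm (cls (?n g))" by (rule norm_cauchy_schwarz)
  also have "\<dots> = norm (cls f) * norm (cls g)" by (simp add: norm_cls fg f g)
  finally show ?thesis .
qed

lemma norm_cls_affine: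
  assumes f: "f \<in> L2" and c: "\<bar>c\<bar> = 1"
  shows "norm (cls (\<lambda>x. f (t + c * x))) = norm (cls f)"
proof -
  have c0: "c \<noteq> 0" using c by auto
  show ?thesis
    using lborel_integral_real_affine[OF c0, of "\<lambda>x. (norm (f x))\<^sup>2" t] c
    by (simp add: norm_cls f L2_affine[OF f c0])
qed

definition prod_const :: "real \<Rightarrow> real" where
  "prod_const s = 2 powr (s / 2) / sqrt (2 * pi)"

lemma prod_const_pos: "0 < prod_const s"
  by (simp add: prod_const_def)

text \<open>By Parseval's identity the transform of a product is a convolution of the transforms, up to
  a constant. Peetre's inequality distributes the weight on the two factors, and the
  Cauchy-Schwarz inequality bounds the convolution pointwise.\<close>
lemma fourier_product_bound:
  assumes f: "f \<in> Hs s" and g: "g \<in> Hs s" and s: "0 \<le> s"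
  shows "integrable lborel (\<lambda>x. f x * g x)"
    "wt s \<xi> * norm (fourier (\<lambda>x. f x * g x) \<xi>) \<le> prod_const s * (norm (sob s f) * norm (sob s g))"
proof -
  note fL = Hs_L2[OF f] and gL = Hs_L2[OF g]
  note FL = fourier_L2[OF fL] and GL = fourier_L2[OF gL]
  note [measurable] = L2_measurable[OF FL] L2_measurable[OF GL]
  show int: "integrable lborel (\<lambda>x. f x * g x)" by (rule L2_mult_integrable[OF fL gL])
  define z where "z = (LBINT x. cis (- (x * \<xi>)) * (f x * g x))"
  \<comment> \<open>Rotating the integral to the positive axis makes its modulus a real inner product.\<close>
  obtain c where c: "norm c = 1" "norm z = Re (c * z)"
  proof (cases "z = 0")
    case True
    then show thesis using that[of 1] by simp
  next
    case False
    have "cnj (sgn z) * z = of_real (norm z)"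
      using False by (simp add: sgn_eq mult.commute[of _ z] complex_norm_square[symmetric] power2_eq_square)
    then show thesis using that[of "cnj (sgn z)"] False by (simp add: norm_sgn)
  qed
  let ?u = "\<lambda>x. c * (cis (- \<xi> * x) * f x)" and ?v = "\<lambda>x. cnj (g x)"
  have mL: "(\<lambda>x. cis (- \<xi> * x) * f x) \<in> L2" by (rule L2_bounded_mult[OF fL, where c = 1]) auto
  have uL: "?u \<in> L2" by (rule L2_cmult[OF mL])
  have vL: "?v \<in> L2" by (rule L2_cnj[OF gL])
  let ?A = "\<lambda>\<eta>. fourier f (\<xi> + 1 * \<eta>)" and ?B = "\<lambda>\<eta>. fourier g (0 + -1 * \<eta>)"
  have AL: "?A \<in> L2" "?B \<in> L2" by (intro L2_affine FL GL; simp)+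
  let ?wA = "\<lambda>\<eta>. of_real (wt s (\<xi> + 1 * \<eta>)) * fourier f (\<xi> + 1 * \<eta>)"
  let ?wB = "\<lambda>\<eta>. of_real (wt s (0 + -1 * \<eta>)) * fourier g (0 + -1 * \<eta>)"
  have wL: "?wA \<in> L2" "?wB \<in> L2"
    using L2_affine[OF Hs_weighted[OF f], of 1 \<xi>] L2_affine[OF Hs_weighted[OF g], of "-1" 0] by simp_all
  have Fu: "AE \<eta> in lborel. fourier ?u \<eta> = c * ?A \<eta>"
    using fourier_cmult[OF mL, of c] fourier_modulation[OF fL, of "- \<xi>"]
    by eventually_elim (simp add: add.commute)
  have Fv: "AE \<eta> in lborel. fourier ?v \<eta> = cnj (?B \<eta>)"
    using fourier_cnj[OF gL] by eventually_elim simp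
  have "c * z = (LBINT x. ?u x * g x)"
    unfolding z_def integral_mult_right_zero[symmetric]
    by (intro Bochner_Integration.integral_cong refl) (simp add: mult_ac)
  then have "norm z = Re (LBINT x. ?u x * g x)"
    using c(2) by simp
  also have "\<dots> = (LBINT x. Re (?u x * g x))"
    by (intro integral_Re[symmetric] L2_mult_integrable uL gL)
  also have "\<dots> = cls ?u \<bullet> cls ?v"
    by (simp only: inner_cls[OF uL vL] inner_complex_eq complex_cnj_cnj)
  also have "\<dots> = cls (fourier ?u) \<bullet> cls (fourier ?v)"
    by (rule parseval[OF uL vL, symmetric])
  also have "cls (fourier ?u) = cls (\<lambda>\<eta>. c * ?A \<eta>)"
    using Fu by (simp only: cls_eq_iff fourier_L2 uL L2_cmult AL)
  also have "cls (fourier ?v) = cls (\<lambda>\<eta>. cnj (?B \<eta>))"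
    using Fv by (simp only: cls_eq_iff fourier_L2 vL L2_cnj AL)
  also have "cls (\<lambda>\<eta>. c * ?A \<eta>) \<bullet> cls (\<lambda>\<eta>. cnj (?B \<eta>)) = (LBINT \<eta>. (c * ?A \<eta>) \<bullet> cnj (?B \<eta>))"
    by (rule inner_cls[OF L2_cmult[OF AL(1)] L2_cnj[OF AL(2)]])
  finally have z: "norm z = (LBINT \<eta>. (c * ?A \<eta>) \<bullet> cnj (?B \<eta>))" .
  have "wt s \<xi> * norm z = (LBINT \<eta>. wt s \<xi> * ((c * ?A \<eta>) \<bullet> cnj (?B \<eta>)))"
    unfolding z by simp
  also have "\<dots> \<le> (LBINT \<eta>. 2 powr (s / 2) * (norm (?wA \<eta>) * norm (?wB \<eta>)))"
  proof (rule integral_mono)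
    show "integrable lborel (\<lambda>\<eta>. wt s \<xi> * ((c * ?A \<eta>) \<bullet> cnj (?B \<eta>)))"
      by (intro integrable_mult_right L2_inner_integrable L2_cmult L2_cnj AL)
    show "integrable lborel (\<lambda>\<eta>. 2 powr (s / 2) * (norm (?wA \<eta>) * norm (?wB \<eta>)))"
      using integrable_norm[OF L2_mult_integrable[OF wL]] by (simp add: norm_mult)
    fix \<eta>
    have "(c * ?A \<eta>) \<bullet> cnj (?B \<eta>) \<le> norm (c * ?A \<eta>) * norm (cnj (?B \<eta>))"
      by (rule norm_cauchy_schwarz)
    also have "\<dots> = norm (?A \<eta>) * norm (?B \<eta>)" using c(1) by (simp add: norm_mult)
    finally have "wt s \<xi> * ((c * ?A \<eta>) \<bullet> cnj (?B \<eta>)) \<le> wt s \<xi> * (norm (?A \<eta>) * norm (?B \<eta>))"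
      by (rule mult_left_mono) simp
    also have "\<dots> \<le> 2 powr (s / 2) * (wt s (\<xi> + 1 * \<eta>) * wt s (0 + -1 * \<eta>)) * (norm (?A \<eta>) * norm (?B \<eta>))"
      using wt_submultiplicative[OF s, of "\<xi> + 1 * \<eta>" "0 + -1 * \<eta>"] by (intro mult_right_mono) auto
    also have "\<dots> = 2 powr (s / 2) * (norm (?wA \<eta>) * norm (?wB \<eta>))"
      by (simp add: norm_mult mult_ac)
    finally show "wt s \<xi> * ((c * ?A \<eta>) \<bullet> cnj (?B \<eta>)) \<le> 2 powr (s / 2) * (norm (?wA \<eta>) * norm (?wB \<eta>))" .
  qed
  also have "\<dots> = 2 powr (s / 2) * (LBINT \<eta>. norm (?wA \<eta>) * norm (?wB \<eta>))"
    by simp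
  also have "\<dots> \<le> 2 powr (s / 2) * (norm (cls ?wA) * norm (cls ?wB))"
    by (intro mult_left_mono L2_Cauchy_Schwarz wL) simp
  also have "norm (cls ?wA) = norm (sob s f)"
    unfolding sob_def by (rule norm_cls_affine[OF Hs_weighted[OF f]]) simp
  also have "norm (cls ?wB) = norm (sob s g)"
    unfolding sob_def by (rule norm_cls_affine[OF Hs_weighted[OF g]]) simp
  finally have "wt s \<xi> * norm z / sqrt (2 * pi) \<le> 2 powr (s / 2) * (norm (sob s f) * norm (sob s g)) / sqrt (2 * pi)"
    by (rule divide_right_mono) simp
  moreover have "fourier (\<lambda>x. f x * g x) \<xi> = of_real (1 / sqrt (2 * pi)) * z"
    using int by (simp add: fourier_def fourier_integral_cis z_def)
  ultimately show "wt s \<xi> * norm (fourier (\<lambda>x. f x * g x) \<xi>) \<le> prod_const s * (norm (sob s f) * norm (sob s g))"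
    by (simp add: norm_mult norm_divide prod_const_def)
qed

definition wt_const :: real where
  "wt_const = norm (cls (\<lambda>\<xi>. complex_of_real (wt (-1) \<xi>)))"

lemma wt_const_nonneg: "0 \<le> wt_const"
  by (simp add: wt_const_def)

lemma L2_weight_bound:
  assumes g: "g \<in> borel_measurable borel" and b: "\<And>\<xi>. norm (g \<xi>) \<le> B * wt (-1) \<xi>"
  shows "g \<in> L2" "norm (cls g) \<le> B * wt_const"
proof -
  have B: "0 \<le> B" using b[of 0] norm_ge_zero[of "g 0"] wt_pos[of "-1" 0]
    by (meson order_trans zero_le_mult_iff not_le)
  have le: "AE \<xi> in lborel. norm (g \<xi>) \<le> B * norm (complex_of_real (wt (-1) \<xi>))"
    using b by simp
  show gL: "g \<in> L2" by (rule L2_dominated[OF g wt_minus1_L2 le])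
  show "norm (cls g) \<le> B * wt_const"
    unfolding wt_const_def by (rule norm_cls_mono[OF gL wt_minus1_L2 B le])
qed

lemma fourier_measurable: "integrable lborel p \<Longrightarrow> fourier p \<in> borel_measurable borel"
  by (simp add: fourier_def fourier_integral_measurable borel_measurable_integrable)

text \<open>A function in \<open>H\<^sup>s\<close> with \<open>s \<ge> 1\<close> has an integrable transform, hence is bounded by inversion.\<close>
lemma Hs_bounded:
  assumes f: "f \<in> Hs s" and s: "1 \<le> s"
  obtains M where "AE x in lborel. norm (f x) \<le> M"
proof -
  note F1 = Hs_weighted[OF Hs_mono(1)[OF f s]] and FL = fourier_L2[OF Hs_L2[OF f]]
  have "integrable lborel (\<lambda>\<xi>. of_real (wt (-1) \<xi>) * (of_real (wt 1 \<xi>) * fourier f \<xi>))"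
    by (rule L2_mult_integrable[OF wt_minus1_L2 F1])
  moreover have "of_real (wt (-1) \<xi>) * (of_real (wt 1 \<xi>) * fourier f \<xi>) = fourier f \<xi>" for \<xi>
    using wt_add[of "-1" 1 \<xi>] by (simp flip: mult.assoc of_real_mult)
  ultimately have int: "integrable lborel (\<lambda>\<xi>. cnj (fourier f \<xi>))"
    by (simp add: integrable_cnj)
  have "AE x in lborel. norm (f x) \<le> (1 / sqrt (2 * pi)) * (LBINT x. norm (cnj (fourier f x)))"
    using adjoint_of_fourier[OF Hs_L2[OF f]]
  proof eventually_elim
    case (elim x)
    show ?case
      unfolding elim complex_mod_cnj[of "fourier _ _"]
      using fourier_integral_bound[OF int, of x] int by (simp add: fourier_def[of "\<lambda>\<xi>. cnj (fourier f \<xi>)"])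
  qed
  then show thesis by (rule that)
qed

text \<open>One derivative is lost, since the pointwise bound on the weighted transform is made square-integrable by
  the weight of order \<open>-1\<close>. This is enough for the cube, as \<open>\<psi>\<close> gains three derivatives.\<close>
lemma Hs_product:
  assumes f: "f \<in> Hs s" and g: "g \<in> Hs s" and s: "1 \<le> s"
  shows "(\<lambda>x. f x * g x) \<in> Hs (s - 1)"
    "norm (sob (s - 1) (\<lambda>x. f x * g x)) \<le> prod_const s * wt_const * (norm (sob s f) * norm (sob s g))"
proof -
  let ?p = "\<lambda>x. f x * g x" and ?B = "prod_const s * (norm (sob s f) * norm (sob s g))"
  note [measurable] = L2_measurable[OF Hs_L2[OF f]] L2_measurable[OF Hs_L2[OF g]]
  have s0: "0 \<le> s" using s by simp
  note prod = fourier_product_bound[OF f g s0]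
  note [measurable] = fourier_measurable[OF prod(1)]
  obtain M where M: "AE x in lborel. norm (f x) \<le> M" using Hs_bounded[OF f s] by blast
  have pL: "?p \<in> L2"
  proof (rule L2_dominated[OF _ Hs_L2[OF g]])
    show "AE x in lborel. norm (f x * g x) \<le> M * norm (g x)"
      using M by eventually_elim (simp add: norm_mult mult_right_mono)
  qed measurable
  have "norm (of_real (wt (s - 1) \<xi>) * fourier ?p \<xi>) \<le> ?B * wt (-1) \<xi>" for \<xi>
  proof -
    have "norm (of_real (wt (s - 1) \<xi>) * fourier ?p \<xi>) = wt s \<xi> * norm (fourier ?p \<xi>) * wt (-1) \<xi>"
      using wt_add[of s "-1" \<xi>] by (simp add: norm_mult)
    also have "\<dots> \<le> ?B * wt (-1) \<xi>" by (intro mult_right_mono prod) simp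
    finally show ?thesis .
  qed
  note * = L2_weight_bound[OF _ this]
  show "?p \<in> Hs (s - 1)" using pL *(1) by (simp add: Hs_iff)
  show "norm (sob (s - 1) ?p) \<le> prod_const s * wt_const * (norm (sob s f) * norm (sob s g))"
    unfolding sob_def[of "s - 1"] using *(2) by (simp add: mult_ac)
qed


text \<open>The decay of the symbol supplies the square-integrable weight of order \<open>-1\<close> that the bound on the
  transform lacks. Here \<open>p\<close> is only integrable, as the square of a derivative may be.\<close>
lemma multiplier_smoothing:
  assumes p: "integrable lborel p" and m: "m \<in> borel_measurable borel" and s: "0 \<le> s"
    and decay: "\<And>\<xi>. norm (m \<xi>) * wt s \<xi> \<le> c * (wt (-1) \<xi> * wt r \<xi>)" "0 \<le> c"
    and bound: "\<And>\<xi>. wt r \<xi> * norm (fourier p \<xi>) \<le> B"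
  shows "multiplier m p \<in> Hs s"
    "AE \<xi> in lborel. fourier (multiplier m p) \<xi> = m \<xi> * fourier p \<xi>"
    "(\<lambda>\<xi>. of_real (wt s \<xi>) * (m \<xi> * fourier p \<xi>)) \<in> L2"
    "sob s (multiplier m p) = cls (\<lambda>\<xi>. of_real (wt s \<xi>) * (m \<xi> * fourier p \<xi>))"
    "norm (sob s (multiplier m p)) \<le> c * B * wt_const"
proof -
  note [measurable] = m fourier_measurable[OF p]
  have le: "norm (of_real (wt s \<xi>) * (m \<xi> * fourier p \<xi>)) \<le> c * B * wt (-1) \<xi>" for \<xi>
  proof -
    have "norm (of_real (wt s \<xi>) * (m \<xi> * fourier p \<xi>)) = (norm (m \<xi>) * wt s \<xi>) * norm (fourier p \<xi>)"
      by (simp add: norm_mult)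
    also have "\<dots> \<le> (c * (wt (-1) \<xi> * wt r \<xi>)) * norm (fourier p \<xi>)"
      by (intro mult_right_mono decay) simp
    also have "\<dots> = c * wt (-1) \<xi> * (wt r \<xi> * norm (fourier p \<xi>))" by simp
    also have "\<dots> \<le> c * wt (-1) \<xi> * B"
      by (intro mult_left_mono bound mult_nonneg_nonneg decay) simp
    finally show ?thesis by (simp add: mult_ac)
  qed
  have meas: "(\<lambda>\<xi>. of_real (wt s \<xi>) * (m \<xi> * fourier p \<xi>)) \<in> borel_measurable borel"
    by measurable
  note w = L2_weight_bound[OF meas le]
  then show "(\<lambda>\<xi>. of_real (wt s \<xi>) * (m \<xi> * fourier p \<xi>)) \<in> L2" by simp
  have "(\<lambda>\<xi>. m \<xi> * fourier p \<xi>) \<in> L2"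
  proof (rule L2_dominated[OF _ w(1), where c = 1])
    show "AE \<xi> in lborel. norm (m \<xi> * fourier p \<xi>) \<le> 1 * norm (of_real (wt s \<xi>) * (m \<xi> * fourier p \<xi>))"
    proof (rule AE_I2)
      fix \<xi>
      have "1 * norm (m \<xi> * fourier p \<xi>) \<le> wt s \<xi> * norm (m \<xi> * fourier p \<xi>)"
        using wt_mono[OF s, of \<xi>] by (intro mult_right_mono) auto
      then show "norm (m \<xi> * fourier p \<xi>) \<le> 1 * norm (of_real (wt s \<xi>) * (m \<xi> * fourier p \<xi>))"
        by (simp add: norm_mult)
    qed
  qed measurable
  note spec = multiplier_spec[OF this]
  show "AE \<xi> in lborel. fourier (multiplier m p) \<xi> = m \<xi> * fourier p \<xi>" by (rule spec(2))
  note * = Hs_I[OF spec w(1)]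
  show "multiplier m p \<in> Hs s" by (rule *)
  show "sob s (multiplier m p) = cls (\<lambda>\<xi>. of_real (wt s \<xi>) * (m \<xi> * fourier p \<xi>))" by (rule *(2))
  with w(2) show "norm (sob s (multiplier m p)) \<le> c * B * wt_const" by simp
qed

lemma multiplier_smoothing_diff:
  assumes p: "integrable lborel p" and q: "integrable lborel q" and m: "m \<in> borel_measurable borel" and s: "0 \<le> s"
    and decay: "\<And>\<xi>. norm (m \<xi>) * wt s \<xi> \<le> c * (wt (-1) \<xi> * wt r \<xi>)" "0 \<le> c"
    and bound: "\<And>\<xi>. wt r \<xi> * norm (fourier p \<xi>) \<le> Bp" "\<And>\<xi>. wt r \<xi> * norm (fourier q \<xi>) \<le> Bq"
      "\<And>\<xi>. wt r \<xi> * norm (fourier d \<xi>) \<le> B"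
    and d: "\<And>x. d x = p x - q x"
  shows "norm (sob s (multiplier m p) - sob s (multiplier m q)) \<le> c * B * wt_const"
proof -
  have d': "d = (\<lambda>x. p x - q x)" using d by (rule ext)
  have dint: "integrable lborel d" unfolding d' using p q by simp
  have Fd: "fourier d \<xi> = fourier p \<xi> - fourier q \<xi>" for \<xi>
    using dint p q fourier_integral_diff[OF p q, of \<xi>] by (simp add: fourier_def d')
  note P = multiplier_smoothing[OF p m s decay bound(1)]
    and Q = multiplier_smoothing[OF q m s decay bound(2)]
    and D = multiplier_smoothing[OF dint m s decay bound(3)]
  have "sob s (multiplier m p) - sob s (multiplier m q) = sob s (multiplier m d)"
    unfolding P(4) Q(4) D(4) Fd
    by (simp add: cls_diff[OF P(3) Q(3), symmetric] right_diff_distrib)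
  with D(5) show ?thesis by simp
qed


section \<open>Real-valued functions on the Fourier side\<close>

text \<open>Complex conjugation, seen on the Fourier side: the classes of transforms of real-valued functions
  are its fixed points.\<close>
definition real_sym :: "l2 \<Rightarrow> l2" where
  "real_sym V = cls (\<lambda>\<xi>. cnj (rep_l2 V (- \<xi>)))"

lemma AE_reflect:
  fixes f g :: "real \<Rightarrow> complex"
  assumes [measurable]: "f \<in> borel_measurable borel" "g \<in> borel_measurable borel"
    and "AE x in lborel. f x = g x"
  shows "AE x in lborel. f (- x) = g (- x)"
  using AE_borel_affine[of "-1" "\<lambda>x. f x = g x" 0] assms(3) by simp

lemma L2_reflect: "f \<in> L2 \<Longrightarrow> (\<lambda>x. f (- x)) \<in> L2"
  using L2_affine[of f "-1" 0] by simp

lemma real_sym_cls: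
  assumes f: "f \<in> L2"
  shows "real_sym (cls f) = cls (\<lambda>\<xi>. cnj (f (- \<xi>)))"
  unfolding real_sym_def
proof (subst cls_eq_iff)
  show "AE \<xi> in lborel. cnj (rep_l2 (cls f) (- \<xi>)) = cnj (f (- \<xi>))"
    using AE_reflect[OF L2_measurable[OF rep_l2_L2] L2_measurable[OF f] rep_l2_cls[OF f]]
    by eventually_elim simp
qed (intro L2_cnj L2_reflect rep_l2_L2 f)+

lemma bounded_linear_real_sym: "bounded_linear real_sym"
proof (rule bounded_linear_intro[where K = 1])
  fix V W :: l2 and r :: real
  obtain f where f: "f \<in> L2" "V = cls f" by (rule l2_cases)
  obtain g where g: "g \<in> L2" "W = cls g" by (rule l2_cases)
  have L: "(\<lambda>\<xi>. cnj (f (- \<xi>))) \<in> L2" "(\<lambda>\<xi>. cnj (g (- \<xi>))) \<in> L2"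
    by (intro L2_cnj L2_reflect f g)+
  show "real_sym (V + W) = real_sym V + real_sym W"
    using f g L by (simp add: cls_add[symmetric] real_sym_cls L2_add)
  show "real_sym (r *\<^sub>R V) = r *\<^sub>R real_sym V"
    using f L by (simp add: cls_scaleR[symmetric] real_sym_cls L2_cmult)
  have "norm (real_sym V) = norm V"
    using norm_cls_affine[OF f(1), of "-1" 0] f L L2_reflect[OF f(1)]
    by (simp add: real_sym_cls norm_cls)
  then show "norm (real_sym V) \<le> norm V * 1" by simp
qed

lemma real_sym_mult_l2:
  assumes m: "m \<in> borel_measurable borel" "\<And>\<xi>. norm (m \<xi>) \<le> c" and sym: "\<And>\<xi>. cnj (m (- \<xi>)) = m \<xi>"
  shows "real_sym (mult_l2 m V) = mult_l2 m (real_sym V)"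
proof -
  obtain f where f: "f \<in> L2" "V = cls f" by (rule l2_cases)
  show ?thesis
    using f L2_cnj[OF L2_reflect[OF f(1)]]
    by (simp add: mult_l2_cls[OF m] real_sym_cls L2_bounded_mult[OF _ m] sym)
qed

lemma sob_cnj:
  assumes f: "f \<in> Hs s"
  shows "(\<lambda>x. cnj (f x)) \<in> Hs s" "sob s (\<lambda>x. cnj (f x)) = real_sym (sob s f)"
proof -
  have "(\<lambda>\<xi>. of_real (wt s \<xi>) * cnj (fourier f (- \<xi>))) \<in> L2"
    using L2_cnj[OF L2_reflect[OF Hs_weighted[OF f]]] by simp
  note * = Hs_I[OF L2_cnj[OF Hs_L2[OF f]] fourier_cnj[OF Hs_L2[OF f]] this]
  show "(\<lambda>x. cnj (f x)) \<in> Hs s" by (rule *)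
  show "sob s (\<lambda>x. cnj (f x)) = real_sym (sob s f)"
    using *(2) real_sym_cls[OF Hs_weighted[OF f]] by (simp add: sob_def)
qed

lemma real_sym_sob_iff:
  assumes f: "f \<in> Hs s"
  shows "real_sym (sob s f) = sob s f \<longleftrightarrow> (AE x in lborel. cnj (f x) = f x)"
  using sob_eq_iff[OF sob_cnj(1)[OF f] f] sob_cnj(2)[OF f] by simp

lemma real_sob_surj:
  assumes s: "0 \<le> s" and V: "real_sym V = V"
  obtains \<eta> :: "real \<Rightarrow> real" where "(\<lambda>x. complex_of_real (\<eta> x)) \<in> Hs s" "sob s (\<lambda>x. complex_of_real (\<eta> x)) = V"
proof -
  obtain f where f: "f \<in> Hs s" "sob s f = V" by (rule sob_surj[OF s])
  note [measurable] = L2_measurable[OF Hs_L2[OF f(1)]]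
  have "AE x in lborel. cnj (f x) = f x" using real_sym_sob_iff[OF f(1)] f V by simp
  then have eq: "AE x in lborel. f x = complex_of_real (Re (f x))"
    by eventually_elim (metis Reals_cnj_iff of_real_Re)
  have h: "(\<lambda>x. complex_of_real (Re (f x))) \<in> Hs s"
    by (rule Hs_cong_AE[OF f(1) _ eq]) measurable
  with that[OF h] show thesis using sob_eq_iff[OF f(1) h] eq f(2) by simp
qed

text \<open>An identity at every \<open>\<xi>\<close>, because the transform of an integrable function is given by the integral.\<close>
lemma fourier_of_real_valued:
  assumes p: "integrable lborel p" and re: "AE x in lborel. cnj (p x) = p x"
  shows "cnj (fourier p (- \<xi>)) = fourier p \<xi>"
proof -
  have [measurable]: "p \<in> borel_measurable borel" using borel_measurable_integrable[OF p] by simp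
  have "fourier_integral (\<lambda>x. cnj (p x)) = fourier_integral p"
    by (rule fourier_integral_cong_AE[OF _ _ re]) measurable
  then show ?thesis using p fourier_integral_cnj[of p \<xi>] by (simp add: fourier_def)
qed

text \<open>Reflection combined with conjugation preserves the transform of a real-valued function and changes the
  sign of an odd real symbol.\<close>
lemma multiplier_odd_imaginary:
  assumes p: "integrable lborel p" "AE x in lborel. cnj (p x) = p x"
    and M: "multiplier m p \<in> L2" "AE \<xi> in lborel. fourier (multiplier m p) \<xi> = m \<xi> * fourier p \<xi>"
    and m: "m \<in> borel_measurable borel" "\<And>\<xi>. cnj (m (- \<xi>)) = - m \<xi>"
  shows "AE x in lborel. cnj (multiplier m p x) = - multiplier m p x"
proof (rule fourier_inj)
  note [measurable] = L2_measurable[OF fourier_L2[OF M(1)]] fourier_measurable[OF p(1)] m(1)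
  have "AE \<xi> in lborel. fourier (multiplier m p) (- \<xi>) = m (- \<xi>) * fourier p (- \<xi>)"
    by (rule AE_reflect[OF _ _ M(2)]) measurable
  then show "AE \<xi> in lborel. fourier (\<lambda>x. cnj (multiplier m p x)) \<xi> = fourier (\<lambda>x. - multiplier m p x) \<xi>"
    using M(2) fourier_cnj[OF M(1)] fourier_cmult[OF M(1), of "-1"]
  proof eventually_elim
    case (elim \<xi>)
    then show ?case using fourier_of_real_valued[OF p, of \<xi>] m(2)[of \<xi>] by simp
  qed
qed (intro L2_cnj L2_minus M)+

text \<open>The symbol \<open>\<i> \<xi>\<close> is invariant under reflection combined with conjugation.\<close>
lemma deriv_x_real:
  assumes f: "f \<in> Hs s" and s: "1 \<le> s" and re: "AE x in lborel. cnj (f x) = f x"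
  shows "AE x in lborel. cnj (deriv_x f x) = deriv_x f x"
proof (rule fourier_inj)
  note d = deriv_x_spec[OF f s]
  note fL = Hs_L2[OF f] and dL = Hs_L2[OF d(1)]
  note [measurable] = L2_measurable[OF fourier_L2[OF dL]] L2_measurable[OF fourier_L2[OF fL]]
  have "AE \<xi> in lborel. fourier (deriv_x f) (- \<xi>) = \<i> * of_real (- \<xi>) * fourier f (- \<xi>)"
    by (rule AE_reflect[OF _ _ d(2)]) measurable
  moreover have "AE \<xi> in lborel. fourier (\<lambda>x. cnj (f x)) \<xi> = fourier f \<xi>"
    using fourier_cong_AE[OF L2_cnj[OF fL] fL re] by (simp add: cls_eq_iff fourier_L2 L2_cnj fL)
  ultimately show "AE \<xi> in lborel. fourier (\<lambda>x. cnj (deriv_x f x)) \<xi> = fourier (deriv_x f) \<xi>"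
    using d(2) fourier_cnj[OF fL] fourier_cnj[OF dL]
    by eventually_elim simp
qed (intro L2_cnj Hs_L2[OF deriv_x_spec(1)[OF f s]])+


section \<open>The equation in the space of classes\<close>

locale wave_equation =
  fixes \<gamma>\<^sub>1 \<gamma>\<^sub>2 \<delta>\<^sub>1 \<delta>\<^sub>2 \<gamma> s :: real
  assumes \<gamma>\<^sub>1: "0 < \<gamma>\<^sub>1" and \<delta>\<^sub>1: "0 < \<delta>\<^sub>1" and s: "1 \<le> s"
begin

abbreviation "D \<equiv> denom \<gamma>\<^sub>1 \<delta>\<^sub>1"
abbreviation "\<phi> \<equiv> phi_symbol \<gamma>\<^sub>1 \<gamma>\<^sub>2 \<delta>\<^sub>1 \<delta>\<^sub>2"
abbreviation "\<psi> \<equiv> psi_symbol \<gamma>\<^sub>1 \<delta>\<^sub>1"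
abbreviation "\<tau> \<equiv> tau_symbol \<gamma>\<^sub>1 \<delta>\<^sub>1 \<gamma>"
abbreviation "S \<equiv> evolution \<gamma>\<^sub>1 \<gamma>\<^sub>2 \<delta>\<^sub>1 \<delta>\<^sub>2"
abbreviation "NL \<equiv> nonlinearity \<gamma>\<^sub>1 \<delta>\<^sub>1 \<gamma>"

lemma symbols_measurable [measurable]:
  "\<phi> \<in> borel_measurable borel" "\<psi> \<in> borel_measurable borel" "\<tau> \<in> borel_measurable borel"
  unfolding phi_symbol_def[abs_def] psi_symbol_def[abs_def] tau_symbol_def[abs_def] denom_def[abs_def]
  by measurable

lemma symbols_odd: "\<phi> (- \<xi>) = - \<phi> \<xi>" "\<psi> (- \<xi>) = - \<psi> \<xi>" "\<tau> (- \<xi>) = - \<tau> \<xi>"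
proof -
  have D: "D (- \<xi>) = D \<xi>" by (simp add: denom_def)
  then show "\<phi> (- \<xi>) = - \<phi> \<xi>" "\<psi> (- \<xi>) = - \<psi> \<xi>"
    by (simp_all add: phi_symbol_def psi_symbol_def)
  have "3 * - \<xi> - 4 * \<gamma> * (- \<xi>)^3 = - (3 * \<xi> - 4 * \<gamma> * \<xi>^3)" by simp
  then show "\<tau> (- \<xi>) = - \<tau> \<xi>"
    unfolding tau_symbol_def D by (simp only: minus_divide_left)
qed

lemma denom_lower: "min 1 \<delta>\<^sub>1 * (1 + \<bar>\<xi>\<bar> ^ 4) \<le> D \<xi>" "0 < D \<xi>"
proof -
  have "min 1 \<delta>\<^sub>1 * (1 + \<bar>\<xi>\<bar> ^ 4) \<le> 1 * 1 + \<delta>\<^sub>1 * \<bar>\<xi>\<bar> ^ 4"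
    unfolding distrib_left by (intro add_mono mult_right_mono) auto
  also have "\<dots> \<le> D \<xi>" using \<gamma>\<^sub>1 by (simp add: denom_def)
  finally show "min 1 \<delta>\<^sub>1 * (1 + \<bar>\<xi>\<bar> ^ 4) \<le> D \<xi>" .
  moreover have "0 < min 1 \<delta>\<^sub>1 * (1 + \<bar>\<xi>\<bar> ^ 4)"
    using \<delta>\<^sub>1 by (intro mult_pos_pos add_pos_nonneg) auto
  ultimately show "0 < D \<xi>" by linarith
qed

lemma power_le_1_plus_power4:
  fixes x :: real assumes "0 \<le> x" "k \<le> 4" shows "x ^ k \<le> 1 + x ^ 4"
proof (cases "x \<le> 1")
  case True
  then have "x ^ k \<le> 1" using assms by (simp add: power_le_one)
  then show ?thesis using zero_le_power[OF assms(1), of 4] by linarith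
next
  case False
  then have "x ^ k \<le> x ^ 4" using assms by (intro power_increasing) auto
  then show ?thesis by simp
qed

text \<open>The symbols are bounded by \<open>c\<tau> (1 + \<xi>\<^sup>2)\<^sup>-\<^sup>1\<^sup>/\<^sup>2\<close> and by \<open>c\<psi> (1 + \<xi>\<^sup>2)\<^sup>-\<^sup>1\<close>. The decay of \<open>\<psi>\<close> is in fact of order \<open>-3\<close>; order
  \<open>-2\<close> is what the product estimate at level \<open>s - 1\<close> consumes.\<close>
definition c\<tau> :: real where "c\<tau> = 4 * (1 + \<bar>\<gamma>\<bar>) / min 1 \<delta>\<^sub>1"
definition c\<psi> :: real where "c\<psi> = 2 / min 1 \<delta>\<^sub>1"

lemma c\<tau>: "norm (complex_of_real (\<tau> \<xi>)) * wt s \<xi> \<le> c\<tau> * (wt (-1) \<xi> * wt s \<xi>)" "0 \<le> c\<tau>"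
proof -
  let ?m = "min 1 \<delta>\<^sub>1" and ?x = "\<bar>\<xi>\<bar>"
  show c0: "0 \<le> c\<tau>" unfolding c\<tau>_def using \<delta>\<^sub>1 by simp
  have wt1: "wt 1 \<xi> \<le> 1 + ?x"
    by (rule power2_le_imp_le) (auto simp: wt_sq power2_sum)
  have num: "\<bar>3 * \<xi> - 4 * \<gamma> * \<xi>^3\<bar> \<le> 4 * (1 + \<bar>\<gamma>\<bar>) * (?x + ?x ^ 3)"
  proof -
    have "\<bar>3 * \<xi> - 4 * \<gamma> * \<xi>^3\<bar> \<le> 3 * ?x + 4 * \<bar>\<gamma>\<bar> * ?x ^ 3"
      using abs_triangle_ineq4[of "3 * \<xi>" "4 * \<gamma> * \<xi>^3"] by (simp add: abs_mult power_abs)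
    also have "\<dots> \<le> 4 * (1 + \<bar>\<gamma>\<bar>) * (?x + ?x ^ 3)"
      by (simp add: algebra_simps)
    finally show ?thesis .
  qed
  have "\<bar>3 * \<xi> - 4 * \<gamma> * \<xi>^3\<bar> * wt 1 \<xi> \<le> (4 * (1 + \<bar>\<gamma>\<bar>) * (?x + ?x ^ 3)) * (1 + ?x)"
    by (intro mult_mono num wt1) auto
  also have "\<dots> = 4 * (1 + \<bar>\<gamma>\<bar>) * (?x ^ 1 + ?x ^ 2 + ?x ^ 3 + ?x ^ 4)"
  proof -
    have "(y + y ^ 3) * (1 + y) = y ^ 1 + y ^ 2 + y ^ 3 + y ^ 4" for y :: real
      by (simp add: algebra_simps power2_eq_square power3_eq_cube power4_eq_xxxx)
    then show ?thesis by (simp only: mult.assoc)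
  qed
  also have "\<dots> \<le> 4 * (1 + \<bar>\<gamma>\<bar>) * (4 * (1 + ?x ^ 4))"
    using power_le_1_plus_power4[of ?x 1] power_le_1_plus_power4[of ?x 2] power_le_1_plus_power4[of ?x 3]
    by (intro mult_left_mono) auto
  also have "\<dots> = c\<tau> * (4 * (?m * (1 + ?x ^ 4)))"
    unfolding c\<tau>_def using \<delta>\<^sub>1 by (simp add: field_simps)
  also have "\<dots> \<le> c\<tau> * (4 * D \<xi>)"
    using denom_lower(1)[of \<xi>] c0 by (intro mult_left_mono) auto
  finally have "\<bar>\<tau> \<xi>\<bar> * wt 1 \<xi> \<le> c\<tau>"
    using denom_lower(2)[of \<xi>] by (simp add: tau_symbol_def abs_mult pos_divide_le_eq)
  then have "\<bar>\<tau> \<xi>\<bar> * wt 1 \<xi> * (wt (-1) \<xi> * wt s \<xi>) \<le> c\<tau> * (wt (-1) \<xi> * wt s \<xi>)"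
    by (intro mult_right_mono) auto
  moreover have "wt 1 \<xi> * (wt (-1) \<xi> * wt s \<xi>) = wt s \<xi>"
    using wt_add[of 1 "-1" \<xi>] by (simp flip: mult.assoc)
  ultimately show "norm (complex_of_real (\<tau> \<xi>)) * wt s \<xi> \<le> c\<tau> * (wt (-1) \<xi> * wt s \<xi>)"
    by (simp add: mult.assoc)
qed

lemma c\<psi>: "norm (complex_of_real (\<psi> \<xi>)) * wt s \<xi> \<le> c\<psi> * (wt (-1) \<xi> * wt (s - 1) \<xi>)" "0 \<le> c\<psi>"
proof -
  let ?m = "min 1 \<delta>\<^sub>1" and ?x = "\<bar>\<xi>\<bar>"
  show c0: "0 \<le> c\<psi>" unfolding c\<psi>_def using \<delta>\<^sub>1 by simp
  have "?x * wt 2 \<xi> = ?x ^ 1 + ?x ^ 3"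
    by (simp add: wt_2 algebra_simps power2_eq_square power3_eq_cube)
  also have "\<dots> \<le> 2 * (1 + ?x ^ 4)"
    using power_le_1_plus_power4[of ?x 1] power_le_1_plus_power4[of ?x 3] by simp
  also have "\<dots> = c\<psi> * (?m * (1 + ?x ^ 4))"
    unfolding c\<psi>_def using \<delta>\<^sub>1 by (simp add: field_simps)
  also have "\<dots> \<le> c\<psi> * D \<xi>"
    using denom_lower(1)[of \<xi>] c0 by (intro mult_left_mono) auto
  finally have "\<bar>\<psi> \<xi>\<bar> * wt 2 \<xi> \<le> c\<psi>"
    using denom_lower(2)[of \<xi>] by (simp add: psi_symbol_def abs_mult pos_divide_le_eq)
  then have "\<bar>\<psi> \<xi>\<bar> * wt 2 \<xi> * (wt (-1) \<xi> * wt (s - 1) \<xi>) \<le> c\<psi> * (wt (-1) \<xi> * wt (s - 1) \<xi>)"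
    by (intro mult_right_mono) auto
  moreover have "wt 2 \<xi> * (wt (-1) \<xi> * wt (s - 1) \<xi>) = wt s \<xi>"
    by (simp add: wt_add[symmetric])
  ultimately show "norm (complex_of_real (\<psi> \<xi>)) * wt s \<xi> \<le> c\<psi> * (wt (-1) \<xi> * wt (s - 1) \<xi>)"
    by (simp add: mult.assoc)
qed

abbreviation "M\<tau> \<equiv> multiplier (\<lambda>\<xi>. complex_of_real (\<tau> \<xi>))"
abbreviation "M\<psi> \<equiv> multiplier (\<lambda>\<xi>. complex_of_real (\<psi> \<xi>))"

lemma s0: "0 \<le> s" "0 \<le> s - 1" "s - 1 \<le> s"
  using s by auto

lemma symbols_measurable_complex:
  "(\<lambda>\<xi>. complex_of_real (\<tau> \<xi>)) \<in> borel_measurable borel"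
  "(\<lambda>\<xi>. complex_of_real (\<psi> \<xi>)) \<in> borel_measurable borel"
  by measurable

lemma cube_factors:
  assumes f: "f \<in> Hs s"
  shows "f \<in> Hs (s - 1)" "(\<lambda>x. (f x)\<^sup>2) \<in> Hs (s - 1)" "(\<lambda>x. (f x)^3) = (\<lambda>x. f x * (f x)\<^sup>2)"
  using Hs_mono(1)[OF f s0(3)] Hs_product(1)[OF f f s] by (simp_all add: power2_eq_square power3_eq_cube mult.assoc)

lemma square_bound:
  assumes f: "f \<in> Hs s"
  shows "integrable lborel (\<lambda>x. (f x)\<^sup>2)"
    "wt s \<xi> * norm (fourier (\<lambda>x. (f x)\<^sup>2) \<xi>) \<le> prod_const s * (norm (sob s f) * norm (sob s f))"
  using fourier_product_bound[OF f f s0(1)] by (simp_all add: power2_eq_square)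

lemma cube_bound:
  assumes f: "f \<in> Hs s"
  shows "integrable lborel (\<lambda>x. (f x)^3)"
    "wt (s - 1) \<xi> * norm (fourier (\<lambda>x. (f x)^3) \<xi>) \<le> prod_const (s - 1) * (norm (sob (s - 1) f) * norm (sob (s - 1) (\<lambda>x. (f x)\<^sup>2)))"
  using fourier_product_bound[OF cube_factors(1,2)[OF f] s0(2)] unfolding cube_factors(3)[OF f] by simp_all

lemma deriv_square_bound:
  assumes f: "f \<in> Hs s"
  shows "integrable lborel (\<lambda>x. (deriv_x f x)\<^sup>2)"
    "wt (s - 1) \<xi> * norm (fourier (\<lambda>x. (deriv_x f x)\<^sup>2) \<xi>)
      \<le> prod_const (s - 1) * (norm (sob (s - 1) (deriv_x f)) * norm (sob (s - 1) (deriv_x f)))"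
  using fourier_product_bound[OF deriv_x_spec(1)[OF f s] deriv_x_spec(1)[OF f s] s0(2)]
  by (simp_all add: power2_eq_square)

lemmas M\<tau>_square = multiplier_smoothing[OF square_bound(1) symbols_measurable_complex(1) s0(1) c\<tau> square_bound(2)]
lemmas M\<psi>_cube = multiplier_smoothing[OF cube_bound(1) symbols_measurable_complex(2) s0(1) c\<psi> cube_bound(2)]
lemmas M\<psi>_deriv = multiplier_smoothing[OF deriv_square_bound(1) symbols_measurable_complex(2) s0(1) c\<psi> deriv_square_bound(2)]

lemma NL_Hs:
  assumes f: "f \<in> Hs s"
  shows "NL f \<in> Hs s"
    "sob s (NL f) = sob s (M\<tau> (\<lambda>x. (f x)\<^sup>2)) - (1/8) *\<^sub>R sob s (M\<psi> (\<lambda>x. (f x)^3)) - (7/48) *\<^sub>R sob s (M\<psi> (\<lambda>x. (deriv_x f x)\<^sup>2))"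
proof -
  note M = M\<tau>_square(1)[OF f f] M\<psi>_cube(1)[OF f f] M\<psi>_deriv(1)[OF f f]
  have eq: "NL f = (\<lambda>x. M\<tau> (\<lambda>x. (f x)\<^sup>2) x - of_real (1/8) * M\<psi> (\<lambda>x. (f x)^3) x - of_real (7/48) * M\<psi> (\<lambda>x. (deriv_x f x)\<^sup>2) x)"
    by (simp add: nonlinearity_def)
  show "NL f \<in> Hs s"
    unfolding eq by (intro Hs_diff(1) Hs_cmult(1) M)
  show "sob s (NL f) = sob s (M\<tau> (\<lambda>x. (f x)\<^sup>2)) - (1/8) *\<^sub>R sob s (M\<psi> (\<lambda>x. (f x)^3)) - (7/48) *\<^sub>R sob s (M\<psi> (\<lambda>x. (deriv_x f x)\<^sup>2))"
    unfolding eq by (simp only: Hs_diff Hs_cmult(1) Hs_scaleR M)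
qed

text \<open>The three terms come from the square, the cube and the square of the derivative; the coefficients
  \<open>1/8\<close> and \<open>7/48\<close> are estimated by 1. The final 1 keeps the constant positive.\<close>
definition lip_const :: real where
  "lip_const = 2 * (c\<tau> * prod_const s * wt_const) + 3 * (c\<psi> * prod_const (s - 1) * (prod_const s * wt_const) * wt_const)
     + 2 * (c\<psi> * prod_const (s - 1) * wt_const) + 1"

lemma lip_const_pos: "0 < lip_const"
  using c\<tau>(2) c\<psi>(2) prod_const_pos[of s] prod_const_pos[of "s - 1"] wt_const_nonneg
  unfolding lip_const_def by (intro add_nonneg_pos add_nonneg_nonneg mult_nonneg_nonneg) (auto simp: less_imp_le)

text \<open>Differences factor: \<open>f\<^sup>2 - g\<^sup>2 = (f - g) (f + g)\<close>, likewise for the derivatives, and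
  \<open>f\<^sup>3 - g\<^sup>3 = (f - g) (f\<^sup>2 + f g + g\<^sup>2)\<close>, where the second factor is estimated at level \<open>s - 1\<close>.\<close>
lemma NL_Lipschitz:
  assumes f: "f \<in> Hs s" and g: "g \<in> Hs s" and R: "norm (sob s f) \<le> R" "norm (sob s g) \<le> R"
  shows "norm (sob s (NL f) - sob s (NL g)) \<le> lip_const * (R * (1 + R)) * norm (sob s f - sob s g)"
proof -
  let ?e = "norm (sob s f - sob s g)" and ?A = "prod_const s" and ?A' = "prod_const (s - 1)" and ?J = wt_const
  have R0: "0 \<le> R" using R norm_ge_zero order_trans by blast
  have A: "0 \<le> ?A" "0 \<le> ?A'" using prod_const_pos less_imp_le by blast+
  note sum = Hs_add[OF f g] and diff = Hs_diff[OF f g]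
  have sumR: "norm (sob s (\<lambda>x. f x + g x)) \<le> 2 * R"
    unfolding sum(2) using norm_triangle_ineq[of "sob s f" "sob s g"] R by linarith
  have 1: "norm (sob s (M\<tau> (\<lambda>x. (f x)\<^sup>2)) - sob s (M\<tau> (\<lambda>x. (g x)\<^sup>2))) \<le> c\<tau> * (?A * (?e * (2 * R))) * ?J"
  proof (rule multiplier_smoothing_diff[OF square_bound(1)[OF f] square_bound(1)[OF g]
        symbols_measurable_complex(1) s0(1) c\<tau> square_bound(2)[OF f] square_bound(2)[OF g]])
    show "(f x - g x) * (f x + g x) = (f x)\<^sup>2 - (g x)\<^sup>2" for x
      by (simp add: power2_eq_square algebra_simps)
    show "wt s \<xi> * norm (fourier (\<lambda>x. (f x - g x) * (f x + g x)) \<xi>) \<le> ?A * (?e * (2 * R))" for \<xi>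
      by (rule order_trans[OF fourier_product_bound(2)[OF diff(1) sum(1) s0(1)]])
        (intro mult_left_mono mult_mono A, auto simp: diff(2) sumR)
  qed
  let ?q = "\<lambda>x. f x * f x + f x * g x + g x * g x"
  have q: "?q \<in> Hs (s - 1)" "norm (sob (s - 1) ?q) \<le> 3 * (?A * ?J * (R * R))"
  proof -
    note ff = Hs_product[OF f f s] and fg = Hs_product[OF f g s] and gg = Hs_product[OF g g s]
    note a1 = Hs_add[OF ff(1) fg(1)] note a2 = Hs_add[OF a1(1) gg(1)]
    show "?q \<in> Hs (s - 1)" by (rule a2)
    have le: "?A * ?J * (norm (sob s u) * norm (sob s v)) \<le> ?A * ?J * (R * R)"
      if "norm (sob s u) \<le> R" "norm (sob s v) \<le> R" for u v
      using that R0 A wt_const_nonneg by (intro mult_left_mono mult_mono mult_nonneg_nonneg) auto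
    have "norm (sob (s - 1) ?q) \<le> norm (sob (s - 1) (\<lambda>x. f x * f x)) + norm (sob (s - 1) (\<lambda>x. f x * g x)) + norm (sob (s - 1) (\<lambda>x. g x * g x))"
      unfolding a2(2) a1(2) by (meson add_mono norm_triangle_ineq order_refl order_trans)
    also have "\<dots> \<le> 3 * (?A * ?J * (R * R))"
      using order_trans[OF ff(2) le] order_trans[OF fg(2) le] order_trans[OF gg(2) le] R by linarith
    finally show "norm (sob (s - 1) ?q) \<le> 3 * (?A * ?J * (R * R))" .
  qed
  have diff': "(\<lambda>x. f x - g x) \<in> Hs (s - 1)" "norm (sob (s - 1) (\<lambda>x. f x - g x)) \<le> ?e"
    using Hs_mono[OF diff(1) s0(3)] by (simp_all add: diff(2))
  have 2: "norm (sob s (M\<psi> (\<lambda>x. (f x)^3)) - sob s (M\<psi> (\<lambda>x. (g x)^3))) \<le> c\<psi> * (?A' * (?e * (3 * (?A * ?J * (R * R))))) * ?J"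
  proof (rule multiplier_smoothing_diff[OF cube_bound(1)[OF f] cube_bound(1)[OF g]
        symbols_measurable_complex(2) s0(1) c\<psi> cube_bound(2)[OF f] cube_bound(2)[OF g]])
    show "(f x - g x) * ?q x = (f x)^3 - (g x)^3" for x
      by (simp add: power3_eq_cube algebra_simps)
    show "wt (s - 1) \<xi> * norm (fourier (\<lambda>x. (f x - g x) * ?q x) \<xi>) \<le> ?A' * (?e * (3 * (?A * ?J * (R * R))))" for \<xi>
      by (rule order_trans[OF fourier_product_bound(2)[OF diff'(1) q(1) s0(2)]])
        (intro mult_left_mono mult_mono A diff' q, auto)
  qed
  note df = deriv_x_spec[OF f s] and dg = deriv_x_spec[OF g s]
  note ddiff = Hs_diff[OF df(1) dg(1)] and dsum = Hs_add[OF df(1) dg(1)]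
  have dsumR: "norm (sob (s - 1) (\<lambda>x. deriv_x f x + deriv_x g x)) \<le> 2 * R"
    unfolding dsum(2) using norm_triangle_ineq[of "sob (s - 1) (deriv_x f)" "sob (s - 1) (deriv_x g)"] R df(3) dg(3)
    by linarith
  have 3: "norm (sob s (M\<psi> (\<lambda>x. (deriv_x f x)\<^sup>2)) - sob s (M\<psi> (\<lambda>x. (deriv_x g x)\<^sup>2))) \<le> c\<psi> * (?A' * (?e * (2 * R))) * ?J"
  proof (rule multiplier_smoothing_diff[OF deriv_square_bound(1)[OF f] deriv_square_bound(1)[OF g]
        symbols_measurable_complex(2) s0(1) c\<psi> deriv_square_bound(2)[OF f] deriv_square_bound(2)[OF g]])
    show "(deriv_x f x - deriv_x g x) * (deriv_x f x + deriv_x g x) = (deriv_x f x)\<^sup>2 - (deriv_x g x)\<^sup>2" for x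
      by (simp add: power2_eq_square algebra_simps)
    show "wt (s - 1) \<xi> * norm (fourier (\<lambda>x. (deriv_x f x - deriv_x g x) * (deriv_x f x + deriv_x g x)) \<xi>) \<le> ?A' * (?e * (2 * R))" for \<xi>
      by (rule order_trans[OF fourier_product_bound(2)[OF ddiff(1) dsum(1) s0(2)]])
        (intro mult_left_mono mult_mono A dsumR, auto simp: ddiff(2) deriv_x_diff[OF f g s])
  qed
  let ?T1 = "c\<tau> * (?A * (?e * (2 * R))) * ?J" and ?T2 = "c\<psi> * (?A' * (?e * (3 * (?A * ?J * (R * R))))) * ?J"
    and ?T3 = "c\<psi> * (?A' * (?e * (2 * R))) * ?J"
  have T: "0 \<le> ?T1" "0 \<le> ?T2" "0 \<le> ?T3"
    using 1 2 3 norm_ge_zero order_trans by blast+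
  have split: "sob s (NL f) - sob s (NL g)
      = (sob s (M\<tau> (\<lambda>x. (f x)\<^sup>2)) - sob s (M\<tau> (\<lambda>x. (g x)\<^sup>2)))
        - (1/8) *\<^sub>R (sob s (M\<psi> (\<lambda>x. (f x)^3)) - sob s (M\<psi> (\<lambda>x. (g x)^3)))
        - (7/48) *\<^sub>R (sob s (M\<psi> (\<lambda>x. (deriv_x f x)\<^sup>2)) - sob s (M\<psi> (\<lambda>x. (deriv_x g x)\<^sup>2)))"
    unfolding NL_Hs(2)[OF f] NL_Hs(2)[OF g] by (simp add: scaleR_diff_right)
  have tri: "norm (a - (1/8) *\<^sub>R b - (7/48) *\<^sub>R c) \<le> norm a + norm b + norm c" for a b c :: l2
  proof -
    have "norm ((1/8) *\<^sub>R b) \<le> norm b" "norm ((7/48) *\<^sub>R c) \<le> norm c" by simp_all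
    then show ?thesis
      using norm_triangle_ineq4[of "a - (1/8) *\<^sub>R b" "(7/48) *\<^sub>R c"] norm_triangle_ineq4[of a "(1/8) *\<^sub>R b"]
      by linarith
  qed
  have "norm (sob s (NL f) - sob s (NL g)) \<le> ?T1 + ?T2 + ?T3"
    unfolding split by (rule order_trans[OF tri]) (use 1 2 3 in linarith)
  also have "\<dots> = ((2 * (c\<tau> * ?A * ?J)) * R + (3 * (c\<psi> * ?A' * (?A * ?J) * ?J)) * R\<^sup>2 + (2 * (c\<psi> * ?A' * ?J)) * R) * ?e"
    by (simp add: algebra_simps power2_eq_square)
  also have "\<dots> \<le> (lip_const * (R * (1 + R))) * ?e"
  proof (rule mult_right_mono)
    have a: "0 \<le> 2 * (c\<tau> * ?A * ?J)" "0 \<le> 3 * (c\<psi> * ?A' * (?A * ?J) * ?J)" "0 \<le> 2 * (c\<psi> * ?A' * ?J)"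
      using A c\<tau>(2) c\<psi>(2) wt_const_nonneg by simp_all
    have R1: "R \<le> R * (1 + R)" "R\<^sup>2 \<le> R * (1 + R)" "0 \<le> R * (1 + R)"
      using R0 by (simp_all add: power2_eq_square algebra_simps)
    show "(2 * (c\<tau> * ?A * ?J)) * R + (3 * (c\<psi> * ?A' * (?A * ?J) * ?J)) * R\<^sup>2 + (2 * (c\<psi> * ?A' * ?J)) * R
        \<le> lip_const * (R * (1 + R))"
      unfolding lip_const_def distrib_right
      using mult_left_mono[OF R1(1) a(1)] mult_left_mono[OF R1(2) a(2)] mult_left_mono[OF R1(1) a(3)] R1(3)
      by linarith
  qed simp
  finally show ?thesis .
qed

text \<open>All symbols of the nonlinear term are odd and real, so the factor \<open>- \<i>\<close> of the integral equation
  makes it real-valued again.\<close>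
lemma NL_imaginary:
  assumes f: "f \<in> Hs s" and re: "AE x in lborel. cnj (f x) = f x"
  shows "AE x in lborel. cnj (- \<i> * NL f x) = - \<i> * NL f x"
proof -
  have dre: "AE x in lborel. cnj (deriv_x f x) = deriv_x f x" by (rule deriv_x_real[OF f s re])
  have "AE x in lborel. cnj (M\<tau> (\<lambda>x. (f x)\<^sup>2) x) = - M\<tau> (\<lambda>x. (f x)\<^sup>2) x"
    by (rule multiplier_odd_imaginary[OF square_bound(1)[OF f] _ Hs_L2[OF M\<tau>_square(1)[OF f f]] M\<tau>_square(2)[OF f f] symbols_measurable_complex(1)])
      (use re in \<open>auto simp: symbols_odd\<close>)
  moreover have "AE x in lborel. cnj (M\<psi> (\<lambda>x. (f x)^3) x) = - M\<psi> (\<lambda>x. (f x)^3) x"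
    by (rule multiplier_odd_imaginary[OF cube_bound(1)[OF f] _ Hs_L2[OF M\<psi>_cube(1)[OF f f]] M\<psi>_cube(2)[OF f f] symbols_measurable_complex(2)])
      (use re in \<open>auto simp: symbols_odd\<close>)
  moreover have "AE x in lborel. cnj (M\<psi> (\<lambda>x. (deriv_x f x)\<^sup>2) x) = - M\<psi> (\<lambda>x. (deriv_x f x)\<^sup>2) x"
    by (rule multiplier_odd_imaginary[OF deriv_square_bound(1)[OF f] _ Hs_L2[OF M\<psi>_deriv(1)[OF f f]] M\<psi>_deriv(2)[OF f f] symbols_measurable_complex(2)])
      (use dre in \<open>auto simp: symbols_odd\<close>)
  ultimately show ?thesis
    by eventually_elim (simp add: nonlinearity_def algebra_simps)
qed

end


section \<open>Ordinary differential equations in a Banach space\<close>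

text \<open>An equation \<open>W' = G(t, W)\<close> whose right-hand side vanishes at 0 and is Lipschitz on balls with the growth
  of a quadratic plus a cubic nonlinearity. The fixed points of \<open>J\<close> are an invariant closed subspace
  in which solutions are required to stay; it stands for the real-valued functions.\<close>
locale local_flow =
  fixes G :: "real \<Rightarrow> 'a::banach \<Rightarrow> 'a" and J :: "'a \<Rightarrow> 'a" and K :: real
  assumes G_continuous: "\<And>I W. continuous_on I W \<Longrightarrow> continuous_on I (\<lambda>t. G t (W t))"
    and G_Lipschitz: "\<And>t v w R. norm v \<le> R \<Longrightarrow> norm w \<le> R \<Longrightarrow> norm (G t v - G t w) \<le> K * (R * (1 + R)) * norm (v - w)"
    and G_zero: "\<And>t. G t 0 = 0"
    and K_pos: "0 < K"
    and J_linear: "bounded_linear J"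
    and J_invariant: "\<And>t v. J v = v \<Longrightarrow> J (G t v) = G t v"
begin

definition solves :: "real \<Rightarrow> 'a \<Rightarrow> real \<Rightarrow> (real \<Rightarrow> 'a) \<Rightarrow> bool" where
  "solves a v b W \<longleftrightarrow> continuous_on {a..b} W \<and>
     (\<forall>t\<in>{a..b}. J (W t) = W t \<and> W t = v + integral {a..t} (\<lambda>r. G r (W r)))"

lemma solvesI:
  assumes "continuous_on {a..b} W" "\<And>t. t \<in> {a..b} \<Longrightarrow> J (W t) = W t"
    "\<And>t. t \<in> {a..b} \<Longrightarrow> W t = v + integral {a..t} (\<lambda>r. G r (W r))"
  shows "solves a v b W"
  using assms unfolding solves_def by blast

lemma solvesD:
  assumes "solves a v b W"
  shows "continuous_on {a..b} W" "t \<in> {a..b} \<Longrightarrow> J (W t) = W t"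
    "t \<in> {a..b} \<Longrightarrow> W t = v + integral {a..t} (\<lambda>r. G r (W r))"
  using assms unfolding solves_def by blast+

lemma solves_integrable:
  "continuous_on {a..b} W \<Longrightarrow> t \<le> b \<Longrightarrow> (\<lambda>r. G r (W r)) integrable_on {a..t}"
  by (intro integrable_continuous_real G_continuous) (auto elim: continuous_on_subset)

lemma solves_restrict:
  assumes "solves a v b W" "c \<le> b" shows "solves a v c W"
proof (rule solvesI)
  show "continuous_on {a..c} W"
    using assms by (intro continuous_on_subset[OF solvesD(1)[OF assms(1)]]) auto
  fix t assume "t \<in> {a..c}"
  then have t: "t \<in> {a..b}" using assms(2) by simp
  show "J (W t) = W t" by (rule solvesD(2)[OF assms(1) t])
  show "W t = v + integral {a..t} (\<lambda>r. G r (W r))" by (rule solvesD(3)[OF assms(1) t])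
qed

lemma solves_cong:
  assumes W: "solves a v b W" and eq: "\<And>t. t \<in> {a..b} \<Longrightarrow> W' t = W t"
  shows "solves a v b W'"
proof (rule solvesI)
  show "continuous_on {a..b} W'"
    by (rule continuous_on_eq[OF solvesD(1)[OF W] eq[symmetric]])
  fix t assume t: "t \<in> {a..b}"
  show "J (W' t) = W' t" using solvesD(2)[OF W t] eq[OF t] by simp
  have "integral {a..t} (\<lambda>r. G r (W' r)) = integral {a..t} (\<lambda>r. G r (W r))"
    using t eq by (intro integral_cong) auto
  then show "W' t = v + integral {a..t} (\<lambda>r. G r (W' r))"
    using solvesD(3)[OF W t] eq[OF t] by simp
qed

lemma solves_initial: "solves a v b W \<Longrightarrow> a \<le> b \<Longrightarrow> W a = v"
  using solvesD(3)[of a v b W a] by simp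

text \<open>Picard iteration in the ball of radius \<open>2 \<rho>\<close>, where the Lipschitz constant is
  \<open>L = 2 K \<rho> (1 + 2 \<rho>)\<close>. The length \<open>h\<close> of the interval is such that \<open>L h \<le> 1/2\<close>: this makes the iteration
  a contraction, and it bounds the integral by \<open>L (2 \<rho>) h \<le> \<rho>\<close>, so the ball is preserved.\<close>
lemma local_existence:
  assumes v: "norm v \<le> \<rho>" "J v = v" and \<rho>: "0 < \<rho>"
  shows "\<exists>W. solves a v (a + 1 / (8 * K * \<rho> * (1 + \<rho>))) W \<and>
    (\<forall>t\<in>{a..a + 1 / (8 * K * \<rho> * (1 + \<rho>))}. norm (W t) \<le> 2 * \<rho>)"
proof -
  define h where "h = 1 / (8 * K * \<rho> * (1 + \<rho>))"
  define L where "L = K * (2 * \<rho> * (1 + 2 * \<rho>))"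
  have h: "0 < h" unfolding h_def using K_pos \<rho> by simp
  have L: "0 < L" unfolding L_def using K_pos \<rho> by simp
  have hL: "L * h \<le> 1 / 2"
  proof -
    have "L * h = (1 + 2 * \<rho>) / (4 * (1 + \<rho>))"
      unfolding L_def h_def using K_pos \<rho> by (simp add: divide_simps) (simp add: algebra_simps)
    also have "\<dots> \<le> 1 / 2" using \<rho> by (simp add: divide_simps)
    finally show ?thesis .
  qed
  \<comment> \<open>Freezing time outside the interval turns the curves into bounded continuous functions on the
    whole line, which form a complete space.\<close>
  define clamp where "clamp t = max a (min t (a + h))" for t
  have clamp: "clamp t \<in> {a..a + h}" for t using h by (auto simp: clamp_def)
  have clamp_id: "t \<in> {a..a + h} \<Longrightarrow> clamp t = t" for t by (auto simp: clamp_def)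
  have clamp_cont: "continuous_on UNIV clamp" unfolding clamp_def by (intro continuous_intros)
  define C where "C = {w. norm w \<le> 2 * \<rho> \<and> J w = w}"
  have J_cont: "continuous_on UNIV J" by (rule linear_continuous_on[OF J_linear])
  have C_closed: "closed C"
    unfolding C_def by (intro closed_Collect_conj closed_Collect_le closed_Collect_eq continuous_intros J_cont)
  define X :: "(real \<Rightarrow>\<^sub>C 'a) set" where "X = PiC UNIV (\<lambda>_. C)"
  have X_iff: "V \<in> X \<longleftrightarrow> (\<forall>t. norm (V t) \<le> 2 * \<rho> \<and> J (V t) = V t)" for V
    by (auto simp: X_def mem_PiC_iff C_def Pi_def)
  have "closed X" unfolding X_def by (intro closed_PiC C_closed)
  note X_complete = this[folded complete_eq_closed]
  let ?g = "\<lambda>V t. G t (apply_bcontfun V t)"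
  let ?P = "\<lambda>V t. v + integral {a..clamp t} (?g V)"
  have g_cont: "continuous_on I (?g V)" for V I
    by (intro G_continuous continuous_on_apply_bcontfun)
  have g_int: "?g V integrable_on {a..t}" for V t
    by (intro integrable_continuous_real g_cont)
  have g_bound: "norm (?g V t) \<le> L * (2 * \<rho>)" if "V \<in> X" for V t
  proof -
    have V: "norm (V t) \<le> 2 * \<rho>" using that by (simp add: X_iff)
    have "norm (?g V t) \<le> L * norm (V t)"
      using G_Lipschitz[of "V t" "2 * \<rho>" 0 t] V \<rho> by (simp add: G_zero L_def)
    also have "\<dots> \<le> L * (2 * \<rho>)" using V L by (intro mult_left_mono) auto
    finally show ?thesis .
  qed
  have int_bound: "norm (integral {a..clamp t} f) \<le> B * h"
    if "continuous_on {a..clamp t} f" "\<And>r. norm (f r) \<le> B" "0 \<le> B" for f :: "real \<Rightarrow> 'a" and B t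
  proof -
    have "norm (integral {a..clamp t} f) \<le> B * (clamp t - a)"
      using that clamp[of t] by (intro integral_bound) auto
    also have "\<dots> \<le> B * h" using clamp[of t] that(3) by (intro mult_left_mono) auto
    finally show ?thesis .
  qed
  have P_norm: "norm (?P V t) \<le> 2 * \<rho>" if "V \<in> X" for V t
  proof -
    have "norm (integral {a..clamp t} (?g V)) \<le> L * (2 * \<rho>) * h"
      using g_bound[OF that] L \<rho> by (intro int_bound g_cont) auto
    also have "\<dots> = (L * h) * (2 * \<rho>)" by simp
    also have "\<dots> \<le> 1 / 2 * (2 * \<rho>)" using hL \<rho> by (intro mult_right_mono) auto
    finally show ?thesis using norm_triangle_ineq[of v "integral {a..clamp t} (?g V)"] v(1) by simp
  qed
  have P_cont: "continuous_on UNIV (?P V)" for V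
  proof -
    have "continuous_on {a..a + h} (\<lambda>t. integral {a..t} (?g V))"
      by (rule indefinite_integral_continuous_1[OF g_int])
    then have "continuous_on UNIV (\<lambda>t. integral {a..clamp t} (?g V))"
      using clamp by (intro continuous_on_compose2[OF _ clamp_cont]) auto
    then show ?thesis by (intro continuous_intros)
  qed
  have P_J: "J (?P V t) = ?P V t" if "V \<in> X" for V t
  proof -
    have "J (integral {a..clamp t} (?g V)) = integral {a..clamp t} (J \<circ> ?g V)"
      by (rule integral_linear[OF g_int J_linear, symmetric])
    also have "J \<circ> ?g V = ?g V"
      using that by (auto simp: X_iff J_invariant)
    finally show ?thesis using v(2) by (simp add: linear_add[OF bounded_linear.linear[OF J_linear]])
  qed
  define \<Phi> where "\<Phi> V = Bcontfun (?P V)" for V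
  have \<Phi>: "apply_bcontfun (\<Phi> V) = ?P V" if "V \<in> X" for V
    unfolding \<Phi>_def by (intro Bcontfun_inverse bcontfun_normI[OF P_cont P_norm[OF that]])
  have "\<exists>!V\<in>X. \<Phi> V = V"
  proof (rule Banach_fix[OF X_complete])
    have "const_bcontfun v \<in> X" using v \<rho> by (simp add: X_iff)
    then show "X \<noteq> {}" by auto
    show "\<Phi> ` X \<subseteq> X" using P_norm P_J by (auto simp: X_iff[of "\<Phi> _"] \<Phi>)
    fix V W assume VW: "V \<in> X" "W \<in> X"
    show "dist (\<Phi> V) (\<Phi> W) \<le> 1 / 2 * dist V W"
    proof (rule dist_bound)
      fix t
      have "norm (integral {a..clamp t} (\<lambda>r. ?g V r - ?g W r)) \<le> L * dist V W * h"
      proof (rule int_bound)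
        fix r
        have "norm (?g V r - ?g W r) \<le> L * norm (V r - W r)"
          using G_Lipschitz[of "V r" "2 * \<rho>" "W r" r] VW by (simp add: X_iff L_def)
        also have "\<dots> \<le> L * dist V W"
          using dist_bounded[of V r W] L by (simp add: dist_norm)
        finally show "norm (?g V r - ?g W r) \<le> L * dist V W" .
      qed (use L in \<open>auto intro!: continuous_on_diff g_cont\<close>)
      also have "\<dots> = (L * h) * dist V W" by simp
      also have "\<dots> \<le> 1 / 2 * dist V W" using hL by (intro mult_right_mono) auto
      finally show "dist (\<Phi> V t) (\<Phi> W t) \<le> 1 / 2 * dist V W"
        by (simp add: \<Phi> VW dist_norm Henstock_Kurzweil_Integration.integral_diff g_int)
    qed
  qed auto
  then obtain V where V: "V \<in> X" "\<Phi> V = V" by blast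
  have eq: "V t = ?P V t" for t
    using fun_cong[OF \<Phi>[OF V(1)], of t] unfolding V(2) .
  have "solves a v (a + h) (apply_bcontfun V)"
  proof (rule solvesI)
    fix t assume t: "t \<in> {a..a + h}"
    show "J (V t) = V t" using V(1) by (simp add: X_iff)
    show "V t = v + integral {a..t} (\<lambda>r. G r (V r))" using eq[of t] clamp_id[OF t] by simp
  qed simp
  moreover have "norm (V t) \<le> 2 * \<rho>" for t using V(1) by (simp add: X_iff)
  ultimately show ?thesis unfolding h_def by blast
qed

text \<open>The difference of two solutions, weighted by \<open>exp (-2 L (t - a))\<close>, is at its maximum
  at most half of itself.\<close>
lemma solves_unique:
  assumes W: "solves a v b W" and W': "solves a v b W'" and t: "t \<in> {a..b}"
  shows "W t = W' t"
proof -
  have ab: "a \<le> b" using t by simp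
  have c: "continuous_on {a..b} W" "continuous_on {a..b} W'" using W W' by (auto dest: solvesD(1))
  have "compact (W ` {a..b})" "compact (W' ` {a..b})"
    by (intro compact_continuous_image c compact_Icc)+
  then have "bounded (W ` {a..b} \<union> W' ` {a..b})" by (simp add: compact_imp_bounded)
  then obtain R where "\<And>x. x \<in> W ` {a..b} \<union> W' ` {a..b} \<Longrightarrow> norm x \<le> R"
    unfolding bounded_iff by blast
  then have R: "norm (W r) \<le> R" "norm (W' r) \<le> R" if "r \<in> {a..b}" for r using that by auto
  have R0: "0 \<le> R" using R(1)[OF t] norm_ge_zero order_trans by blast
  define L where "L = K * (R * (1 + R)) + 1"
  have L: "0 < L" "K * (R * (1 + R)) \<le> L" using K_pos R0 by (auto simp: L_def add_nonneg_pos)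
  define d where "d r = norm (W r - W' r) * exp (- 2 * L * (r - a))" for r
  have "continuous_on {a..b} d" unfolding d_def by (intro continuous_intros c)
  then obtain t0 where t0: "t0 \<in> {a..b}" and max: "\<And>r. r \<in> {a..b} \<Longrightarrow> d r \<le> d t0"
    using continuous_attains_sup[of "{a..b}" d] ab by auto
  have g_int: "(\<lambda>r. G r (W r)) integrable_on {a..t0}" "(\<lambda>r. G r (W' r)) integrable_on {a..t0}"
    using t0 by (auto intro: solves_integrable c)
  have le: "norm (G r (W r) - G r (W' r)) \<le> L * d t0 * exp (2 * L * (r - a))" if "r \<in> {a..t0}" for r
  proof -
    have r: "r \<in> {a..b}" using that t0 by auto
    have "norm (G r (W r) - G r (W' r)) \<le> K * (R * (1 + R)) * norm (W r - W' r)"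
      by (rule G_Lipschitz[OF R[OF r]])
    also have "\<dots> \<le> L * norm (W r - W' r)" by (intro mult_right_mono L) simp
    also have "\<dots> = L * d r * exp (2 * L * (r - a))"
      by (simp add: d_def mult.assoc flip: exp_add)
    also have "\<dots> \<le> L * d t0 * exp (2 * L * (r - a))"
      using max[OF r] L by (intro mult_right_mono mult_left_mono) auto
    finally show ?thesis .
  qed
  have exp_int: "((\<lambda>r. L * d t0 * exp (2 * L * (r - a))) has_integral
      d t0 / 2 * exp (2 * L * (t0 - a)) - d t0 / 2 * exp (2 * L * (a - a))) {a..t0}"
    using t0 by (intro fundamental_theorem_of_calculus)
      (auto intro!: derivative_eq_intros simp flip: has_real_derivative_iff_has_vector_derivative)
  have "W t0 - W' t0 = integral {a..t0} (\<lambda>r. G r (W r)) - integral {a..t0} (\<lambda>r. G r (W' r))"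
  proof -
    have "W t0 = v + integral {a..t0} (\<lambda>r. G r (W r))" "W' t0 = v + integral {a..t0} (\<lambda>r. G r (W' r))"
      using solvesD(3)[OF W t0] solvesD(3)[OF W' t0] .
    then show ?thesis by (metis add_diff_cancel_left)
  qed
  also have "\<dots> = integral {a..t0} (\<lambda>r. G r (W r) - G r (W' r))"
    by (rule Henstock_Kurzweil_Integration.integral_diff[OF g_int, symmetric])
  finally have "norm (W t0 - W' t0) = norm (integral {a..t0} (\<lambda>r. G r (W r) - G r (W' r)))"
    by simp
  also have "\<dots> \<le> integral {a..t0} (\<lambda>r. L * d t0 * exp (2 * L * (r - a)))"
    using exp_int g_int le by (intro integral_norm_bound_integral integrable_diff) (auto simp: integrable_on_def)
  also have "\<dots> = d t0 / 2 * exp (2 * L * (t0 - a)) - d t0 / 2"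
    using integral_unique[OF exp_int] by simp
  finally have "norm (W t0 - W' t0) \<le> d t0 / 2 * exp (2 * L * (t0 - a)) - d t0 / 2" .
  moreover have "0 \<le> d t0" by (simp add: d_def)
  ultimately have "norm (W t0 - W' t0) \<le> d t0 / 2 * exp (2 * L * (t0 - a))"
    by linarith
  then have "d t0 \<le> d t0 / 2 * exp (2 * L * (t0 - a)) * exp (- 2 * L * (t0 - a))"
    unfolding d_def[of t0] by (rule mult_right_mono) simp
  also have "\<dots> = d t0 / 2" by (simp add: mult.assoc flip: exp_add)
  finally have "d t0 \<le> 0" by simp
  then have "d t \<le> 0" using max[OF t] by simp
  then show ?thesis by (simp add: d_def mult_le_0_iff)
qed

lemma solves_glue:
  assumes W: "solves a v b W" and W': "solves b (W b) c W'" and ab: "a \<le> b" "b \<le> c"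
  shows "solves a v c (\<lambda>t. if t \<le> b then W t else W' t)"
proof -
  let ?U = "\<lambda>t. if t \<le> b then W t else W' t"
  have Wb: "W' b = W b" by (rule solves_initial[OF W' ab(2)])
  have cont: "continuous_on {a..c} ?U"
  proof -
    have "continuous_on ({a..b} \<union> {b..c}) ?U"
      using solvesD(1)[OF W] solvesD(1)[OF W'] Wb by (intro continuous_on_cases) (auto dest: antisym)
    then show ?thesis using ab by (simp add: ivl_disj_un_two_touch(4))
  qed
  show ?thesis
  proof (rule solvesI[OF cont])
    fix t assume t: "t \<in> {a..c}"
    show "J (?U t) = ?U t" using t solvesD(2)[OF W, of t] solvesD(2)[OF W', of t] by simp
    show "?U t = v + integral {a..t} (\<lambda>r. G r (?U r))"
    proof (cases "t \<le> b")
      case True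
      have "integral {a..t} (\<lambda>r. G r (?U r)) = integral {a..t} (\<lambda>r. G r (W r))"
        using True by (intro integral_cong) auto
      then show ?thesis using True t solvesD(3)[OF W, of t] by simp
    next
      case False
      have "integral {a..t} (\<lambda>r. G r (?U r)) = integral {a..b} (\<lambda>r. G r (?U r)) + integral {b..t} (\<lambda>r. G r (?U r))"
        using False ab t solves_integrable[OF cont, of t]
        by (intro Henstock_Kurzweil_Integration.integral_combine[symmetric]) auto
      also have "integral {a..b} (\<lambda>r. G r (?U r)) = integral {a..b} (\<lambda>r. G r (W r))"
        by (intro integral_cong) auto
      also have "integral {b..t} (\<lambda>r. G r (?U r)) = integral {b..t} (\<lambda>r. G r (W' r))"
        using Wb by (intro integral_cong) (auto simp: le_less)
      finally show ?thesis
        using False t ab solvesD(3)[OF W, of b] solvesD(3)[OF W', of t] by (simp add: add.assoc[symmetric])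
    qed
  qed
qed

text \<open>A solution on a closed interval can be restarted at its end.\<close>
lemma solves_extend:
  assumes W: "solves a v b W" and ab: "a \<le> b"
  obtains c W' where "b < c" "solves a v c W'"
proof -
  let ?\<rho> = "norm (W b) + 1"
  let ?c = "b + 1 / (8 * K * ?\<rho> * (1 + ?\<rho>))"
  have "J (W b) = W b" using solvesD(2)[OF W, of b] ab by simp
  then obtain W' where W': "solves b (W b) ?c W'"
    using local_existence[of "W b" ?\<rho> b] by (auto simp: add_nonneg_pos)
  have "0 < 8 * K * ?\<rho> * (1 + ?\<rho>)"
    using K_pos norm_ge_zero[of "W b"] by (intro mult_pos_pos add_nonneg_pos) auto
  then have c: "b < ?c" by simp
  show thesis by (rule that[OF c solves_glue[OF W W' ab less_imp_le[OF c]]])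
qed

text \<open>The maximal time is the supremum of the times of existence. Since a solution on a closed interval can
  be extended, it is not attained; by uniqueness the solutions fit together.\<close>
lemma maximal_existence:
  assumes v: "J v = v"
  shows "\<exists>T W. 0 < T \<and> (\<forall>r. ereal r < T \<longrightarrow> solves 0 v r W) \<and>
    (\<forall>r W'. T \<le> ereal r \<longrightarrow> \<not> solves 0 v r W')"
proof -
  define A where "A = {r. 0 \<le> r \<and> (\<exists>W. solves 0 v r W)}"
  define T where "T = Sup (ereal ` A)"
  define W where "W t = (SOME W. solves 0 v t W) t" for t
  have zero: "solves 0 v 0 (\<lambda>_. v)" using v by (simp add: solves_def)
  have ext: "\<exists>c. r < c \<and> c \<in> A" if "r \<in> A" for r
  proof -
    from that obtain W where W: "solves 0 v r W" and r: "0 \<le> r" by (auto simp: A_def)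
    obtain c W' where "r < c" "solves 0 v c W'" by (rule solves_extend[OF W r])
    then show ?thesis using r unfolding A_def by (intro exI[of _ c]) auto
  qed
  have lt: "ereal r < T" if "r \<in> A" for r
  proof -
    obtain c where "r < c" "c \<in> A" using ext[OF \<open>r \<in> A\<close>] by blast
    then show ?thesis unfolding T_def by (intro less_SUP_iff[THEN iffD2]) auto
  qed
  have A0: "0 \<in> A" using zero by (auto simp: A_def)
  have sol: "solves 0 v r W" if r: "r \<in> A" for r
  proof -
    obtain W1 where W1: "solves 0 v r W1" using r by (auto simp: A_def)
    have "W t = W1 t" if t: "t \<in> {0..r}" for t
    proof -
      have t1: "solves 0 v t W1" using solves_restrict[OF W1] t by simp
      then have "solves 0 v t (SOME W. solves 0 v t W)"
        by (rule someI[where P = "solves 0 v t"])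
      from solves_unique[OF this t1, of t] show ?thesis using t by (simp add: W_def)
    qed
    then show ?thesis by (rule solves_cong[OF W1])
  qed
  show ?thesis
  proof (intro exI conjI allI impI)
    show "0 < T" using lt[OF A0] by (simp add: zero_ereal_def)
    show "solves 0 v r W" if r: "ereal r < T" for r
    proof -
      obtain r' where "r' \<in> A" "r < r'"
        using r unfolding T_def less_Sup_iff by auto
      then show ?thesis using solves_restrict[OF sol] by simp
    qed
    show "\<not> solves 0 v r W'" if T_le: "T \<le> ereal r" for r W'
    proof
      assume "solves 0 v r W'"
      moreover have "0 \<le> r"
        using less_le_trans[OF \<open>0 < T\<close> T_le] by (simp add: zero_ereal_def)
      ultimately have "r \<in> A" by (auto simp: A_def)
      from lt[OF this] T_le show False by simp
    qed
  qed
qed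

end


section \<open>Riemann integrals in Sobolev spaces\<close>

text \<open>For a continuous integrand the gauge can be taken constant, by uniform continuity.\<close>
lemma Riemann_sums_uniform:
  fixes f :: "real \<Rightarrow> 'a::banach"
  assumes f: "continuous_on {a..b} f" and e: "0 < e"
  obtains d where "0 < d" "\<And>p. p tagged_division_of {a..b} \<Longrightarrow> (\<lambda>t. ball t d) fine p \<Longrightarrow>
    norm ((\<Sum>(t, I)\<in>p. measure lborel I *\<^sub>R f t) - integral {a..b} f) < e"
proof -
  define e' where "e' = e / (2 * (measure lborel {a..b} + 1))"
  have c0: "0 \<le> measure lborel {a..b}" by (rule measure_nonneg)
  have e': "0 < e'" unfolding e'_def using e c0 by (intro divide_pos_pos) auto
  have "uniformly_continuous_on {a..b} f"
    by (rule compact_uniformly_continuous[OF f compact_Icc])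
  then obtain d where d: "0 < d" and unif: "\<And>t r. t \<in> {a..b} \<Longrightarrow> r \<in> {a..b} \<Longrightarrow> dist r t < d \<Longrightarrow> dist (f r) (f t) < e'"
    using e' unfolding uniformly_continuous_on_def by metis
  have "norm ((\<Sum>(t, I)\<in>p. measure lborel I *\<^sub>R f t) - integral {a..b} f) < e"
    if p: "p tagged_division_of {a..b}" and fine: "(\<lambda>t. ball t d) fine p" for p
  proof -
    have p': "p tagged_division_of cbox a b" using p by simp
    have int: "f integrable_on cbox a b" using integrable_continuous_real[OF f] by simp
    have eq: "integral {a..b} f = (\<Sum>(t, I)\<in>p. integral I f)"
      using integral_combine_tagged_division_topdown[OF int p'] by simp
    have le: "norm (measure lborel I *\<^sub>R f t - integral I f) \<le> e' * measure lborel I" if tI: "(t, I) \<in> p" for t I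
    proof -
      from tagged_division_ofD(4)[OF p' tI] obtain u v where I: "I = cbox u v" by blast
      have sub: "I \<subseteq> {a..b}" "t \<in> I" using tagged_division_ofD(2,3)[OF p' tI] by auto
      have intI: "f integrable_on cbox u v"
        using integrable_on_subcbox[OF int, of u v] sub I by simp
      have "((\<lambda>r. f t - f r) has_integral (measure lborel (cbox u v) *\<^sub>R f t - integral (cbox u v) f)) (cbox u v)"
        by (intro has_integral_diff has_integral_const integrable_integral intI)
      then show ?thesis
        unfolding I
      proof (rule has_integral_bound[rotated])
        show "norm (f t - f r) \<le> e'" if "r \<in> cbox u v" for r
        proof -
          have "I \<subseteq> ball t d" using fine tI unfolding fine_def by blast
          then have "dist t r < d" using that I by auto
          then have "dist (f t) (f r) < e'" using sub that I by (intro unif) auto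
          then show ?thesis by (simp add: dist_norm)
        qed
      qed (use e' in simp)
    qed
    have "norm ((\<Sum>(t, I)\<in>p. measure lborel I *\<^sub>R f t) - integral {a..b} f)
        = norm (\<Sum>(t, I)\<in>p. measure lborel I *\<^sub>R f t - integral I f)"
      unfolding eq by (simp add: sum_subtractf case_prod_unfold)
    also have "\<dots> \<le> (\<Sum>(t, I)\<in>p. e' * measure lborel I)"
      by (rule sum_norm_le) (use le in auto)
    also have "\<dots> = e' * measure lborel {a..b}"
      using additive_content_tagged_division[OF p'] by (simp add: sum_distrib_left[symmetric] case_prod_unfold)
    also have "\<dots> < e"
    proof -
      have "e' * measure lborel {a..b} \<le> e' * (measure lborel {a..b} + 1)" using e' by simp
      also have "\<dots> = e / 2" unfolding e'_def using c0 by (simp add: field_simps add_nonneg_eq_0_iff)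
      finally show ?thesis using e by simp
    qed
    finally show ?thesis .
  qed
  with d that show thesis by blast
qed

text \<open>The isometry \<open>sob s\<close> carries Riemann sums to Riemann sums, so integrals in \<open>H\<^sup>s\<close> are integrals in the
  space of classes.\<close>
lemma Riemann_sum_sob:
  assumes p: "p tagged_division_of {a..b}" and F: "\<And>t. t \<in> {a..b} \<Longrightarrow> F t \<in> Hs s" and w: "w \<in> Hs s"
  shows "Hs_norm s (\<lambda>x. (\<Sum>(t, I)\<in>p. of_real (measure lborel I) * F t x) - w x)
    = norm ((\<Sum>(t, I)\<in>p. measure lborel I *\<^sub>R sob s (F t)) - sob s w)"
proof -
  have fin: "finite p" by (rule tagged_division_of_finite[OF p])
  have "F (fst z) \<in> Hs s" if "z \<in> p" for z
    using tag_in_interval[OF p, of "fst z" "snd z"] that F by simp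
  then have *: "(\<lambda>x. \<Sum>z\<in>p. of_real (measure lborel (snd z)) * F (fst z) x) \<in> Hs s \<and>
      sob s (\<lambda>x. \<Sum>z\<in>p. of_real (measure lborel (snd z)) * F (fst z) x)
        = (\<Sum>z\<in>p. measure lborel (snd z) *\<^sub>R sob s (F (fst z)))"
    by (intro Hs_sum fin)
  show ?thesis
    using Hs_diff[OF conjunct1[OF *] w] * by (simp only: case_prod_unfold Hs_norm_sob)
qed

lemma has_Hs_integral_imp_has_integral:
  assumes "has_Hs_integral s F w a b"
  shows "((\<lambda>t. sob s (F t)) has_integral sob s w) {a..b}"
  unfolding has_integral_real
proof (intro allI impI)
  fix e :: real assume "0 < e"
  from assms have F: "\<And>t. t \<in> {a..b} \<Longrightarrow> F t \<in> Hs s" and w: "w \<in> Hs s" by (auto simp: has_Hs_integral_def)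
  from assms \<open>0 < e\<close> obtain d where d: "0 < d" and
    *: "\<And>p. p tagged_division_of {a..b} \<Longrightarrow> (\<lambda>t. ball t d) fine p \<Longrightarrow>
      Hs_norm s (\<lambda>x. (\<Sum>(t, I)\<in>p. of_real (measure lborel I) * F t x) - w x) < e"
    unfolding has_Hs_integral_def by meson
  show "\<exists>\<gamma>. gauge \<gamma> \<and> (\<forall>\<D>. \<D> tagged_division_of {a..b} \<and> \<gamma> fine \<D> \<longrightarrow>
      norm ((\<Sum>(x, I)\<in>\<D>. measure lborel I *\<^sub>R sob s (F x)) - sob s w) < e)"
  proof (intro exI conjI allI impI)
    show "gauge (\<lambda>t::real. ball t d)" using d by (rule gauge_ball)
    fix p assume p: "p tagged_division_of {a..b} \<and> (\<lambda>t. ball t d) fine p"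
    show "norm ((\<Sum>(x, I)\<in>p. measure lborel I *\<^sub>R sob s (F x)) - sob s w) < e"
      using *[of p] p Riemann_sum_sob[OF conjunct1[OF p] F w] by simp
  qed
qed

lemma has_Hs_integral_continuous:
  assumes F: "\<And>t. t \<in> {a..b} \<Longrightarrow> F t \<in> Hs s" and cont: "continuous_on {a..b} (\<lambda>t. sob s (F t))"
    and w: "w \<in> Hs s" "sob s w = integral {a..b} (\<lambda>t. sob s (F t))"
  shows "has_Hs_integral s F w a b"
  unfolding has_Hs_integral_def
proof (intro conjI ballI allI impI F w)
  fix e :: real assume "0 < e"
  then obtain d where d: "0 < d" and *: "\<And>p. p tagged_division_of {a..b} \<Longrightarrow> (\<lambda>t. ball t d) fine p \<Longrightarrow>
      norm ((\<Sum>(t, I)\<in>p. measure lborel I *\<^sub>R sob s (F t)) - integral {a..b} (\<lambda>t. sob s (F t))) < e"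
    using Riemann_sums_uniform[OF cont] by metis
  show "\<exists>d>0. \<forall>p. p tagged_division_of {a..b} \<and> (\<lambda>t. ball t d) fine p \<longrightarrow>
      Hs_norm s (\<lambda>x. (\<Sum>(t, I)\<in>p. of_real (measure lborel I) * F t x) - w x) < e"
  proof (intro exI[of _ d] conjI allI impI d)
    fix p assume p: "p tagged_division_of {a..b} \<and> (\<lambda>t. ball t d) fine p"
    show "Hs_norm s (\<lambda>x. (\<Sum>(t, I)\<in>p. of_real (measure lborel I) * F t x) - w x) < e"
      using *[of p] p Riemann_sum_sob[OF conjunct1[OF p] F w(1)] w(2) by simp
  qed
qed

lemma continuous_Hs_iff:
  "continuous_Hs s I u \<longleftrightarrow> (\<forall>t\<in>I. u t \<in> Hs s) \<and> continuous_on I (\<lambda>t. sob s (u t))"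
proof -
  have "((\<lambda>r. Hs_norm s (\<lambda>x. u r x - u t x)) \<longlongrightarrow> 0) (at t within I)
      \<longleftrightarrow> ((\<lambda>r. sob s (u r)) \<longlongrightarrow> sob s (u t)) (at t within I)"
    if u: "\<forall>t\<in>I. u t \<in> Hs s" and t: "t \<in> I" for t
  proof -
    have "eventually (\<lambda>r. Hs_norm s (\<lambda>x. u r x - u t x) = norm (sob s (u r) - sob s (u t))) (at t within I)"
      using u t by (auto simp: eventually_at_filter Hs_norm_sob Hs_diff)
    then have "((\<lambda>r. Hs_norm s (\<lambda>x. u r x - u t x)) \<longlongrightarrow> 0) (at t within I)
        \<longleftrightarrow> ((\<lambda>r. norm (sob s (u r) - sob s (u t))) \<longlongrightarrow> 0) (at t within I)"
      by (rule tendsto_cong)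
    then show ?thesis by (simp only: tendsto_norm_zero_iff LIM_zero_iff)
  qed
  then show ?thesis by (auto simp: continuous_Hs_def continuous_on_def)
qed


section \<open>The flow of the equation\<close>

context wave_equation
begin

definition E :: "real \<Rightarrow> l2 \<Rightarrow> l2" where
  "E t = mult_l2 (\<lambda>\<xi>. cis (- (\<phi> \<xi> * t)))"

lemma E_symbol: "(\<lambda>\<xi>. cis (- (\<phi> \<xi> * t))) \<in> borel_measurable borel" "norm (cis (- (\<phi> \<xi> * t))) \<le> 1"
  by simp_all measurable

lemma E_linear: "bounded_linear (E t)"
  unfolding E_def by (rule bounded_linear_mult_l2(1)[OF E_symbol])

lemma E_E: "E t (E r V) = E (t + r) V"
proof -
  obtain f where f: "f \<in> L2" "V = cls f" by (rule l2_cases)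
  have "cis (- (\<phi> \<xi> * t)) * cis (- (\<phi> \<xi> * r)) = cis (- (\<phi> \<xi> * (t + r)))" for \<xi>
    by (simp add: cis_mult algebra_simps)
  then have "(\<lambda>\<xi>. cis (- (\<phi> \<xi> * t)) * (cis (- (\<phi> \<xi> * r)) * f \<xi>)) = (\<lambda>\<xi>. cis (- (\<phi> \<xi> * (t + r))) * f \<xi>)"
    by (simp only: mult.assoc[symmetric])
  then show ?thesis
    unfolding E_def f(2) by (simp only: mult_l2_cls[OF E_symbol] L2_bounded_mult[OF _ E_symbol] f(1))
qed

lemma E_0 [simp]: "E 0 V = V"
proof -
  obtain f where f: "f \<in> L2" "V = cls f" by (rule l2_cases)
  then show ?thesis using mult_l2_cls[of "\<lambda>_. 1" 1 f] by (simp add: E_def)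
qed

lemma E_inverse [simp]: "E t (E (- t) V) = V" "E (- t) (E t V) = V"
  by (simp_all add: E_E)

lemma norm_E [simp]: "norm (E t V) = norm V"
proof -
  have "norm (E t V) \<le> norm V" for t V
    unfolding E_def using bounded_linear_mult_l2(2)[OF E_symbol] by simp
  from this[of t V] this[of "- t" "E t V"] show ?thesis by simp
qed

lemma E_diff: "E t (V - W) = E t V - E t W"
  by (rule linear_diff[OF bounded_linear.linear[OF E_linear]])

lemma E_add: "E t (V + W) = E t V + E t W"
  by (rule linear_add[OF bounded_linear.linear[OF E_linear]])

text \<open>The symbol \<open>\<phi>\<close> is unbounded unless \<open>\<delta>\<^sub>2 = 0\<close>, so the group need not be continuous in the operator norm.
  Strong continuity is dominated convergence.\<close>
lemma E_strongly_continuous: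
  assumes "X \<longlonglongrightarrow> t" shows "(\<lambda>n. E (X n) V) \<longlonglongrightarrow> E t V"
proof -
  obtain f where f: "f \<in> L2" "V = cls f" by (rule l2_cases)
  note [measurable] = L2_measurable[OF f(1)]
  have "(\<lambda>n. cls (\<lambda>\<xi>. cis (- (\<phi> \<xi> * X n)) * f \<xi>)) \<longlonglongrightarrow> cls (\<lambda>\<xi>. cis (- (\<phi> \<xi> * t)) * f \<xi>)"
  proof (rule cls_tendsto_dominated(3)[OF _ _ f(1)])
    have "isCont cis y" for y
      using continuous_on_cis[OF continuous_on_id, of UNIV] by (simp add: continuous_on_eq_continuous_at)
    then have "(\<lambda>n. cis (- (\<phi> \<xi> * X n))) \<longlonglongrightarrow> cis (- (\<phi> \<xi> * t))" for \<xi>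
      by (rule isCont_tendsto_compose) (intro tendsto_intros assms)
    then show "AE \<xi> in lborel. (\<lambda>n. cis (- (\<phi> \<xi> * X n)) * f \<xi>) \<longlonglongrightarrow> cis (- (\<phi> \<xi> * t)) * f \<xi>"
      by (intro AE_I2 tendsto_mult_right)
  qed (measurable, simp add: norm_mult)
  then show ?thesis unfolding E_def f(2) by (simp only: mult_l2_cls[OF E_symbol f(1)])
qed

lemma E_continuous:
  fixes I :: "real set"
  assumes W: "continuous_on I W" and \<sigma>: "continuous_on I \<sigma>"
  shows "continuous_on I (\<lambda>t. E (\<sigma> t) (W t))"
  unfolding continuous_on_sequentially
proof (intro allI ballI impI)
  fix X :: "nat \<Rightarrow> real" and t assume t: "t \<in> I" and X: "(\<forall>n. X n \<in> I) \<and> X \<longlonglongrightarrow> t"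
  have W_lim: "(\<lambda>n. W (X n)) \<longlonglongrightarrow> W t" and \<sigma>_lim: "(\<lambda>n. \<sigma> (X n)) \<longlonglongrightarrow> \<sigma> t"
    using W \<sigma> X t unfolding continuous_on_sequentially o_def by blast+
  have "(\<lambda>n. E (\<sigma> (X n)) (W (X n) - W t)) \<longlonglongrightarrow> 0"
    using tendsto_norm_zero[OF LIM_zero[OF W_lim]] by (subst tendsto_norm_zero_iff[symmetric]) simp
  from tendsto_add[OF this E_strongly_continuous[OF \<sigma>_lim, of "W t"]]
  show "((\<lambda>t. E (\<sigma> t) (W t)) \<circ> X) \<longlonglongrightarrow> E (\<sigma> t) (W t)"
    by (simp add: o_def E_diff)
qed

lemma S_sob:
  assumes f: "f \<in> Hs s"
  shows "S t f \<in> Hs s" "sob s (S t f) = E t (sob s f)"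
proof -
  have "S t = multiplier (\<lambda>\<xi>. cis (- (\<phi> \<xi> * t)))"
    unfolding evolution_def cis_conv_exp by simp
  then show "S t f \<in> Hs s" "sob s (S t f) = E t (sob s f)"
    using multiplier_bounded[OF f E_symbol] by (simp_all add: E_def)
qed

definition lift :: "l2 \<Rightarrow> real \<Rightarrow> complex" where
  "lift V = (SOME f. f \<in> Hs s \<and> sob s f = V)"

definition NV :: "l2 \<Rightarrow> l2" where
  "NV V = sob s (NL (lift V))"

lemma lift: "lift V \<in> Hs s" "sob s (lift V) = V"
proof -
  have "\<exists>f. f \<in> Hs s \<and> sob s f = V" by (rule sob_surj[OF s0(1), of V]) blast
  then have "lift V \<in> Hs s \<and> sob s (lift V) = V" unfolding lift_def by (rule someI_ex)
  then show "lift V \<in> Hs s" "sob s (lift V) = V" by auto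
qed

text \<open>The nonlinear term is independent of the representative, by the Lipschitz estimate at distance 0.\<close>
lemma NV_sob:
  assumes f: "f \<in> Hs s" shows "NV (sob s f) = sob s (NL f)"
  using NL_Lipschitz[OF lift(1)[of "sob s f"] f, of "norm (sob s f)"] by (simp add: NV_def lift)

lemma NV_Lipschitz:
  "norm V \<le> R \<Longrightarrow> norm W \<le> R \<Longrightarrow> norm (NV V - NV W) \<le> lip_const * (R * (1 + R)) * norm (V - W)"
  using NL_Lipschitz[OF lift(1)[of V] lift(1)[of W], of R] by (simp add: NV_def lift)

lemma NV_0: "NV 0 = 0"
proof -
  have f: "lift 0 \<in> Hs s" and 0: "norm (sob s (lift 0)) = 0" by (simp_all add: lift)
  have 1: "norm (sob (s - 1) (lift 0)) = 0"
    using Hs_mono(2)[OF f s0(3)] 0 norm_ge_zero[of "sob (s - 1) (lift 0)"] by linarith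
  have 2: "norm (sob (s - 1) (deriv_x (lift 0))) = 0"
    using deriv_x_spec(3)[OF f s] 0 norm_ge_zero[of "sob (s - 1) (deriv_x (lift 0))"] by linarith
  show ?thesis
    unfolding NV_def NL_Hs(2)[OF f]
    using M\<tau>_square(5)[OF f f] M\<psi>_cube(5)[OF f f] M\<psi>_deriv(5)[OF f f] unfolding 0 1 2 by simp
qed

lemma continuous_on_NV: "continuous_on UNIV NV"
  unfolding continuous_on_eq_continuous_at[OF open_UNIV]
proof
  fix V :: l2
  let ?R = "norm V + 1"
  let ?L = "lip_const * (?R * (1 + ?R))"
  have "((\<lambda>W. NV W - NV V) \<longlongrightarrow> 0) (at V)"
  proof (rule Lim_null_comparison)
    show "eventually (\<lambda>W. norm (NV W - NV V) \<le> ?L * norm (W - V)) (at V)"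
      unfolding eventually_at
    proof (intro exI[of _ 1] conjI ballI impI)
      fix W assume "W \<noteq> V \<and> dist W V < 1"
      then have "norm W \<le> ?R" using norm_triangle_ineq2[of W V] by (simp add: dist_norm)
      then show "norm (NV W - NV V) \<le> ?L * norm (W - V)" by (intro NV_Lipschitz) auto
    qed simp
    have "((\<lambda>W. ?L * norm (W - V)) \<longlongrightarrow> ?L * norm (V - V)) (at V)"
      by (intro tendsto_intros)
    then show "((\<lambda>W. ?L * norm (W - V)) \<longlongrightarrow> 0) (at V)" by simp
  qed
  then show "isCont NV V" by (simp add: isCont_def LIM_zero_iff)
qed

abbreviation "rot \<equiv> mult_l2 (\<lambda>_. - \<i>)"

lemma rot_symbol: "(\<lambda>_. - \<i>) \<in> borel_measurable (borel :: real measure)" "\<And>x::real. norm (- \<i>) \<le> 1"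
  by simp_all

lemma rot_linear: "bounded_linear rot"
  by (rule bounded_linear_mult_l2(1)[OF rot_symbol])

lemma norm_rot: "norm (rot V) \<le> norm V"
  using bounded_linear_mult_l2(2)[OF rot_symbol, of V] by simp

lemma rot_E: "rot (E t V) = E t (rot V)"
proof -
  obtain f where f: "f \<in> L2" "V = cls f" by (rule l2_cases)
  show ?thesis
    unfolding E_def f(2)
    by (simp only: mult_l2_cls[OF E_symbol] mult_l2_cls[OF rot_symbol] L2_bounded_mult[OF _ E_symbol]
        L2_bounded_mult[OF _ rot_symbol] f(1) mult.left_commute[of "- \<i>"])
qed

text \<open>The right-hand side in the unknown \<open>W t = E (- t) (V t)\<close>. In this picture the group only
  enters the nonlinear term, and the integral equation is an ordinary differential equation.\<close>
definition G :: "real \<Rightarrow> l2 \<Rightarrow> l2" where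
  "G t W = E (- t) (rot (NV (E t W)))"

lemma E_G: "E t (G r W) = rot (E (t - r) (NV (E r W)))"
  by (simp add: G_def E_E rot_E)

lemma real_sym_E: "real_sym (E t V) = E t (real_sym V)"
  unfolding E_def by (rule real_sym_mult_l2[OF E_symbol]) (simp add: cis_cnj symbols_odd)

lemma real_sym_rot_NV:
  assumes V: "real_sym V = V" shows "real_sym (rot (NV V)) = rot (NV V)"
proof -
  obtain \<eta> where \<eta>: "(\<lambda>x. complex_of_real (\<eta> x)) \<in> Hs s" "sob s (\<lambda>x. complex_of_real (\<eta> x)) = V"
    by (rule real_sob_surj[OF s0(1) V])
  let ?f = "\<lambda>x. complex_of_real (\<eta> x)"
  have "AE x in lborel. cnj (- \<i> * NL ?f x) = - \<i> * NL ?f x"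
    by (rule NL_imaginary[OF \<eta>(1)]) simp
  then have "real_sym (sob s (\<lambda>x. - \<i> * NL ?f x)) = sob s (\<lambda>x. - \<i> * NL ?f x)"
    by (rule real_sym_sob_iff[OF Hs_cmult(1)[OF NL_Hs(1)[OF \<eta>(1)]], THEN iffD2])
  then show ?thesis
    using Hs_cmult(2)[OF NL_Hs(1)[OF \<eta>(1)], of "- \<i>"] NV_sob[OF \<eta>(1)] \<eta>(2) by simp
qed

sublocale flow: local_flow G real_sym lip_const
proof (rule local_flow.intro)
  fix I :: "real set" and W :: "real \<Rightarrow> l2" assume W: "continuous_on I W"
  have id: "continuous_on I (\<lambda>t. t)" "continuous_on I (\<lambda>t. - t)"
    by (intro continuous_intros)+
  have "continuous_on I (\<lambda>t. rot (NV (E t (W t))))"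
    by (intro bounded_linear.continuous_on[OF rot_linear]
        continuous_on_compose2[OF continuous_on_NV E_continuous[OF W id(1)]]) simp
  from E_continuous[OF this id(2)]
  show "continuous_on I (\<lambda>t. G t (W t))" by (simp only: G_def)
next
  fix t V W R assume "norm (V :: l2) \<le> R" "norm (W :: l2) \<le> R"
  then have "norm (NV (E t V) - NV (E t W)) \<le> lip_const * (R * (1 + R)) * norm (E t V - E t W)"
    by (intro NV_Lipschitz) simp_all
  moreover have "norm (G t V - G t W) \<le> norm (NV (E t V) - NV (E t W))"
    using norm_rot[of "NV (E t V) - NV (E t W)"]
    by (simp add: G_def E_diff[symmetric] linear_diff[OF bounded_linear.linear[OF rot_linear]])
  ultimately show "norm (G t V - G t W) \<le> lip_const * (R * (1 + R)) * norm (V - W)"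
    by (simp add: E_diff[symmetric])
next
  fix t
  show "G t 0 = 0"
    using linear_0[OF bounded_linear.linear[OF E_linear]] linear_0[OF bounded_linear.linear[OF rot_linear]]
    by (simp add: G_def NV_0)
next
  fix t V assume "real_sym V = V"
  then show "real_sym (G t V) = G t V"
    by (simp add: G_def real_sym_E real_sym_rot_NV)
qed (rule lip_const_pos, rule bounded_linear_real_sym)

abbreviation "soln \<equiv> solution_on \<gamma>\<^sub>1 \<gamma>\<^sub>2 \<delta>\<^sub>1 \<delta>\<^sub>2 \<gamma> s"
abbreviation "msoln \<equiv> maximal_solution \<gamma>\<^sub>1 \<gamma>\<^sub>2 \<delta>\<^sub>1 \<delta>\<^sub>2 \<gamma> s"

definition sobR :: "(real \<Rightarrow> real) \<Rightarrow> l2" where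
  "sobR f = sob s (\<lambda>x. complex_of_real (f x))"

abbreviation HsR :: "(real \<Rightarrow> real) \<Rightarrow> bool" where
  "HsR f \<equiv> (\<lambda>x. complex_of_real (f x)) \<in> Hs s"

lemma real_sym_sobR: "HsR f \<Longrightarrow> real_sym (sobR f) = sobR f"
  by (simp add: sobR_def real_sym_sob_iff)

lemma sobR_eq_iff: "HsR f \<Longrightarrow> HsR g \<Longrightarrow> sobR f = sobR g \<longleftrightarrow> (AE x in lborel. f x = g x)"
  by (simp add: sobR_def sob_eq_iff)

lemma integrand_Hs:
  assumes "HsR f"
  shows "S t (NL (\<lambda>x. complex_of_real (f x))) \<in> Hs s"
    "sob s (S t (NL (\<lambda>x. complex_of_real (f x)))) = E t (NV (sobR f))"
  using S_sob[OF NL_Hs(1)[OF assms]] NV_sob[OF assms] by (simp_all add: sobR_def)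

lemma duhamel_iff:
  assumes f: "HsR f" and g: "HsR g" and w: "w \<in> Hs s"
  shows "(AE x in lborel. complex_of_real (f x) = S t (\<lambda>y. complex_of_real (g y)) x - \<i> * w x)
    \<longleftrightarrow> sobR f = E t (sobR g) + rot (sob s w)"
proof -
  note Sg = S_sob[OF g, of t] and iw = Hs_cmult[OF w, of "- \<i>"]
  note sum = Hs_add[OF Sg(1) iw(1)]
  show ?thesis
    using sob_eq_iff[OF f sum(1)] unfolding sum(2) Sg(2) iw(2) by (simp add: sobR_def)
qed

text \<open>Applying \<open>E (- t)\<close> to the integral equation at time \<open>t\<close> removes \<open>t\<close> from the integrand.\<close>
lemma solution_imp_solves:
  assumes g: "HsR g" and sol: "soln g r \<eta>"
  shows "\<And>t. t \<in> {0..r} \<Longrightarrow> HsR (\<eta> t)" "flow.solves 0 (sobR g) r (\<lambda>t. E (- t) (sobR (\<eta> t)))"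
proof -
  let ?W = "\<lambda>t. E (- t) (sobR (\<eta> t))"
  have cont: "continuous_Hs s {0..r} (\<lambda>t x. complex_of_real (\<eta> t x))"
    and eqn: "\<And>t. t \<in> {0..r} \<Longrightarrow> \<exists>w. has_Hs_integral s (\<lambda>t'. S (t - t') (NL (\<lambda>x. complex_of_real (\<eta> t' x)))) w 0 t \<and>
      (AE x in lborel. complex_of_real (\<eta> t x) = S t (\<lambda>y. complex_of_real (g y)) x - \<i> * w x)"
    using sol unfolding solution_on_def by blast+
  show H: "\<And>t. t \<in> {0..r} \<Longrightarrow> HsR (\<eta> t)" using cont by (simp add: continuous_Hs_iff)
  show "flow.solves 0 (sobR g) r ?W"
  proof (rule flow.solvesI)
    show "continuous_on {0..r} ?W"
      using cont by (intro E_continuous continuous_intros) (simp add: continuous_Hs_iff sobR_def)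
    fix t assume t: "t \<in> {0..r}"
    show "real_sym (?W t) = ?W t" by (simp add: real_sym_E real_sym_sobR H[OF t])
    obtain w where int: "has_Hs_integral s (\<lambda>t'. S (t - t') (NL (\<lambda>x. complex_of_real (\<eta> t' x)))) w 0 t"
      and ae: "AE x in lborel. complex_of_real (\<eta> t x) = S t (\<lambda>y. complex_of_real (g y)) x - \<i> * w x"
      using eqn[OF t] by blast
    have w: "w \<in> Hs s" using int by (simp add: has_Hs_integral_def)
    have "((\<lambda>t'. E (t - t') (NV (sobR (\<eta> t')))) has_integral sob s w) {0..t}"
    proof (rule has_integral_eq[OF _ has_Hs_integral_imp_has_integral[OF int]])
      fix t' assume "t' \<in> {0..t}"
      then show "sob s (S (t - t') (NL (\<lambda>x. complex_of_real (\<eta> t' x)))) = E (t - t') (NV (sobR (\<eta> t')))"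
        using t by (intro integrand_Hs(2) H) auto
    qed
    from has_integral_linear[OF has_integral_linear[OF this rot_linear] E_linear[of "- t"]]
    have "((\<lambda>t'. G t' (?W t')) has_integral E (- t) (rot (sob s w))) {0..t}"
      by (simp add: o_def G_def E_E rot_E)
    then have "integral {0..t} (\<lambda>t'. G t' (?W t')) = E (- t) (rot (sob s w))"
      by (rule integral_unique)
    moreover have "sobR (\<eta> t) = E t (sobR g) + rot (sob s w)"
      using ae duhamel_iff[OF H[OF t] g w] by simp
    ultimately show "?W t = sobR g + integral {0..t} (\<lambda>t'. G t' (?W t'))"
      by (simp add: E_add)
  qed
qed

lemma solves_imp_solution:
  assumes g: "HsR g" and W: "flow.solves 0 (sobR g) r W"
    and \<eta>: "\<And>t. t \<in> {0..r} \<Longrightarrow> HsR (\<eta> t)" "\<And>t. t \<in> {0..r} \<Longrightarrow> sobR (\<eta> t) = E t (W t)"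
  shows "soln g r \<eta>"
proof -
  have W_cont: "continuous_on {0..r} (\<lambda>t. E t (W t))"
    by (intro E_continuous flow.solvesD(1)[OF W] continuous_intros)
  then have sob_cont: "continuous_on {0..r} (\<lambda>t. sobR (\<eta> t))"
    by (rule continuous_on_eq) (simp add: \<eta>)
  then have cont: "continuous_Hs s {0..r} (\<lambda>t x. complex_of_real (\<eta> t x))"
    using \<eta>(1) by (simp add: continuous_Hs_iff sobR_def)
  have "\<exists>w. has_Hs_integral s (\<lambda>t'. S (t - t') (NL (\<lambda>x. complex_of_real (\<eta> t' x)))) w 0 t \<and>
      (AE x in lborel. complex_of_real (\<eta> t x) = S t (\<lambda>y. complex_of_real (g y)) x - \<i> * w x)"
    if t: "t \<in> {0..r}" for t
  proof -
    let ?F = "\<lambda>t'. S (t - t') (NL (\<lambda>x. complex_of_real (\<eta> t' x)))"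
    have sub: "{0..t} \<subseteq> {0..r}" using t by auto
    have F: "?F t' \<in> Hs s" "sob s (?F t') = E (t - t') (NV (sobR (\<eta> t')))" if "t' \<in> {0..t}" for t'
      using integrand_Hs[OF \<eta>(1)] that sub by auto
    have "continuous_on {0..t} (\<lambda>t'. E (t - t') (NV (sobR (\<eta> t'))))"
      by (intro E_continuous continuous_on_compose2[OF continuous_on_NV continuous_on_subset[OF sob_cont sub]] continuous_intros)
        simp
    then have F_cont: "continuous_on {0..t} (\<lambda>t'. sob s (?F t'))"
      by (rule continuous_on_eq) (simp add: F)
    obtain w where w: "w \<in> Hs s" "sob s w = integral {0..t} (\<lambda>t'. sob s (?F t'))"
      by (rule sob_surj[OF s0(1)])
    have int: "has_Hs_integral s ?F w 0 t"
      by (rule has_Hs_integral_continuous[OF F(1) F_cont w])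
    have "rot (sob s w) = integral {0..t} (rot \<circ> (\<lambda>t'. sob s (?F t')))"
      unfolding w(2) by (rule integral_linear[OF integrable_continuous_real[OF F_cont] rot_linear, symmetric])
    also have "\<dots> = integral {0..t} (E t \<circ> (\<lambda>t'. G t' (W t')))"
      using sub by (intro integral_cong) (auto simp: F \<eta> E_G)
    also have "\<dots> = E t (integral {0..t} (\<lambda>t'. G t' (W t')))"
      using t by (intro integral_linear[OF flow.solves_integrable[OF flow.solvesD(1)[OF W]] E_linear]) simp
    finally have "sobR (\<eta> t) = E t (sobR g) + rot (sob s w)"
      using flow.solvesD(3)[OF W t] \<eta>(2)[OF t] by (simp add: E_add)
    then show ?thesis using int duhamel_iff[OF \<eta>(1)[OF t] g w(1)] by blast
  qed
  then show ?thesis using cont unfolding solution_on_def by blast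
qed

lemma solves_realise:
  assumes "\<And>t. t \<in> A \<Longrightarrow> real_sym (W t) = W t"
  shows "\<exists>\<eta>. \<forall>t\<in>A. HsR (\<eta> t) \<and> sobR (\<eta> t) = E t (W t)"
proof (rule bchoice, rule ballI)
  fix t assume "t \<in> A"
  then have sym: "real_sym (E t (W t)) = E t (W t)" using assms by (simp add: real_sym_E)
  obtain f where "HsR f" "sob s (\<lambda>x. complex_of_real (f x)) = E t (W t)"
    by (rule real_sob_surj[OF s0(1) sym])
  then show "\<exists>f. HsR f \<and> sobR f = E t (W t)" unfolding sobR_def by blast
qed

lemma maximal_solution_exists:
  assumes g: "HsR g"
  shows "\<exists>T \<eta>. msoln g T \<eta>"
proof -
  obtain T W where T: "0 < T" and W: "\<And>r. ereal r < T \<Longrightarrow> flow.solves 0 (sobR g) r W"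
    and max: "\<And>r W'. T \<le> ereal r \<Longrightarrow> \<not> flow.solves 0 (sobR g) r W'"
    using flow.maximal_existence[OF real_sym_sobR[OF g]] by blast
  have "real_sym (W t) = W t" if "t \<in> {t. 0 \<le> t \<and> ereal t < T}" for t
    using that flow.solvesD(2)[OF W[of t], of t] by simp
  from solves_realise[of _ W, OF this] obtain \<eta> where
    \<eta>: "\<forall>t\<in>{t. 0 \<le> t \<and> ereal t < T}. HsR (\<eta> t) \<and> sobR (\<eta> t) = E t (W t)"
    by blast
  have "msoln g T \<eta>"
    unfolding maximal_solution_def
  proof (intro conjI allI impI T notI)
    fix r assume r: "0 < r" "ereal r < T"
    have "ereal t < T" if "t \<in> {0..r}" for t
      using that r(2) by (intro le_less_trans[OF _ r(2)]) simp
    then show "soln g r \<eta>"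
      using \<eta> by (intro solves_imp_solution[OF g W[OF r(2)]]) auto
  next
    assume "\<exists>r \<zeta>. T \<le> ereal r \<and> soln g r \<zeta> \<and> (\<forall>t\<ge>0. ereal t < T \<longrightarrow> (AE x in lborel. \<zeta> t x = \<eta> t x))"
    then show False using solution_imp_solves(2)[OF g] max by blast
  qed
  then show ?thesis by blast
qed

text \<open>The local solution \<open>W\<close> agrees with \<open>\<eta>\<close> as long as both exist. If \<open>T \<le> h\<close>, then \<open>W\<close> is a solution on
  \<open>[0, h]\<close> that extends \<open>\<eta>\<close> up to or beyond \<open>T\<close>, against maximality.\<close>
lemma maximal_solution_bounds:
  assumes g: "HsR g" and N: "N = norm (sobR g)" "0 < N" and \<eta>: "msoln g T \<eta>"
    and h: "h = 1 / (8 * lip_const * N * (1 + N))"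
  shows "ereal h < T" "\<And>t. t \<in> {0..h} \<Longrightarrow> HsR (\<eta> t) \<and> norm (sobR (\<eta> t)) \<le> 2 * N"
proof -
  have hpos: "0 < h" unfolding h using lip_const_pos N(2) by simp
  obtain W where W: "flow.solves 0 (sobR g) h W" and bound: "\<And>t. t \<in> {0..h} \<Longrightarrow> norm (W t) \<le> 2 * N"
    using flow.local_existence[of "sobR g" N 0] real_sym_sobR[OF g] N by (auto simp: h)
  have sol: "\<And>r. 0 < r \<Longrightarrow> ereal r < T \<Longrightarrow> soln g r \<eta>"
    and max: "\<And>r \<zeta>. T \<le> ereal r \<Longrightarrow> soln g r \<zeta> \<Longrightarrow> (\<And>t. 0 \<le> t \<Longrightarrow> ereal t < T \<Longrightarrow> AE x in lborel. \<zeta> t x = \<eta> t x) \<Longrightarrow> False"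
    and T: "0 < T"
    using \<eta> unfolding maximal_solution_def by blast+
  have agree: "HsR (\<eta> t) \<and> sobR (\<eta> t) = E t (W t)" if t: "t \<in> {0..h}" "ereal t < T" for t
  proof -
    obtain r where r: "t < r" "ereal r < T"
      using ereal_dense2[OF t(2)] by auto
    have tr: "t \<in> {0..r}" and r0: "0 < r" using t r by auto
    note A = solution_imp_solves[OF g sol[OF r0 r(2)]]
    have "E (- t) (sobR (\<eta> t)) = W t"
      by (rule flow.solves_unique[OF flow.solves_restrict[OF A(2)] flow.solves_restrict[OF W], of t]) (use t r in auto)
    then have "E t (E (- t) (sobR (\<eta> t))) = E t (W t)" by simp
    then show ?thesis using A(1)[OF tr] by simp
  qed
  show "ereal h < T"
  proof (rule ccontr)
    assume "\<not> ereal h < T"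
    then have Th: "T \<le> ereal h" by simp
    obtain \<zeta> where "\<forall>t\<in>{0..h}. HsR (\<zeta> t) \<and> sobR (\<zeta> t) = E t (W t)"
      using solves_realise[of "{0..h}" W, OF flow.solvesD(2)[OF W]] by blast
    then have \<zeta>: "\<And>t. t \<in> {0..h} \<Longrightarrow> HsR (\<zeta> t)" "\<And>t. t \<in> {0..h} \<Longrightarrow> sobR (\<zeta> t) = E t (W t)"
      by blast+
    show False
    proof (rule max[OF Th solves_imp_solution[OF g W \<zeta>]])
      fix t assume t: "0 \<le> t" "ereal t < T"
      then have th: "t \<in> {0..h}" using less_le_trans[OF t(2) Th] by simp
      show "AE x in lborel. \<zeta> t x = \<eta> t x"
        using sobR_eq_iff[OF \<zeta>(1)[OF th] conjunct1[OF agree[OF th t(2)]]] \<zeta>(2)[OF th] agree[OF th t(2)]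
        by (simp only: simp_thms)
    qed
  qed
  then show "HsR (\<eta> t) \<and> norm (sobR (\<eta> t)) \<le> 2 * N" if t: "t \<in> {0..h}" for t
  proof -
    have "ereal t < T" using t by (intro le_less_trans[OF _ \<open>ereal h < T\<close>]) simp
    from agree[OF t this] bound[OF t] show ?thesis by simp
  qed
qed

end

theorem mainTheorem2:
  fixes \<theta> lam \<mu> lam\<^sub>1 \<mu>\<^sub>1 \<rho> :: real
    and a b c d a\<^sub>1 b\<^sub>1 c\<^sub>1 d\<^sub>1 :: real
    and \<gamma>\<^sub>1 \<gamma>\<^sub>2 \<delta>\<^sub>1 \<delta>\<^sub>2 \<gamma> :: real
  assumes "0 \<le> \<theta>" "\<theta> \<le> 1"
    and "a = 1/2 * (\<theta>^2 - 1/3) * lam"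
    and "b = 1/2 * (\<theta>^2 - 1/3) * (1 - lam)"
    and "c = 1/2 * (1 - \<theta>^2) * \<mu>"
    and "d = 1/2 * (1 - \<theta>^2) * (1 - \<mu>)"
    and "a\<^sub>1 = - (1/4 * (\<theta>^2 - 1/3)^2 * (1 - lam)) + 5/24 * (\<theta>^2 - 1/5)^2 * lam\<^sub>1"
    and "b\<^sub>1 = - (5/24 * (\<theta>^2 - 1/5)^2 * (1 - lam\<^sub>1))"
    and "c\<^sub>1 = 5/24 * (1 - \<theta>^2) * (\<theta>^2 - 1/5) * (1 - \<mu>\<^sub>1)"
    and "d\<^sub>1 = - (1/4 * (1 - \<theta>^2)^2 * \<mu>) - 5/24 * (1 - \<theta>^2) * (\<theta>^2 - 1/5) * \<mu>\<^sub>1"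
    and "\<gamma>\<^sub>1 = 1/2 * (b + d - \<rho>)"
    and "\<gamma>\<^sub>2 = 1/2 * (a + c + \<rho>)"
    and "\<delta>\<^sub>1 = 1/4 * (2 * (b\<^sub>1 + d\<^sub>1) - (b - d + \<rho>) * (1/6 - a - d) - d * (c - a + \<rho>))"
    and "\<delta>\<^sub>2 = 1/4 * (2 * (a\<^sub>1 + c\<^sub>1) - (c - a + \<rho>) * (1/6 - a) + 1/3 * \<rho>)"
    and "\<gamma> = 1/24 * (5 - 9 * (b + d) + 9 * \<rho>)"
    and "\<gamma>\<^sub>1 > 0" "\<delta>\<^sub>1 > 0"
  shows "\<forall>s\<ge>1. \<exists>C>0. \<forall>\<eta>\<^sub>0 :: real \<Rightarrow> real.
    (\<lambda>x. complex_of_real (\<eta>\<^sub>0 x)) \<in> Hs s \<and> \<not> (AE x in lborel. \<eta>\<^sub>0 x = 0) \<longrightarrow>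
    (let N = Hs_norm s (\<lambda>x. complex_of_real (\<eta>\<^sub>0 x));
         Tbar = 1 / (8 * C * N * (1 + N))
     in (\<exists>T \<eta>. maximal_solution \<gamma>\<^sub>1 \<gamma>\<^sub>2 \<delta>\<^sub>1 \<delta>\<^sub>2 \<gamma> s \<eta>\<^sub>0 T \<eta>) \<and>
        (\<forall>T \<eta>. maximal_solution \<gamma>\<^sub>1 \<gamma>\<^sub>2 \<delta>\<^sub>1 \<delta>\<^sub>2 \<gamma> s \<eta>\<^sub>0 T \<eta> \<longrightarrow>
           ereal Tbar \<le> T \<and>
           (\<forall>t\<in>{0..Tbar}. ereal t < T \<and> Hs_norm s (\<lambda>x. complex_of_real (\<eta> t x)) \<le> 2 * N)))"
proof (intro allI impI)
  fix s :: real assume "1 \<le> s"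
  then interpret wave_equation \<gamma>\<^sub>1 \<gamma>\<^sub>2 \<delta>\<^sub>1 \<delta>\<^sub>2 \<gamma> s
    using \<open>\<gamma>\<^sub>1 > 0\<close> \<open>\<delta>\<^sub>1 > 0\<close> by unfold_locales
  show "\<exists>C>0. \<forall>\<eta>\<^sub>0. HsR \<eta>\<^sub>0 \<and> \<not> (AE x in lborel. \<eta>\<^sub>0 x = 0) \<longrightarrow>
    (let N = Hs_norm s (\<lambda>x. complex_of_real (\<eta>\<^sub>0 x)); Tbar = 1 / (8 * C * N * (1 + N))
     in (\<exists>T \<eta>. msoln \<eta>\<^sub>0 T \<eta>) \<and>
        (\<forall>T \<eta>. msoln \<eta>\<^sub>0 T \<eta> \<longrightarrow> ereal Tbar \<le> T \<and>
           (\<forall>t\<in>{0..Tbar}. ereal t < T \<and> Hs_norm s (\<lambda>x. complex_of_real (\<eta> t x)) \<le> 2 * N)))"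
    (is "\<exists>C>0. \<forall>\<eta>\<^sub>0. _ \<longrightarrow> ?Q C \<eta>\<^sub>0")
  proof (intro exI[of _ lip_const] conjI allI impI)
    fix \<eta>\<^sub>0
    assume "HsR \<eta>\<^sub>0 \<and> \<not> (AE x in lborel. \<eta>\<^sub>0 x = 0)"
    then have g: "HsR \<eta>\<^sub>0" and nz: "\<not> (AE x in lborel. \<eta>\<^sub>0 x = 0)" by auto
    define N where "N = norm (sobR \<eta>\<^sub>0)"
    define h where "h = 1 / (8 * lip_const * N * (1 + N))"
    have norm_eq: "Hs_norm s (\<lambda>x. complex_of_real (f x)) = norm (sobR f)" if "HsR f" for f
      using Hs_norm_sob[OF that] by (simp add: sobR_def)
    have zero: "HsR (\<lambda>x. 0)" "sobR (\<lambda>x. 0) = 0" using Hs_zero[of s] by (simp_all add: sobR_def)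
    have "sobR \<eta>\<^sub>0 \<noteq> 0" using sobR_eq_iff[OF g zero(1)] nz zero(2) by simp
    then have N: "0 < N" by (simp add: N_def)
    have "ereal h \<le> T \<and> (\<forall>t\<in>{0..h}. ereal t < T \<and> Hs_norm s (\<lambda>x. complex_of_real (\<eta> t x)) \<le> 2 * N)"
      if \<eta>: "msoln \<eta>\<^sub>0 T \<eta>" for T \<eta>
    proof (intro conjI ballI)
      note B = maximal_solution_bounds[OF g N_def N \<eta> h_def]
      show "ereal h \<le> T" using B(1) by simp
      fix t assume t: "t \<in> {0..h}"
      show "ereal t < T" using t by (intro le_less_trans[OF _ B(1)]) simp
      show "Hs_norm s (\<lambda>x. complex_of_real (\<eta> t x)) \<le> 2 * N" using B(2)[OF t] norm_eq by simp
    qed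
    then show "?Q lip_const \<eta>\<^sub>0"
      unfolding Let_def norm_eq[OF g] N_def[symmetric] h_def[symmetric]
      using maximal_solution_exists[OF g] by blast
  qed (rule lip_const_pos)
qed

end
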